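(* Let $c=2\pi\sqrt{5/12}$. Uniformly for all integers $m,n>0$ such that $m\le 2n$, $$D(m,n)\sim \frac{5c}{2^5\cdot 3}\,\frac{e^{c\sqrt{\min(m,2n-m)}}}{[\min(m,2n-m)]^2}\left(1+e^{-\frac{c|n-m|}{2\sqrt{\min(m,2n-m)}}}\right)^{-2}$$ as $\min(m,2n-m)\to\infty$. That is, for every $\varepsilon>0$ there is $N$ such that for all integers $m,n>0$ with $m\le 2n$ and $\min(m,2n-m)\ge N$, the ratio of the left-hand side to the right-hand side differs from $1$ by at most $\varepsilon$.
   Context: An integer partition is a non-increasing sequence $\lambda=(\lambda_1,\lambda_2,\dots)$ of non-negative integers; it is a partition of $n$ if $\lambda_1+\lambda_2+\cdots=n$ (so all but finitely many $\lambda_j$ are $0$). For partitions $\alpha=(\alpha_1,\alpha_2,\dots)$ and $\beta=(\beta_1,\beta_2,\dots)$, the pair $(\alpha,\beta)$ is a pair of partitions with steadily decreasing parts if $\min(\alpha_i,\beta_i)\ge \max(\alpha_{i+1},\beta_{i+1})$ for all integers $i\ge 1$. For integers $m,n\ge 0$, $\pi(m,n)$ is the number of pairs $(\alpha,\beta)$ with steadily decreasing parts such that $\alpha_1+\alpha_2+\cdots=m$ and $\beta_1+\beta_2+\cdots=n$. (In the claim, $\pi$ without arguments is the usual constant.) Define $D(m,n):=\pi(m,n)-\pi(m-1,n)$, with $\pi(-1,n):=0$. *)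

theory Defs
  imports Complex_Main
begin

text \<open>
  Partitions are sequences indexed from \<open>0\<close>: \<open>a i\<close> stands for the part written with index
  \<open>i + 1\<close> on paper. Summing over the (finite) support avoids sums over an infinite index set.
\<close>

definition is_partition_of :: "(nat \<Rightarrow> nat) \<Rightarrow> nat \<Rightarrow> bool" where
  "is_partition_of a n \<longleftrightarrow>
     (\<forall>i. a (Suc i) \<le> a i) \<and> finite {j. a j \<noteq> 0} \<and> (\<Sum>j | a j \<noteq> 0. a j) = n"

definition steadily_decreasing :: "(nat \<Rightarrow> nat) \<Rightarrow> (nat \<Rightarrow> nat) \<Rightarrow> bool" where
  "steadily_decreasing a b \<longleftrightarrow>
     (\<forall>i. min (a i) (b i) \<ge> max (a (Suc i)) (b (Suc i)))"

definition steady_pairs :: "nat \<Rightarrow> nat \<Rightarrow> ((nat \<Rightarrow> nat) \<times> (nat \<Rightarrow> nat)) set" where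
  "steady_pairs m n =
     {(a, b). is_partition_of a m \<and> is_partition_of b n \<and> steadily_decreasing a b}"

definition num_steady_pairs :: "nat \<Rightarrow> nat \<Rightarrow> nat" where
  "num_steady_pairs m n = card (steady_pairs m n)"

definition D :: "nat \<Rightarrow> nat \<Rightarrow> int" where
  "D m n = int (num_steady_pairs m n) - (if m = 0 then 0 else int (num_steady_pairs (m - 1) n))"

text \<open>The sets counted above are finite, so the cardinality is the intended one.\<close>

lemma finite_partitions: "finite {a. is_partition_of a n}"
proof (rule finite_subset)
  show "finite {a. \<forall>x. (x \<in> {..<n} \<longrightarrow> a x \<in> {..n}) \<and> (x \<notin> {..<n} \<longrightarrow> a x = (0::nat))}"
    by (rule finite_set_of_finite_funs) auto
  show "{a. is_partition_of a n} \<subseteq>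
        {a. \<forall>x. (x \<in> {..<n} \<longrightarrow> a x \<in> {..n}) \<and> (x \<notin> {..<n} \<longrightarrow> a x = (0::nat))}"
  proof (rule subsetI)
    fix a assume "a \<in> {a. is_partition_of a n}"
    then have mono: "\<And>i. a (Suc i) \<le> a i" and fin: "finite {j. a j \<noteq> 0}"
      and sum: "(\<Sum>j | a j \<noteq> 0. a j) = n"
      by (auto simp: is_partition_of_def)
    have "a x \<le> n" for x
    proof (cases "a x = 0")
      case False
      then have "a x \<le> (\<Sum>j | a j \<noteq> 0. a j)"
        using fin by (intro member_le_sum) auto
      with sum show ?thesis by simp
    qed simp
    moreover have "x < n" if nz: "a x \<noteq> 0" for x
    proof -
      have "a x \<le> a j" if "j \<le> x" for j
        using lift_Suc_antimono_le[of a j x] mono that by simp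
      with nz have sub: "{..x} \<subseteq> {j. a j \<noteq> 0}" by fastforce
      have "Suc x = card {..x}" by simp
      also have "\<dots> \<le> card {j. a j \<noteq> 0}" using fin sub by (rule card_mono)
      also have "\<dots> = (\<Sum>j | a j \<noteq> 0. 1)" by simp
      also have "\<dots> \<le> (\<Sum>j | a j \<noteq> 0. a j)" by (rule sum_mono) auto
      finally show ?thesis using sum by simp
    qed
    ultimately show "a \<in> {a. \<forall>x. (x \<in> {..<n} \<longrightarrow> a x \<in> {..n}) \<and> (x \<notin> {..<n} \<longrightarrow> a x = (0::nat))}"
      by fastforce
  qed
qed

lemma finite_steady_pairs: "finite (steady_pairs m n)"
  by (rule finite_subset[OF _ finite_cartesian_product[OF finite_partitions[of m] finite_partitions[of n]]])
     (auto simp: steady_pairs_def)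

end

theory Submission
  imports Defs "HOL-Probability.Sinc_Integral" "HOL-Real_Asymp.Real_Asymp"
begin

text \<open>
  Read row by row, a steadily decreasing pair is a partition together with a choice, in every
  row with distinct entries, of which of the two entries is larger; this gives a product formula
  for the generating function of \<open>\<pi>(m, n)\<close>. Multiplying by \<open>1 - x\<close> makes it symmetric
  under \<open>m \<mapsto> 2 n - m\<close>, and its diagonal \<open>\<bar>m - n\<bar> = r\<close> is the coefficient of
  \<open>z\<^sup>r\<close> of the crank generating function, up to a factor depending only on \<open>q = x y\<close>. Two
  applications of Euler's \<open>q\<close>-series identities turn this coefficient into the alternating sum
  \<open>T\<^sub>r(q) = \<Sum>\<^sub>i (-1)\<^sup>i q\<^bsup>i r + i (i + 1) / 2\<^esup> (1 - q\<^bsup>i + 1\<^esup>)\<close>. Hence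
  \<open>D(m, n)\<close> is the coefficient of \<open>q\<^sup>k\<close>, where \<open>k = min m (2 n - m)\<close>, in
  \<open>P(q) T\<^sub>r(q)\<close> with \<open>P = 1 / ((q; q)\<^sup>2 (q\<^sup>2; q\<^sup>2))\<close>.

  The saddle point method on the circle \<open>\<bar>q\<bar> = e\<^bsup>-t\<^esup>\<close>, with \<open>t = c / (2 \<surd>k)\<close>,
  gives the asymptotics: near the positive real axis
  \<open>T\<^sub>r(q) \<sim> t (1 + e\<^bsup>-r t\<^esup>)\<^bsup>-2\<^esup>\<close> uniformly in \<open>r\<close>, while \<open>P\<close> behaves like
  \<open>e\<^bsup>a / \<tau>\<^esup>\<close> with \<open>a = 5 \<pi>\<^sup>2 / 12\<close> and \<open>q = e\<^bsup>-\<tau>\<^esup>\<close>. Uniformity in \<open>m, n\<close> follows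
  by dominated convergence along an arbitrary sequence of counterexamples.
\<close>

text \<open>Origin of the constants: each of the two factors \<open>1 / (q; q)\<close> contributes
  pi^2 / (6 \<tau>) to log P, and the factor in q^2 half of that, whence a = 5 pi^2 / 12. The
  exponent k t + a / t is least at t = sqrt (a / k), with value 2 sqrt (a k) = c sqrt k. The power
  t^(3/2) of P, the power t of \<open>T\<^sub>r\<close> and the width t^(3/2) of the peak multiply
  to t^4 = a^2 / k^2. The obstacle is \<open>T\<^sub>r\<close>: for small r its terms reach size
  sqrt t while the sum has size t, so absolute values lose too much, and r may grow with k at any
  rate. A recurrence in r that contracts gives an error O(t^(3/2)) independent of r. No modular
  transformation of P is used. The peak is much narrower than t, so an error O(|Im \<tau>| / Re
  \<tau>) in comparing log P with its value on the real axis is harmless; only the real axis needs a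
  precise asymptotic formula, and there real analysis suffices. Away from the axis, exponential
  decay of P beats a trivial bound for \<open>T\<^sub>r\<close>.\<close>

subsection \<open>Infinite products and Euler's identities\<close>

text \<open>
  \<open>qprod q x\<close> is the infinite product \<open>(x; q)\<close>, that is, \<open>\<Prod>\<^sub>n (1 - q\<^sup>n x)\<close>. Through its logarithm
  it is determined by the functional equation \<open>qprod_rec\<close> and by continuity at \<open>0\<close>, so
  that no theory of infinite products is needed; this restricts \<open>x\<close> to the unit disc.
\<close>

definition log_qprod :: "complex \<Rightarrow> complex \<Rightarrow> complex" where
  "log_qprod q x = (\<Sum>m. x ^ Suc m / (of_nat (Suc m) * (1 - q ^ Suc m)))"

definition qprod :: "complex \<Rightarrow> complex \<Rightarrow> complex" where
  "qprod q x = exp (- log_qprod q x)"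

definition qfac :: "complex \<Rightarrow> nat \<Rightarrow> complex" where
  "qfac q n = (\<Prod>i<n. 1 - q ^ Suc i)"

lemma norm_power_Suc_less:
  fixes q :: complex
  assumes "norm q < 1"
  shows "norm (q ^ Suc m) \<le> norm q"
  using assms by (simp add: norm_mult norm_power mult_left_le power_le_one)

lemma norm_one_minus_power_ge:
  fixes q :: complex
  assumes "norm q < 1"
  shows "norm (1 - q ^ Suc m) \<ge> 1 - norm q"
proof -
  have "norm (1 - q ^ Suc m) \<ge> norm (1::complex) - norm (q ^ Suc m)"
    by (rule norm_triangle_ineq2)
  with norm_power_Suc_less[OF assms, of m] show ?thesis by simp
qed

lemma one_minus_power_nonzero:
  fixes q :: complex
  assumes "norm q < 1"
  shows "1 - q ^ Suc m \<noteq> 0"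
  using norm_one_minus_power_ge[OF assms, of m] assms by auto

lemma norm_log_qprod_term:
  fixes q x :: complex
  assumes "norm q < 1"
  shows "norm (x ^ Suc m / (of_nat (Suc m) * (1 - q ^ Suc m))) \<le> norm x / (1 - norm q) * norm x ^ m"
proof -
  have "1 * (1 - norm q) \<le> norm (of_nat (Suc m) :: complex) * norm (1 - q ^ Suc m)"
    using norm_one_minus_power_ge[OF assms, of m] assms
    by (intro mult_mono) (auto simp: norm_of_nat simp del: of_nat_Suc)
  hence "norm (x ^ Suc m / (of_nat (Suc m) * (1 - q ^ Suc m))) \<le> norm x ^ Suc m / (1 - norm q)"
    unfolding norm_divide norm_mult norm_power using assms by (intro divide_left_mono) auto
  thus ?thesis by simp
qed

lemma summable_log_qprod:
  fixes q x :: complex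
  assumes "norm q < 1" "norm x < 1"
  shows "summable (\<lambda>m. x ^ Suc m / (of_nat (Suc m) * (1 - q ^ Suc m)))"
  by (rule summable_comparison_test'[where g = "\<lambda>m. norm x / (1 - norm q) * norm x ^ m" and N = 0])
     (use assms norm_log_qprod_term[OF assms(1)] in \<open>auto intro!: summable_mult summable_geometric\<close>)

lemma norm_log_qprod_le:
  assumes "norm q < 1" "norm x < 1"
  shows "norm (log_qprod q x) \<le> norm x / (1 - norm q) / (1 - norm x)"
proof -
  have "norm (log_qprod q x) \<le> (\<Sum>m. norm x / (1 - norm q) * norm x ^ m)"
    unfolding log_qprod_def using assms
    by (intro norm_suminf_le norm_log_qprod_term summable_mult summable_geometric) auto
  also have "\<dots> = norm x / (1 - norm q) * (1 / (1 - norm x))"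
    using assms by (subst suminf_mult) (auto simp: suminf_geometric intro!: summable_geometric)
  finally show ?thesis by simp
qed

lemma qprod_nonzero [simp]: "qprod q x \<noteq> 0"
  by (simp add: qprod_def)

lemma norm_mult_less_one:
  fixes q x :: complex
  assumes "norm q < 1" "norm x < 1"
  shows "norm (q * x) < 1"
  using mult_strict_mono'[of "norm q" 1 "norm x" 1] assms by (simp add: norm_mult)

text \<open>In the difference of the two logarithmic series, \<open>x ^ m - (q * x) ^ m\<close> is
  \<open>x ^ m\<close> times \<open>1 - q ^ m\<close>, which cancels the denominator and leaves the
  series of \<open>- ln (1 - x)\<close>.\<close>

lemma qprod_rec:
  assumes q: "norm q < 1" and x: "norm x < 1"
  shows "qprod q x = (1 - x) * qprod q (q * x)"
proof -
  have qx: "norm (q * x) < 1" using norm_mult_less_one assms by blast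
  have s: "(\<lambda>m. x ^ Suc m / (of_nat (Suc m) * (1 - q ^ Suc m)) -
             (q * x) ^ Suc m / (of_nat (Suc m) * (1 - q ^ Suc m))) sums
           (log_qprod q x - log_qprod q (q * x))"
    unfolding log_qprod_def
    by (intro sums_diff summable_sums summable_log_qprod q x qx)
  have "x ^ Suc m / (of_nat (Suc m) * (1 - q ^ Suc m)) -
             (q * x) ^ Suc m / (of_nat (Suc m) * (1 - q ^ Suc m)) = x ^ Suc m / of_nat (Suc m)" for m
  proof -
    have "x ^ Suc m / (of_nat (Suc m) * (1 - q ^ Suc m)) -
             (q * x) ^ Suc m / (of_nat (Suc m) * (1 - q ^ Suc m))
        = (x ^ Suc m * (1 - q ^ Suc m)) / (of_nat (Suc m) * (1 - q ^ Suc m))"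
      by (simp only: power_mult_distrib diff_divide_distrib [symmetric]) (simp add: algebra_simps)
    also have "\<dots> = x ^ Suc m / of_nat (Suc m)"
      using one_minus_power_nonzero[OF q, of m] by (simp del: power_Suc of_nat_Suc)
    finally show ?thesis .
  qed
  hence "(\<lambda>m. x ^ Suc m / of_nat (Suc m)) sums (log_qprod q x - log_qprod q (q * x))"
    using s by (simp del: power_Suc of_nat_Suc)
  hence s': "(\<lambda>m. x ^ m / of_nat m) sums (log_qprod q x - log_qprod q (q * x))"
    by (subst (asm) sums_Suc_iff) (simp del: power_Suc of_nat_Suc)
  have "(\<lambda>m. - (x ^ m / of_nat m)) sums ln (1 - x)"
    using Ln_series'[of "-x"] x by simp
  hence "(\<lambda>m. x ^ m / of_nat m) sums (- ln (1 - x))"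
    using sums_minus by fastforce
  with s' have eq: "log_qprod q x - log_qprod q (q * x) = - ln (1 - x)"
    using sums_unique2 by blast
  have "1 - x \<noteq> 0" using x by auto
  have "- A = C + - B" if "A - B = - C" for A B C :: complex
    using that by (simp add: algebra_simps)
  from this[OF eq] have "qprod q x = exp (ln (1 - x)) * exp (- log_qprod q (q * x))"
    unfolding qprod_def by (simp only: exp_add)
  also have "\<dots> = (1 - x) * qprod q (q * x)"
    using \<open>1 - x \<noteq> 0\<close> by (simp add: qprod_def)
  finally show ?thesis .
qed

lemma norm_power_mult_less_one:
  fixes q x :: complex
  assumes "norm q < 1" "norm x < 1"
  shows "norm (q ^ n * x) < 1"
proof (induction n)
  case (Suc n)
  from norm_mult_less_one[OF assms(1) Suc] show ?case by (simp add: mult.assoc)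
qed (use assms in auto)

lemma qprod_unfold:
  assumes q: "norm q < 1" and x: "norm x < 1"
  shows "qprod q x = (\<Prod>i<n. 1 - q ^ i * x) * qprod q (q ^ n * x)"
proof (induction n)
  case (Suc n)
  show ?case unfolding Suc
    by (subst qprod_rec[OF q norm_power_mult_less_one[OF q x]]) (simp add: mult_ac)
qed auto

lemma qprod_tendsto_1:
  assumes q: "norm q < 1" and x: "eventually (\<lambda>n. norm (x n) < 1) F" and x0: "(x \<longlongrightarrow> 0) F"
  shows "((\<lambda>n. qprod q (x n)) \<longlongrightarrow> 1) F"
proof -
  have "((\<lambda>n. log_qprod q (x n)) \<longlongrightarrow> 0) F"
  proof (rule Lim_null_comparison)
    show "\<forall>\<^sub>F n in F. norm (log_qprod q (x n)) \<le> norm (x n) / (1 - norm q) / (1 - norm (x n))"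
      using x by eventually_elim (rule norm_log_qprod_le[OF q])
    show "((\<lambda>n. norm (x n) / (1 - norm q) / (1 - norm (x n))) \<longlongrightarrow> 0) F"
      using q by (auto intro!: tendsto_eq_intros x0)
  qed
  hence "((\<lambda>n. exp (- log_qprod q (x n))) \<longlongrightarrow> exp (- 0)) F"
    by (intro tendsto_intros)
  thus ?thesis by (simp add: qprod_def)
qed

lemma power_mult_tendsto_0:
  fixes q x :: complex
  assumes "norm q < 1"
  shows "(\<lambda>n. q ^ n * x) \<longlonglongrightarrow> 0"
  using tendsto_mult[OF LIMSEQ_power_zero[OF assms] tendsto_const[of x]] by simp

lemma qprod_power_tendsto_1:
  assumes q: "norm q < 1" and x: "norm x < 1"
  shows "(\<lambda>n. qprod q (q ^ n * x)) \<longlonglongrightarrow> 1"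
  by (rule qprod_tendsto_1[OF q])
     (auto intro!: always_eventually power_mult_tendsto_0 norm_power_mult_less_one q x)

lemma qfac_0 [simp]: "qfac q 0 = 1" and qfac_Suc: "qfac q (Suc n) = qfac q n * (1 - q ^ Suc n)"
  by (simp_all add: qfac_def)

lemma qfac_nonzero: "norm q < 1 \<Longrightarrow> qfac q n \<noteq> 0"
  using one_minus_power_nonzero[of q] by (auto simp: qfac_def simp del: power_Suc)

lemma qfac_eq:
  assumes q: "norm q < 1"
  shows "qfac q n = qprod q q / qprod q (q ^ Suc n)"
proof -
  have "qprod q q = qfac q n * qprod q (q ^ Suc n)"
    using qprod_unfold[OF q q, of n] unfolding qfac_def by (simp add: mult_ac)
  thus ?thesis by simp
qed

text \<open>The sequence converges to \<open>1 / qprod q q\<close>, hence is bounded. This lets a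
  geometric series dominate the power series with \<open>qfac\<close> in the denominator.\<close>

lemma inverse_qfac_bounded:
  assumes q: "norm q < 1"
  shows "\<exists>C>0. \<forall>n. norm (1 / qfac q n) \<le> C"
proof -
  have "(\<lambda>n. 1 / qfac q n) \<longlonglongrightarrow> 1 / qprod q q"
    unfolding qfac_eq[OF q] using tendsto_divide[OF qprod_power_tendsto_1[OF q q] tendsto_const[of "qprod q q"]]
    by (simp add: mult.commute)
  hence "Bseq (\<lambda>n. 1 / qfac q n)"
    by (intro convergent_imp_Bseq) (auto simp: convergent_def)
  thus ?thesis by (auto simp: Bseq_def)
qed

text \<open>The quotient \<open>F / qprod q\<close> has the same value at \<open>x\<close> and at
  every \<open>q ^ n * x\<close>, and it tends to 1 along this orbit.\<close>

lemma qprod_eqI: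
  fixes F :: "complex \<Rightarrow> complex"
  assumes q: "norm q < 1" and x: "norm x < 1"
    and rec: "\<And>x. norm x < 1 \<Longrightarrow> F x = (1 - x) * F (q * x)"
    and lim: "(\<lambda>n. F (q ^ n * x)) \<longlonglongrightarrow> 1"
  shows "F x = qprod q x"
proof -
  have "F x = (\<Prod>i<n. 1 - q ^ i * x) * F (q ^ n * x)" for n
  proof (induction n)
    case (Suc n)
    show ?case unfolding Suc
      by (subst rec[OF norm_power_mult_less_one[OF q x]]) (simp add: mult_ac)
  qed auto
  hence "F x / qprod q x = F (q ^ n * x) / qprod q (q ^ n * x)" for n
    using qprod_unfold[OF q x, of n] qprod_nonzero[of q x] by (metis mult_divide_mult_cancel_left mult_zero_left)
  moreover have "(\<lambda>n. F (q ^ n * x) / qprod q (q ^ n * x)) \<longlonglongrightarrow> 1 / 1"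
    by (intro tendsto_intros lim qprod_power_tendsto_1 q x) auto
  ultimately have "F x / qprod q x = 1" by (simp add: LIMSEQ_const_iff)
  thus ?thesis by simp
qed

lemma power_series_tendsto_at_0:
  fixes a :: "nat \<Rightarrow> complex" and q x :: complex
  assumes q: "norm q < 1" and a: "\<And>x. norm x < 1 \<Longrightarrow> summable (\<lambda>n. a n * x ^ n)"
  shows "(\<lambda>n. \<Sum>j. a j * (q ^ n * x) ^ j) \<longlonglongrightarrow> a 0"
proof -
  have "isCont (\<lambda>x. \<Sum>j. a j * x ^ j) 0"
    by (rule isCont_powser[where K = "1/2"]) (auto intro: a)
  hence "(\<lambda>n. \<Sum>j. a j * (q ^ n * x) ^ j) \<longlonglongrightarrow> (\<Sum>j. a j * 0 ^ j)"
    using power_mult_tendsto_0[OF q, of x] by (rule isCont_tendsto_compose)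
  also have "(\<Sum>j. a j * 0 ^ j) = a 0" using powser_zero by blast
  finally show ?thesis .
qed

lemma summable_inverse_qfac:
  assumes q: "norm q < 1" and x: "norm x < 1" and c: "\<And>n. norm (c n) \<le> 1"
  shows "summable (\<lambda>n. c n / qfac q n * x ^ n)"
proof -
  obtain C where C: "C > 0" "\<forall>n. norm (1 / qfac q n) \<le> C" using inverse_qfac_bounded[OF q] by blast
  have "norm (c n / qfac q n * x ^ n) \<le> C * norm x ^ n" for n
  proof -
    have "norm (c n) * norm (1 / qfac q n) \<le> 1 * C"
      by (rule mult_mono[OF c C(2)[rule_format]]) auto
    hence "norm (c n) * norm (1 / qfac q n) * norm (x ^ n) \<le> C * norm (x ^ n)"
      by (intro mult_right_mono) auto
    thus ?thesis by (simp add: norm_mult norm_divide norm_power)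
  qed
  hence le: "norm (c n / qfac q n * x ^ n) \<le> C * norm x ^ n" if "n \<ge> 0" for n by blast
  have "summable (\<lambda>n. C * norm x ^ n)"
    using x by (intro summable_mult summable_geometric) auto
  thus ?thesis by (rule summable_comparison_test'[OF _ le])
qed

text \<open>Passing from \<open>F x\<close> to \<open>F x - F (q * x)\<close> multiplies the
  coefficient of \<open>x ^ j\<close> by \<open>1 - q ^ j\<close>, the last factor of
  \<open>qfac q j\<close>. This is the common core of Euler's two identities, which differ only in
  \<open>B\<close>: it is \<open>F x\<close> in one and \<open>- F (q * x)\<close> in the
  other.\<close>

lemma qdiff_powser:
  fixes a :: "nat \<Rightarrow> complex"
  assumes a: "\<And>x. norm x < 1 \<Longrightarrow> summable (\<lambda>j. a j * x ^ j)" and q: "norm q < 1" and x: "norm x < 1"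
    and b: "\<And>j. a (Suc j) * (1 - q ^ Suc j) = b j" and B: "(\<lambda>j. b j * x ^ j) sums B"
  shows "(\<Sum>j. a j * x ^ j) - (\<Sum>j. a j * (q * x) ^ j) = x * B"
proof -
  have "(\<lambda>j. a j * x ^ j - a j * (q * x) ^ j) sums ((\<Sum>j. a j * x ^ j) - (\<Sum>j. a j * (q * x) ^ j))"
    by (intro sums_diff summable_sums a x norm_mult_less_one q)
  moreover have "a (Suc j) * x ^ Suc j - a (Suc j) * (q * x) ^ Suc j = x * (b j * x ^ j)" for j
    unfolding b [symmetric] by (simp add: power_mult_distrib algebra_simps)
  with sums_mult[OF B, of x] have "(\<lambda>j. a (Suc j) * x ^ Suc j - a (Suc j) * (q * x) ^ Suc j) sums (x * B)"
    by simp
  hence "(\<lambda>j. a j * x ^ j - a j * (q * x) ^ j) sums (x * B)"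
    by (subst (asm) sums_Suc_iff) simp
  ultimately show ?thesis by (rule sums_unique2)
qed

text \<open>\<open>F (q * x) = (1 - x) * F x\<close> is the functional equation of the reciprocal of
  \<open>qprod q\<close>, so the product of \<open>F\<close> and \<open>qprod q\<close> is constant
  along \<open>q ^ n * x\<close>, with limit 1.\<close>

theorem qprod_inverse_sums:
  assumes q: "norm q < 1" and x: "norm x < 1"
  shows "(\<lambda>j. x ^ j / qfac q j) sums (1 / qprod q x)"
proof -
  define F where "F x = (\<Sum>j. 1 / qfac q j * x ^ j)" for x
  have s: "summable (\<lambda>j. 1 / qfac q j * x ^ j)" if "norm x < 1" for x
    using summable_inverse_qfac[OF q that, of "\<lambda>_. 1"] by simp
  have rec: "F (q * x) = (1 - x) * F x" if x: "norm x < 1" for x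
  proof -
    have "F x - F (q * x) = x * F x"
      unfolding F_def
    proof (rule qdiff_powser[OF s q x _ summable_sums[OF s[OF x]]])
      show "1 / qfac q (Suc j) * (1 - q ^ Suc j) = 1 / qfac q j" for j
        using one_minus_power_nonzero[OF q, of j] by (simp add: qfac_Suc)
    qed
    thus ?thesis by (simp add: algebra_simps)
  qed
  have "F x * qprod q x = 1"
  proof -
    have inv: "F (q ^ n * x) * qprod q (q ^ n * x) = F x * qprod q x" for n
    proof (induction n)
      case (Suc n)
      have n: "norm (q ^ n * x) < 1" by (rule norm_power_mult_less_one[OF q x])
      have "F (q ^ Suc n * x) * qprod q (q ^ Suc n * x) = F (q ^ n * x) * qprod q (q ^ n * x)"
        using rec[OF n] qprod_rec[OF q n] by (simp add: mult_ac)
      with Suc show ?case by simp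
    qed auto
    have "(\<lambda>n. F (q ^ n * x)) \<longlonglongrightarrow> 1 / qfac q 0"
      unfolding F_def by (rule power_series_tendsto_at_0[OF q s])
    hence "(\<lambda>n. F (q ^ n * x) * qprod q (q ^ n * x)) \<longlonglongrightarrow> 1 * 1"
      by (intro tendsto_intros qprod_power_tendsto_1 q x) auto
    thus ?thesis unfolding inv by (simp add: LIMSEQ_const_iff)
  qed
  hence "F x = 1 / qprod q x" by (simp add: field_simps)
  thus ?thesis using summable_sums[OF s[OF x]] by (simp add: F_def)
qed

text \<open>The quadratic exponent makes \<open>c (Suc j) = - (q ^ j * c j)\<close>. The extra
  \<open>q ^ j\<close> turns the argument \<open>x\<close> into \<open>q * x\<close>, which yields
  the functional equation of \<open>qprod\<close> itself.\<close>

theorem qprod_sums: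
  assumes q: "norm q < 1" and x: "norm x < 1"
  shows "(\<lambda>j. (-1) ^ j * q ^ (j * (j - 1) div 2) / qfac q j * x ^ j) sums qprod q x"
proof -
  define c where "c j = (-1) ^ j * q ^ (j * (j - 1) div 2)" for j :: nat
  have c1: "norm (c j) \<le> 1" for j
    using q by (auto simp: c_def norm_mult norm_power power_le_one)
  define F where "F x = (\<Sum>j. c j / qfac q j * x ^ j)" for x
  have s: "summable (\<lambda>j. c j / qfac q j * x ^ j)" if "norm x < 1" for x
    using summable_inverse_qfac[OF q that c1] .
  have cS: "c (Suc j) = - (q ^ j * c j)" for j
  proof -
    have "Suc j * (Suc j - 1) div 2 = j * (j - 1) div 2 + j"
      by (cases j) (auto simp: algebra_simps)
    thus ?thesis by (simp add: c_def power_add)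
  qed
  have rec: "F x = (1 - x) * F (q * x)" if x: "norm x < 1" for x
  proof -
    have "F x - F (q * x) = x * - F (q * x)"
      unfolding F_def
    proof (rule qdiff_powser[OF s q x])
      show "c (Suc j) / qfac q (Suc j) * (1 - q ^ Suc j) = - (c j / qfac q j * q ^ j)" for j
        using one_minus_power_nonzero[OF q, of j] by (simp add: qfac_Suc cS)
      show "(\<lambda>j. - (c j / qfac q j * q ^ j) * x ^ j) sums - (\<Sum>j. c j / qfac q j * (q * x) ^ j)"
        using sums_minus[OF summable_sums[OF s[OF norm_mult_less_one[OF q x]]]] by (simp add: power_mult_distrib mult.assoc)
    qed
    thus ?thesis by (simp add: algebra_simps)
  qed
  have "(\<lambda>n. F (q ^ n * x)) \<longlonglongrightarrow> c 0 / qfac q 0"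
    unfolding F_def by (rule power_series_tendsto_at_0[OF q s])
  hence "F x = qprod q x"
    by (intro qprod_eqI[OF q x] rec) (auto simp: c_def)
  thus ?thesis using summable_sums[OF s[OF x]] by (simp add: F_def c_def)
qed

subsection \<open>The crank expansion and Fourier coefficients\<close>

lemma abs_summable_Times:
  fixes f :: "'a \<Rightarrow> complex" and g :: "'b \<Rightarrow> complex"
  assumes f: "f summable_on A" and g: "g summable_on B"
  shows "(\<lambda>(x, y). f x * g y) summable_on (A \<times> B)"
proof -
  have f': "(\<lambda>x. norm (f x)) summable_on A" and g': "(\<lambda>x. norm (g x)) summable_on B"
    using f g by (simp_all add: summable_on_iff_abs_summable_on_complex)
  have "(\<lambda>p. norm (f (fst p)) * norm (g (snd p))) summable_on (A \<times> B)"
  proof (rule summable_on_SigmaI)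
    show "((\<lambda>y. norm (f (fst (x, y))) * norm (g (snd (x, y)))) has_sum norm (f x) * infsum (\<lambda>y. norm (g y)) B) B"
      for x using has_sum_cmult_right[OF has_sum_infsum[OF g'], of "norm (f x)"] by simp
    show "(\<lambda>x. norm (f x) * infsum (\<lambda>y. norm (g y)) B) summable_on A"
      by (intro summable_on_cmult_left f')
  qed auto
  hence "(\<lambda>p. norm (f (fst p) * g (snd p))) summable_on (A \<times> B)"
    by (simp add: norm_mult)
  hence "(\<lambda>p. f (fst p) * g (snd p)) summable_on (A \<times> B)"
    by (simp add: summable_on_iff_abs_summable_on_complex)
  thus ?thesis by (simp add: case_prod_unfold)
qed

lemma has_sum_Times:
  fixes f :: "'a \<Rightarrow> complex" and g :: "'b \<Rightarrow> complex"
  assumes f: "(f has_sum a) A" and g: "(g has_sum b) B"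
  shows "((\<lambda>(x, y). f x * g y) has_sum (a * b)) (A \<times> B)"
proof (rule has_sum_SigmaI)
  show "((\<lambda>y. case (x, y) of (x, y) \<Rightarrow> f x * g y) has_sum f x * b) B" for x
    using has_sum_cmult_right[OF g] by simp
  show "((\<lambda>x. f x * b) has_sum a * b) A" by (rule has_sum_cmult_left[OF f])
  show "(\<lambda>(x, y). f x * g y) summable_on A \<times> B"
    using f g by (intro abs_summable_Times) (auto simp: summable_on_def)
qed

lemma has_sum_geometric:
  fixes z :: complex
  assumes "norm z < 1"
  shows "((\<lambda>n. z ^ n) has_sum (1 / (1 - z))) UNIV"
  by (rule norm_summable_imp_has_sum)
     (use assms in \<open>auto simp: norm_power intro!: summable_geometric geometric_sums\<close>)

lemma has_sum_inverse_qfac: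
  assumes q: "norm q < 1" and x: "norm x < 1"
  shows "((\<lambda>j. x ^ j / qfac q j) has_sum (1 / qprod q x)) UNIV"
proof (rule norm_summable_imp_has_sum)
  obtain C where C: "C > 0" "\<forall>n. norm (1 / qfac q n) \<le> C"
    using inverse_qfac_bounded[OF q] by blast
  have le: "norm (norm (x ^ n / qfac q n)) \<le> C * norm x ^ n" for n
    using mult_right_mono[OF C(2)[rule_format, of n], of "norm x ^ n"] by (simp add: norm_divide norm_power)
  show "summable (\<lambda>n. norm (x ^ n / qfac q n))"
    by (rule summable_comparison_test'[OF _ le])
       (use x in \<open>auto intro!: summable_mult summable_geometric\<close>)
qed (rule qprod_inverse_sums[OF q x])

text \<open>The sum over \<open>i\<close> is \<open>T\<^sub>r\<close> of the overview. With n = i +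
  1 and an additional factor q^r these are the terms of the classical series for
  \<open>(q; q)\<close> times the generating function of partitions of crank r.\<close>

definition crank_term :: "nat \<Rightarrow> complex \<Rightarrow> nat \<Rightarrow> complex" where
  "crank_term r q i = (-1) ^ i * q ^ (i * r + i * (i + 1) div 2) * (1 - q ^ (i + 1))"

definition crank_sum :: "nat \<Rightarrow> complex \<Rightarrow> complex" where
  "crank_sum r q = suminf (crank_term r q)"

lemma norm_crank_sum_term:
  fixes q :: complex
  assumes q: "norm q < 1"
  shows "norm (crank_term r q i) \<le> 2 * norm q ^ i"
proof -
  have "i \<le> i * r + i * (i + 1) div 2" by (cases i) auto
  hence 1: "norm (q ^ (i * r + i * (i + 1) div 2)) \<le> norm q ^ i"
    using q unfolding norm_power by (intro power_decreasing) auto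
  have "norm (1 - q ^ Suc i) \<le> norm (1::complex) + norm (q ^ Suc i)" by (rule norm_triangle_ineq4)
  hence 2: "norm (1 - q ^ Suc i) \<le> 2" using norm_power_Suc_less[OF q, of i] q by simp
  show ?thesis using mult_mono[OF 1 2] by (simp add: crank_term_def norm_mult norm_power mult.commute)
qed

lemma has_sum_crank_sum:
  assumes q: "norm q < 1"
  shows "(crank_term r q has_sum crank_sum r q) UNIV"
proof -
  have le: "norm (norm (crank_term r q i)) \<le> 2 * norm q ^ i" for i
    using norm_crank_sum_term[OF q] by simp
  have s: "summable (\<lambda>i. norm (crank_term r q i))"
    by (rule summable_comparison_test'[OF _ le])
       (use q in \<open>auto intro!: summable_mult summable_geometric\<close>)
  show ?thesis unfolding crank_sum_def
    by (intro norm_summable_imp_has_sum s summable_sums summable_norm_cancel)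
qed

lemma norm_crank_sum_le:
  assumes q: "norm q < 1"
  shows "norm (crank_sum r q) \<le> 2 / (1 - norm q)"
proof -
  have "norm (crank_sum r q) \<le> (\<Sum>i. 2 * norm q ^ i)"
    unfolding crank_sum_def
    by (intro norm_suminf_le norm_crank_sum_term q summable_mult summable_geometric) (use q in auto)
  also have "\<dots> = 2 / (1 - norm q)"
    using q by (subst suminf_mult) (auto simp: suminf_geometric intro!: summable_geometric)
  finally show ?thesis .
qed

text \<open>Write \<open>1 / qfac q (j + r)\<close> as
  \<open>qprod q (q ^ (j + r + 1)) / qprod q q\<close> and expand the numerator by Euler's second
  identity. In the double series the sum over \<open>j\<close> is then an instance of the first
  identity and equals \<open>1 / qprod q (q ^ (i + 2))\<close>, that is
  \<open>qfac q (i + 1) / qprod q q\<close>. Against the \<open>1 / qfac q i\<close> of the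
  expansion only the factor \<open>1 - q ^ (i + 1)\<close> survives.\<close>

theorem crank_identity:
  assumes q: "norm q < 1"
  shows "((\<lambda>j. q ^ (2 * j) / (qfac q j * qfac q (j + r))) has_sum (crank_sum r q / (qprod q q)\<^sup>2)) UNIV"
proof -
  define c where "c i = (-1) ^ i * q ^ (i * (i - 1) div 2) / qfac q i" for i :: nat
  define G where "G = (\<lambda>(j, i). q ^ (2 * j) / qfac q j * (c i * (q ^ (j + r + 1)) ^ i))"
  have qn: "norm (q ^ Suc n) < 1" for n
    using norm_power_Suc_less[OF q, of n] q by simp
  have "(\<lambda>p. norm (G p)) summable_on (UNIV \<times> UNIV)"
  proof (rule Infinite_Sum.abs_summable_on_comparison_test')
    \<comment> \<open>Bounding the quadratic power by 1 and \<open>(q ^ (j + r + 1)) ^ i\<close> by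
      \<open>norm q ^ i\<close> decouples the indices: what is left is a product of two convergent
      series of the first identity.\<close>
    define h where "h = (\<lambda>(j, i). (q\<^sup>2) ^ j / qfac q j * (complex_of_real (norm q) ^ i / qfac q i))"
    have "norm (q\<^sup>2) < 1" using qn[of 1] by (simp add: power2_eq_square)
    hence "h summable_on (UNIV \<times> UNIV)"
      unfolding h_def using q
      by (intro abs_summable_Times has_sum_imp_summable[OF has_sum_inverse_qfac]) auto
    thus "(\<lambda>p. norm (h p)) summable_on (UNIV \<times> UNIV)"
      by (simp only: summable_on_iff_abs_summable_on_complex)
    show "norm (G p) \<le> norm (h p)" for p
    proof (cases p)
      case (Pair j i)
      have "norm ((q ^ (j + r + 1)) ^ i) \<le> norm q ^ i"
        using q unfolding power_mult [symmetric] norm_power by (auto intro!: power_decreasing)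
      hence "norm (q ^ (i * (i - 1) div 2)) * norm ((q ^ (j + r + 1)) ^ i) \<le> 1 * norm q ^ i"
        using q by (intro mult_mono) (auto simp: norm_power power_le_one)
      hence "norm ((q\<^sup>2) ^ j) / norm (qfac q j) / norm (qfac q i) * (norm (q ^ (i * (i - 1) div 2)) * norm ((q ^ (j + r + 1)) ^ i))
          \<le> norm ((q\<^sup>2) ^ j) / norm (qfac q j) / norm (qfac q i) * norm q ^ i"
        by (intro mult_left_mono) auto
      moreover have "q ^ (2 * j) = (q\<^sup>2) ^ j" by (simp only: power_mult)
      ultimately show ?thesis
        by (simp add: G_def h_def c_def Pair norm_mult norm_divide norm_power mult_ac)
    qed
  qed
  hence G: "(G has_sum infsum G (UNIV \<times> UNIV)) (UNIV \<times> UNIV)"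
    by (simp only: has_sum_infsum summable_on_iff_abs_summable_on_complex)
  have rows: "((\<lambda>i. G (j, i)) has_sum (qprod q q * (q ^ (2 * j) / (qfac q j * qfac q (j + r))))) UNIV" for j
  proof -
    have "summable (\<lambda>i. norm (G (j, i)))"
    proof (rule summable_on_imp_summable, fold summable_on_iff_abs_summable_on_complex)
      have "(\<lambda>(j, i). G (j, i)) summable_on (UNIV \<times> UNIV)"
        using G by (auto simp: summable_on_def)
      from summable_on_SigmaD1[OF this, of j] show "(\<lambda>i. G (j, i)) summable_on UNIV" by simp
    qed
    moreover have "(\<lambda>i. G (j, i)) sums (q ^ (2 * j) / qfac q j * qprod q (q ^ (j + r + 1)))"
      unfolding G_def prod.case c_def using qn[of "j + r"]
      by (intro sums_mult qprod_sums q) simp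
    moreover have "qprod q (q ^ (j + r + 1)) = qprod q q / qfac q (j + r)"
      by (simp add: qfac_eq[OF q])
    ultimately show ?thesis
      by (intro norm_summable_imp_has_sum) (simp_all add: mult_ac)
  qed
  have cols: "((\<lambda>j. G (j, i)) has_sum (crank_term r q i / qprod q q)) UNIV" for i
  proof -
    have "((\<lambda>j. c i * q ^ (i * (r + 1)) * ((q ^ Suc (Suc i)) ^ j / qfac q j)) has_sum
             (c i * q ^ (i * (r + 1)) * (1 / qprod q (q ^ Suc (Suc i))))) UNIV"
      by (intro has_sum_cmult_right has_sum_inverse_qfac q qn)
    also have "(\<lambda>j. c i * q ^ (i * (r + 1)) * ((q ^ Suc (Suc i)) ^ j / qfac q j)) = (\<lambda>j. G (j, i))"
    proof
      fix j
      have "q ^ (i * (r + 1)) * (q ^ Suc (Suc i)) ^ j = q ^ (2 * j) * (q ^ (j + r + 1)) ^ i"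
        unfolding power_mult [symmetric] power_add [symmetric]
        by (rule arg_cong[where f = "\<lambda>n. q ^ n"]) (simp add: algebra_simps)
      thus "c i * q ^ (i * (r + 1)) * ((q ^ Suc (Suc i)) ^ j / qfac q j) = G (j, i)"
        by (simp add: G_def mult_ac)
    qed
    also have "c i * q ^ (i * (r + 1)) * (1 / qprod q (q ^ Suc (Suc i))) =
               crank_term r q i / qprod q q"
    proof -
      have "i * (i - 1) div 2 + i * (r + 1) = i * r + i * (i + 1) div 2"
        by (cases i) (auto simp: algebra_simps)
      hence "c i * q ^ (i * (r + 1)) = (-1) ^ i * q ^ (i * r + i * (i + 1) div 2) / qfac q i"
        unfolding c_def by (simp only: power_add [symmetric] mult.assoc times_divide_eq_left times_divide_eq_right)
      moreover have "1 / qprod q (q ^ Suc (Suc i)) = qfac q i * (1 - q ^ Suc i) / qprod q q"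
        using qfac_eq[OF q, of "Suc i"] unfolding qfac_Suc by simp
      ultimately show ?thesis using qfac_nonzero[OF q, of i] by (simp add: crank_term_def)
    qed
    finally show ?thesis .
  qed
  have "((\<lambda>i. crank_term r q i / qprod q q) has_sum
           (crank_sum r q / qprod q q)) UNIV"
    using has_sum_crank_sum[OF q, of r] by (rule has_sum_divide_const)
  moreover have "((\<lambda>i. crank_term r q i / qprod q q) has_sum
           infsum G (UNIV \<times> UNIV)) UNIV"
  proof (rule has_sum_SigmaD)
    show "((\<lambda>(i, j). G (j, i)) has_sum infsum G (UNIV \<times> UNIV)) (UNIV \<times> UNIV)"
      using G by (subst (asm) has_sum_swap) (simp add: case_prod_unfold)
  qed (use cols in simp)
  ultimately have "infsum G (UNIV \<times> UNIV) = crank_sum r q / qprod q q"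
    using has_sum_unique by blast
  with has_sum_SigmaD[OF G rows]
  have "((\<lambda>j. qprod q q * (q ^ (2 * j) / (qfac q j * qfac q (j + r)))) has_sum (crank_sum r q / qprod q q)) UNIV"
    by simp
  from has_sum_cmult_right[OF this, of "1 / qprod q q"] show ?thesis
    by (simp add: power2_eq_square)
qed

section \<open>Fourier coefficients of absolutely convergent series\<close>

lemma integral_exp_int:
  "((\<lambda>\<theta>. exp (\<i> * of_int k * complex_of_real \<theta>)) has_integral (if k = 0 then 2 * pi else 0)) {-pi..pi}"
proof (cases "k = 0")
  case True
  thus ?thesis using has_integral_const_real[of "1::complex" "-pi" pi] by (simp add: scaleR_conv_of_real)
next
  case False
  have "((\<lambda>\<theta>. exp (\<i> * of_int k * complex_of_real \<theta>)) has_integral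
        (exp (\<i> * of_int k * complex_of_real pi) / (\<i> * of_int k) - exp (\<i> * of_int k * complex_of_real (-pi)) / (\<i> * of_int k))) {-pi..pi}"
  proof (rule fundamental_theorem_of_calculus)
    fix x :: real
    have "((\<lambda>z. exp (\<i> * of_int k * z) / (\<i> * of_int k)) has_field_derivative exp (\<i> * of_int k * complex_of_real x)) (at (complex_of_real x))"
      using False by (auto intro!: derivative_eq_intros)
    thus "((\<lambda>\<theta>. exp (\<i> * of_int k * complex_of_real \<theta>) / (\<i> * of_int k)) has_vector_derivative exp (\<i> * of_int k * complex_of_real x)) (at x within {-pi..pi})"
      by (rule has_vector_derivative_real_field[OF DERIV_subset, of _ _ _ UNIV, simplified])
  qed auto
  moreover have "exp (\<i> * of_int k * complex_of_real pi) = exp (\<i> * of_int k * complex_of_real (-pi))"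
    by (subst exp_eq) (auto intro!: exI[of _ k])
  ultimately show ?thesis using False by simp
qed

text \<open>The frequencies \<open>\<kappa> i\<close> may repeat, so a double series can be compared with another one
  diagonal by diagonal without first grouping its terms.\<close>

lemma has_integral_fourier_coefficient:
  fixes f :: "'a \<Rightarrow> complex" and \<kappa> :: "'a \<Rightarrow> int"
  assumes f: "f summable_on A"
    and F: "\<And>\<theta>. ((\<lambda>i. f i * exp (\<i> * of_int (\<kappa> i) * complex_of_real \<theta>)) has_sum F \<theta>) A"
  shows "((\<lambda>\<theta>. F \<theta> * exp (- (\<i> * of_int r * complex_of_real \<theta>))) has_integral
           (2 * pi * infsum f {i\<in>A. \<kappa> i = r})) {-pi..pi}"
proof -
  define u where "u Y \<theta> = (\<Sum>i\<in>Y. f i * exp (\<i> * of_int (\<kappa> i - r) * complex_of_real \<theta>))" for Y and \<theta> :: real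
  have e: "exp (\<i> * of_int (\<kappa> i) * complex_of_real \<theta>) * exp (- (\<i> * of_int r * complex_of_real \<theta>))
         = exp (\<i> * of_int (\<kappa> i - r) * complex_of_real \<theta>)" for i \<theta>
    by (simp add: exp_add [symmetric] algebra_simps)
  have "uniform_limit (cbox (-pi) pi) u (\<lambda>\<theta>. F \<theta> * exp (- (\<i> * of_int r * complex_of_real \<theta>))) (finite_subsets_at_top A)"
    unfolding u_def
  proof (rule Weierstrass_m_test_general'[where M = "\<lambda>i. norm (f i)"])
    show "((\<lambda>i. f i * exp (\<i> * of_int (\<kappa> i - r) * complex_of_real \<theta>)) has_sum
            F \<theta> * exp (- (\<i> * of_int r * complex_of_real \<theta>))) A" for \<theta>
      using has_sum_cmult_left[OF F[of \<theta>], of "exp (- (\<i> * of_int r * complex_of_real \<theta>))"]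
      by (simp only: mult.assoc[where a = "f i" for i] e)
    show "(\<lambda>i. norm (f i)) summable_on A"
      using f by (simp add: summable_on_iff_abs_summable_on_complex)
    have "norm (exp (\<i> * of_int k * complex_of_real \<theta>)) = 1" for k \<theta>
      using norm_exp_i_times[of "of_int k * \<theta>"] by (simp add: mult.assoc)
    thus "norm (f i * exp (\<i> * of_int (\<kappa> i - r) * complex_of_real \<theta>)) \<le> norm (f i)" for i \<theta>
      by (simp add: norm_mult)
  qed
  then obtain I J where I: "\<And>Y. (u Y has_integral I Y) (cbox (-pi) pi)"
    and J: "((\<lambda>\<theta>. F \<theta> * exp (- (\<i> * of_int r * complex_of_real \<theta>))) has_integral J) (cbox (-pi) pi)"
    and lim: "(I \<longlongrightarrow> J) (finite_subsets_at_top A)"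
    by (rule uniform_limit_integral_cbox) (auto simp: u_def intro!: continuous_intros)
  have I': "I Y = (\<Sum>i\<in>Y. 2 * pi * (if \<kappa> i = r then f i else 0))" if "finite Y" for Y
  proof -
    have "(u Y has_integral (\<Sum>i\<in>Y. f i * (if \<kappa> i - r = 0 then 2 * pi else 0))) {-pi..pi}"
      unfolding u_def by (intro has_integral_sum that has_integral_mult_right integral_exp_int)
    also have "(\<Sum>i\<in>Y. f i * (if \<kappa> i - r = 0 then 2 * pi else 0)) = (\<Sum>i\<in>Y. 2 * pi * (if \<kappa> i = r then f i else 0))"
      by (intro sum.cong) auto
    finally have "(u Y has_integral (\<Sum>i\<in>Y. 2 * pi * (if \<kappa> i = r then f i else 0))) {-pi..pi}" .
    with I[of Y] show ?thesis by (metis cbox_interval has_integral_unique)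
  qed
  \<comment> \<open>The integral of a finite partial sum is a finite partial sum of this series of
    constants, so convergence of the integrals along finite subsets is literally a
    \<open>has_sum\<close>.\<close>
  have "((\<lambda>i. 2 * pi * (if \<kappa> i = r then f i else 0)) has_sum J) A"
    unfolding has_sum_def
    by (rule Lim_transform_eventually[OF lim])
       (use I' in \<open>auto simp: eventually_finite_subsets_at_top intro!: exI[of _ "{}"]\<close>)
  moreover have "((\<lambda>i. 2 * pi * (if \<kappa> i = r then f i else 0)) has_sum (2 * pi * infsum f {i\<in>A. \<kappa> i = r})) A"
  proof (rule has_sum_cmult_right)
    have "f summable_on {i\<in>A. \<kappa> i = r}"
      by (rule summable_on_subset_banach[OF f]) auto
    hence "(f has_sum infsum f {i\<in>A. \<kappa> i = r}) {i\<in>A. \<kappa> i = r}" by (rule has_sum_infsum)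
    thus "((\<lambda>i. if \<kappa> i = r then f i else 0) has_sum infsum f {i\<in>A. \<kappa> i = r}) A"
      by (rule has_sum_cong_neutral[THEN iffD1, rotated -1]) auto
  qed
  ultimately have "J = 2 * pi * infsum f {i\<in>A. \<kappa> i = r}" using has_sum_unique by blast
  with J show ?thesis by simp
qed

subsection \<open>The generating function of steadily decreasing pairs\<close>

lemma finite_subset_incseq:
  assumes A: "incseq A" and X: "finite X" "X \<subseteq> (\<Union>n. A n)"
  shows "\<exists>N. X \<subseteq> A N"
  using X
proof (induction X)
  case (insert x X)
  then obtain N M where "X \<subseteq> A N" "x \<in> A M" by auto
  moreover have "A N \<subseteq> A (max M N)" "A M \<subseteq> A (max M N)" using A by (auto simp: incseq_def)
  ultimately show ?case by (intro exI[of _ "max M N"]) auto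
qed auto

text \<open>A finite set that nearly exhausts the union lies in some \<open>A N\<close>. Inside any
  later \<open>A n\<close> it can be enlarged to a finite set that nearly exhausts
  \<open>A n\<close>, and the sum over this set is close to both limits.\<close>

lemma has_sum_incseq_limit:
  fixes f :: "'a \<Rightarrow> 'b :: real_normed_vector"
  assumes S: "(f has_sum s) (\<Union>n. A n)" and A: "incseq A" and z: "\<And>n. (f has_sum z n) (A n)"
  shows "z \<longlonglongrightarrow> s"
proof (rule LIMSEQ_I)
  fix e :: real assume e: "e > 0"
  obtain X where X: "finite X" "X \<subseteq> (\<Union>n. A n)"
    and X': "\<And>Y. finite Y \<Longrightarrow> X \<subseteq> Y \<Longrightarrow> Y \<subseteq> (\<Union>n. A n) \<Longrightarrow> dist (sum f Y) s < e / 2"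
    using S[unfolded has_sum_def tendsto_iff, rule_format, of "e / 2"] e
    unfolding eventually_finite_subsets_at_top by auto
  obtain N where N: "X \<subseteq> A N" using finite_subset_incseq[OF A X] by blast
  show "\<exists>no. \<forall>n\<ge>no. norm (z n - s) < e"
  proof (intro exI[of _ N] allI impI)
    fix n assume n: "n \<ge> N"
    obtain X2 where X2: "finite X2" "X2 \<subseteq> A n"
      and X2': "\<And>Y. finite Y \<Longrightarrow> X2 \<subseteq> Y \<Longrightarrow> Y \<subseteq> A n \<Longrightarrow> dist (sum f Y) (z n) < e / 2"
      using z[of n, unfolded has_sum_def tendsto_iff, rule_format, of "e / 2"] e
      unfolding eventually_finite_subsets_at_top by auto
    have "X \<subseteq> A n" using N A n by (meson incseq_def order_trans)
    hence "dist (sum f (X \<union> X2)) (z n) < e / 2" "dist (sum f (X \<union> X2)) s < e / 2"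
      using X X2 X'[of "X \<union> X2"] X2'[of "X \<union> X2"] by auto
    hence "dist (z n) s < e" by (metis dist_triangle_half_r)
    thus "norm (z n - s) < e" by (simp add: dist_norm)
  qed
qed

definition bounded_steady_pairs :: "nat \<Rightarrow> ((nat \<Rightarrow> nat) \<times> (nat \<Rightarrow> nat)) set" where
  "bounded_steady_pairs L = {(a, b). steadily_decreasing a b \<and> (\<forall>i\<ge>L. a i = 0 \<and> b i = 0)}"

definition all_steady_pairs :: "((nat \<Rightarrow> nat) \<times> (nat \<Rightarrow> nat)) set" where
  "all_steady_pairs = {(a, b). steadily_decreasing a b \<and> finite {i. a i \<noteq> 0} \<and> finite {i. b i \<noteq> 0}}"

definition weight :: "(nat \<Rightarrow> nat) \<Rightarrow> nat" where
  "weight a = (\<Sum>i | a i \<noteq> 0. a i)"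

definition pair_term :: "'a :: comm_monoid_mult \<Rightarrow> 'a \<Rightarrow> (nat \<Rightarrow> nat) \<times> (nat \<Rightarrow> nat) \<Rightarrow> 'a" where
  "pair_term x y p = x ^ weight (fst p) * y ^ weight (snd p)"

definition add_row :: "nat \<Rightarrow> nat \<Rightarrow> nat \<Rightarrow> (nat \<Rightarrow> nat) \<Rightarrow> nat \<Rightarrow> nat" where
  "add_row L k v a i = (if i < L then a i + k else if i = L then v else 0)"

lemma steadily_decreasing_iff:
  "steadily_decreasing a b \<longleftrightarrow>
     (\<forall>i. a (Suc i) \<le> a i \<and> a (Suc i) \<le> b i \<and> b (Suc i) \<le> a i \<and> b (Suc i) \<le> b i)"
  by (auto simp: steadily_decreasing_def)

text \<open>Ensures that subtracting the larger entry of a row from all earlier rows never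
  truncates, so that the subtraction in \<open>bij_betw_add_row\<close> can be undone.\<close>

lemma steadily_decreasing_ge:
  assumes "steadily_decreasing a b" "i < L"
  shows "max (a L) (b L) \<le> a i" "max (a L) (b L) \<le> b i"
proof -
  have *: "max (a (Suc (i + d))) (b (Suc (i + d))) \<le> min (a i) (b i)" for d
  proof (induction d)
    case 0 thus ?case using assms(1) by (auto simp: steadily_decreasing_def)
  next
    case (Suc d)
    have "max (a (Suc (i + Suc d))) (b (Suc (i + Suc d))) \<le> min (a (Suc (i + d))) (b (Suc (i + d)))"
      using assms(1) by (auto simp: steadily_decreasing_def)
    with Suc show ?case by auto
  qed
  obtain d where "L = Suc (i + d)" using assms(2) less_imp_Suc_add by blast
  with *[of d] show "max (a L) (b L) \<le> a i" "max (a L) (b L) \<le> b i" by auto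
qed

lemma weight_eq:
  assumes "\<And>i. i \<ge> L \<Longrightarrow> a i = 0"
  shows "weight a = (\<Sum>i<L. a i)"
proof -
  have "i < L" if "a i \<noteq> 0" for i using assms[of i] that by (cases "i < L") auto
  thus ?thesis unfolding weight_def by (intro sum.mono_neutral_left) auto
qed

lemma weight_add_row:
  assumes "\<And>i. i \<ge> L \<Longrightarrow> a i = 0"
  shows "weight (add_row L k v a) = weight a + L * k + v"
proof -
  have "weight (add_row L k v a) = (\<Sum>i<Suc L. add_row L k v a i)"
    by (rule weight_eq) (auto simp: add_row_def)
  also have "\<dots> = (\<Sum>i<L. a i + k) + v"
    by (simp add: add_row_def)
  finally show ?thesis using weight_eq[of L a] assms by (simp add: sum.distrib)
qed

text \<open>A pair with at most \<open>L + 1\<close> rows is determined by its last row \<open>(u, v)\<close> and the pair with at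
  most \<open>L\<close> rows obtained by subtracting \<open>max u v\<close> from all the other entries.\<close>

lemma bij_betw_add_row:
  "bij_betw (\<lambda>((a, b), (u, v)). (add_row L (max u v) u a, add_row L (max u v) v b))
     (bounded_steady_pairs L \<times> UNIV) (bounded_steady_pairs (Suc L))"
proof -
  define f where "f = (\<lambda>((a, b), (u, v)). (add_row L (max u v) u a, add_row L (max u v) v b))"
  define f' where "f' = (\<lambda>(a, b). ((\<lambda>i. if i < L then a i - max (a L) (b L) else 0 :: nat,
     \<lambda>i. if i < L then b i - max (a L) (b L) else 0 :: nat), (a L, b L)))"
  have "bij_betw f (bounded_steady_pairs L \<times> UNIV) (bounded_steady_pairs (Suc L))"
  proof (rule bij_betw_byWitness[where f' = f'])
    show "\<forall>p\<in>bounded_steady_pairs L \<times> UNIV. f' (f p) = p"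
      by (auto simp: bounded_steady_pairs_def add_row_def fun_eq_iff f_def f'_def)
    show "\<forall>p\<in>bounded_steady_pairs (Suc L). f (f' p) = p"
    proof
      fix p assume "p \<in> bounded_steady_pairs (Suc L)"
      then obtain a b where p: "p = (a, b)" and ab: "(a, b) \<in> bounded_steady_pairs (Suc L)"
        by (cases p) auto
      hence "max (a L) (b L) \<le> a i" "max (a L) (b L) \<le> b i" if "i < L" for i
        using steadily_decreasing_ge[of a b i L] that by (auto simp: bounded_steady_pairs_def)
      moreover have "a i = 0" "b i = 0" if "i > L" for i
        using ab that by (auto simp: bounded_steady_pairs_def)
      ultimately show "f (f' p) = p"
        by (auto simp: add_row_def fun_eq_iff p f_def f'_def)
    qed
    show "f ` (bounded_steady_pairs L \<times> UNIV) \<subseteq> bounded_steady_pairs (Suc L)"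
    proof
      fix p assume "p \<in> f ` (bounded_steady_pairs L \<times> UNIV)"
      then obtain a b u v where ab: "(a, b) \<in> bounded_steady_pairs L"
        and p: "p = (add_row L (max u v) u a, add_row L (max u v) v b)"
        by (auto simp: f_def)
      hence "a (Suc i) \<le> a i \<and> a (Suc i) \<le> b i \<and> b (Suc i) \<le> a i \<and> b (Suc i) \<le> b i" for i
        by (auto simp: bounded_steady_pairs_def steadily_decreasing_iff)
      thus "p \<in> bounded_steady_pairs (Suc L)"
        by (auto simp: p bounded_steady_pairs_def steadily_decreasing_iff add_row_def le_diff_conv trans_le_add2)
    qed
    show "f' ` bounded_steady_pairs (Suc L) \<subseteq> bounded_steady_pairs L \<times> UNIV"
      by (auto simp: f'_def bounded_steady_pairs_def steadily_decreasing_iff diff_le_mono)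
  qed
  thus ?thesis unfolding f_def .
qed

text \<open>Split off \<open>e = min u v\<close>. Each unit common to both entries contributes
  \<open>q ^ L * x * y = q ^ Suc L\<close>, each unit of excess \<open>q ^ L * x\<close> or
  \<open>q ^ L * y\<close>, so either region is a product of two geometric series; for u < v one
  unit of excess is compulsory. With A = \<open>q ^ L * x\<close> and B = \<open>q ^ L * y\<close>
  the two values combine by 1 - A B = (1 - B) + B (1 - A).\<close>

lemma has_sum_row:
  fixes x y :: complex
  assumes x: "norm x < 1" and y: "norm y < 1"
  defines "q \<equiv> x * y"
  shows "((\<lambda>(u, v). q ^ (L * max u v) * x ^ u * y ^ v) has_sum
           ((1 - q ^ (2 * L + 1)) / ((1 - q ^ Suc L) * (1 - q ^ L * x) * (1 - q ^ L * y)))) UNIV"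
proof -
  have q: "norm q < 1" using norm_mult_less_one[OF x y] by (simp add: q_def)
  have qL: "norm (q ^ Suc L) < 1" using norm_power_Suc_less[OF q, of L] q by simp
  have xL: "norm (q ^ L * x) < 1" and yL: "norm (q ^ L * y) < 1"
    using norm_power_mult_less_one[OF q] x y by auto
  define g where "g = (\<lambda>(u, v). q ^ (L * max u v) * x ^ u * y ^ v)"
  have 1: "(g has_sum (1 / (1 - q ^ Suc L) * (1 / (1 - q ^ L * x)))) {(u, v). v \<le> u}"
  proof -
    have "((\<lambda>(e, d). (q ^ Suc L) ^ e * (q ^ L * x) ^ d) has_sum (1 / (1 - q ^ Suc L) * (1 / (1 - q ^ L * x)))) (UNIV \<times> UNIV)"
      by (intro has_sum_Times has_sum_geometric qL xL)
    also have "?this \<longleftrightarrow> ?thesis"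
    proof (rule has_sum_reindex_bij_witness[where j = "\<lambda>(e, d). (e + d, e)" and i = "\<lambda>(u, v). (v, u - v)"])
      fix p :: "nat \<times> nat"
      obtain e d where p: "p = (e, d)" by (cases p)
      have "(q ^ Suc L) ^ e * (q ^ L * x) ^ d = q ^ (L * (e + d)) * x ^ (e + d) * y ^ e"
        by (simp add: power_mult_distrib power_add power_mult q_def mult_ac distrib_left)
      thus "g (case p of (e, d) \<Rightarrow> (e + d, e)) = (case p of (e, d) \<Rightarrow> (q ^ Suc L) ^ e * (q ^ L * x) ^ d)"
        by (simp add: p g_def)
    qed auto
    finally show ?thesis .
  qed
  have 2: "(g has_sum (1 / (1 - q ^ Suc L) * (q ^ L * y * (1 / (1 - q ^ L * y))))) {(u, v). u < v}"
  proof -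
    have "((\<lambda>(e, d). (q ^ Suc L) ^ e * (q ^ L * y * (q ^ L * y) ^ d)) has_sum (1 / (1 - q ^ Suc L) * (q ^ L * y * (1 / (1 - q ^ L * y))))) (UNIV \<times> UNIV)"
      by (intro has_sum_Times has_sum_geometric has_sum_cmult_right qL yL)
    also have "?this \<longleftrightarrow> ?thesis"
    proof (rule has_sum_reindex_bij_witness[where j = "\<lambda>(e, d). (e, e + Suc d)" and i = "\<lambda>(u, v). (u, v - Suc u)"])
      fix p :: "nat \<times> nat"
      obtain e d where p: "p = (e, d)" by (cases p)
      have "(q ^ Suc L) ^ e * (q ^ L * y) ^ Suc d = q ^ (L * (e + Suc d)) * x ^ e * y ^ (e + Suc d)"
        by (simp add: power_mult_distrib power_add power_mult q_def mult_ac distrib_left)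
      moreover have "max e (e + Suc d) = e + Suc d" by simp
      ultimately show "g (case p of (e, d) \<Rightarrow> (e, e + Suc d)) = (case p of (e, d) \<Rightarrow> (q ^ Suc L) ^ e * (q ^ L * y * (q ^ L * y) ^ d))"
        by (simp only: p g_def prod.case power_Suc)
    qed auto
    finally show ?thesis .
  qed
  have "(g has_sum (1 / (1 - q ^ Suc L) * (1 / (1 - q ^ L * x)) + 1 / (1 - q ^ Suc L) * (q ^ L * y * (1 / (1 - q ^ L * y)))))
          ({(u, v). v \<le> u} \<union> {(u, v). u < v})"
    by (rule has_sum_Un_disjoint[OF 1 2]) auto
  also have "{(u, v). v \<le> u} \<union> {(u, v). u < v} = (UNIV :: (nat \<times> nat) set)" by auto
  also have "1 / (1 - q ^ Suc L) * (1 / (1 - q ^ L * x)) + 1 / (1 - q ^ Suc L) * (q ^ L * y * (1 / (1 - q ^ L * y)))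
      = (1 - q ^ (2 * L + 1)) / ((1 - q ^ Suc L) * (1 - q ^ L * x) * (1 - q ^ L * y))"
  proof -
    define A B P where "A = q ^ L * x" and "B = q ^ L * y" and "P = 1 - q ^ Suc L"
    have "A * B = q ^ (2 * L + 1)"
    proof -
      have "A * B = q ^ L * q ^ L * (x * y)" by (simp add: A_def B_def mult_ac)
      also have "\<dots> = q ^ (2 * L + 1)" by (simp only: q_def [symmetric] mult_2 power_add power_one_right)
      finally show ?thesis .
    qed
    have "P \<noteq> 0" "1 - A \<noteq> 0" "1 - B \<noteq> 0" using qL xL yL by (auto simp: A_def B_def P_def)
    moreover have "1 - A * B = (1 - B) + B * (1 - A)" by (simp add: algebra_simps)
    hence "(1 - A * B) / (P * (1 - A) * (1 - B)) = (1 - B) / (P * (1 - A) * (1 - B)) + B * (1 - A) / (P * (1 - A) * (1 - B))"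
      by (simp only: add_divide_distrib)
    ultimately have "1 / P * (1 / (1 - A)) + 1 / P * (B * (1 / (1 - B))) = (1 - A * B) / (P * (1 - A) * (1 - B))"
      by simp
    with \<open>A * B = q ^ (2 * L + 1)\<close> show ?thesis by (simp add: A_def B_def P_def)
  qed
  finally show ?thesis unfolding g_def .
qed

lemma has_sum_bounded_steady_pairs:
  fixes x y :: complex
  assumes x: "norm x < 1" and y: "norm y < 1"
  defines "q \<equiv> x * y"
  shows "(pair_term x y has_sum
           (\<Prod>l<L. (1 - q ^ (2 * l + 1)) / ((1 - q ^ Suc l) * (1 - q ^ l * x) * (1 - q ^ l * y)))) (bounded_steady_pairs L)"
proof (induction L)
  case 0
  have "bounded_steady_pairs 0 = {(\<lambda>_. 0, \<lambda>_. 0)}"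
    by (auto simp: bounded_steady_pairs_def steadily_decreasing_iff)
  thus ?case by (simp add: has_sum_finite_iff pair_term_def weight_def)
next
  case (Suc L)
  define j where "j = (\<lambda>((a, b), (u, v)). (add_row L (max u v) u a, add_row L (max u v) v b))"
  have "((\<lambda>(p, r). pair_term x y p * (case r of (u, v) \<Rightarrow> q ^ (L * max u v) * x ^ u * y ^ v)) has_sum
      (\<Prod>l<L. (1 - q ^ (2 * l + 1)) / ((1 - q ^ Suc l) * (1 - q ^ l * x) * (1 - q ^ l * y))) *
         ((1 - q ^ (2 * L + 1)) / ((1 - q ^ Suc L) * (1 - q ^ L * x) * (1 - q ^ L * y))))
      (bounded_steady_pairs L \<times> UNIV)"
    unfolding q_def by (rule has_sum_Times[OF Suc[unfolded q_def] has_sum_row[OF x y]])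
  moreover have "(\<lambda>(p, r). pair_term x y p * (case r of (u, v) \<Rightarrow> q ^ (L * max u v) * x ^ u * y ^ v)) z
                   = pair_term x y (j z)" if "z \<in> bounded_steady_pairs L \<times> UNIV" for z
    using that
    by (auto simp: j_def pair_term_def weight_add_row bounded_steady_pairs_def power_add power_mult_distrib q_def mult_ac)
  ultimately have "((\<lambda>z. pair_term x y (j z)) has_sum
      (\<Prod>l<Suc L. (1 - q ^ (2 * l + 1)) / ((1 - q ^ Suc l) * (1 - q ^ l * x) * (1 - q ^ l * y))))
      (bounded_steady_pairs L \<times> UNIV)"
    by (subst (asm) has_sum_cong) auto
  thus ?case
    using bij_betw_add_row[of L] unfolding j_def [symmetric] by (simp add: has_sum_reindex_bij_betw)
qed

lemma all_steady_pairs_eq: "all_steady_pairs = (\<Union>L. bounded_steady_pairs L)"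
proof (intro equalityI subsetI)
  fix p assume "p \<in> all_steady_pairs"
  then obtain a b where p: "p = (a, b)" and ab: "steadily_decreasing a b" "finite ({i. a i \<noteq> 0} \<union> {i. b i \<noteq> 0})"
    by (auto simp: all_steady_pairs_def)
  from ab(2) obtain L where "\<forall>i\<in>{i. a i \<noteq> 0} \<union> {i. b i \<noteq> 0}. i < L"
    by (meson finite_nat_set_iff_bounded)
  hence "a i = 0 \<and> b i = 0" if "i \<ge> L" for i using that by (meson UnCI leD mem_Collect_eq)
  hence "p \<in> bounded_steady_pairs L" using ab p by (auto simp: bounded_steady_pairs_def)
  thus "p \<in> (\<Union>L. bounded_steady_pairs L)" by blast
next
  fix p assume "p \<in> (\<Union>L. bounded_steady_pairs L)"
  then obtain L a b where p: "p = (a, b)" "steadily_decreasing a b" "\<forall>i\<ge>L. a i = 0 \<and> b i = 0"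
    by (auto simp: bounded_steady_pairs_def)
  have "i < L" if "a i \<noteq> 0 \<or> b i \<noteq> 0" for i using p(3) that by (cases "i < L") auto
  hence "{i. a i \<noteq> 0} \<subseteq> {..<L}" "{i. b i \<noteq> 0} \<subseteq> {..<L}" by auto
  thus "p \<in> all_steady_pairs"
    using p by (auto simp: all_steady_pairs_def intro: finite_subset)
qed

lemma incseq_bounded_steady_pairs: "incseq bounded_steady_pairs"
  by (auto simp: incseq_def bounded_steady_pairs_def)

lemma steady_product_tendsto:
  fixes x y :: complex
  assumes x: "norm x < 1" and y: "norm y < 1"
  defines "q \<equiv> x * y"
  shows "(\<lambda>L. \<Prod>l<L. (1 - q ^ (2 * l + 1)) / ((1 - q ^ Suc l) * (1 - q ^ l * x) * (1 - q ^ l * y)))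
           \<longlonglongrightarrow> 1 / (qprod (q\<^sup>2) (q\<^sup>2) * qprod q x * qprod q y)"
proof -
  have q: "norm q < 1" using norm_mult_less_one[OF x y] by (simp add: q_def)
  have q2: "norm (q\<^sup>2) < 1" using norm_mult_less_one[OF q q] by (simp add: power2_eq_square)
  \<comment> \<open>The odd and the even factors of \<open>(q; q)\<close>. On the logarithmic series
    this is z / (1 - z^2) + z^2 / (1 - z^2) = z / (1 - z).\<close>
  have split: "qprod (q\<^sup>2) q * qprod (q\<^sup>2) (q\<^sup>2) = qprod q q"
  proof -
    have "(\<lambda>m. q ^ Suc m / (of_nat (Suc m) * (1 - (q\<^sup>2) ^ Suc m)) + (q\<^sup>2) ^ Suc m / (of_nat (Suc m) * (1 - (q\<^sup>2) ^ Suc m)))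
            sums (log_qprod (q\<^sup>2) q + log_qprod (q\<^sup>2) (q\<^sup>2))"
      unfolding log_qprod_def by (intro sums_add summable_sums summable_log_qprod q q2)
    also have "(\<lambda>m. q ^ Suc m / (of_nat (Suc m) * (1 - (q\<^sup>2) ^ Suc m)) + (q\<^sup>2) ^ Suc m / (of_nat (Suc m) * (1 - (q\<^sup>2) ^ Suc m)))
             = (\<lambda>m. q ^ Suc m / (of_nat (Suc m) * (1 - q ^ Suc m)))"
    proof
      fix m
      define z N where "z = q ^ Suc m" and "N = (of_nat (Suc m) :: complex)"
      have "(q\<^sup>2) ^ Suc m = z\<^sup>2" unfolding z_def by (metis power_mult mult.commute)
      moreover have "1 - z \<noteq> 0" using one_minus_power_nonzero[OF q, of m] by (simp add: z_def)
      moreover have "norm z < 1" using norm_power_Suc_less[OF q, of m] q by (simp add: z_def)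
      hence "z \<noteq> -1" by auto
      hence "1 + z \<noteq> 0" by (metis add.commute add_eq_0_iff)
      moreover have "N \<noteq> 0" by (simp add: N_def del: of_nat_Suc)
      moreover have "z / (N * (1 - z\<^sup>2)) + z\<^sup>2 / (N * (1 - z\<^sup>2)) = z * (1 + z) / (N * ((1 - z) * (1 + z)))"
        by (simp add: add_divide_distrib [symmetric] algebra_simps power2_eq_square)
      ultimately show "q ^ Suc m / (of_nat (Suc m) * (1 - (q\<^sup>2) ^ Suc m)) + (q\<^sup>2) ^ Suc m / (of_nat (Suc m) * (1 - (q\<^sup>2) ^ Suc m))
          = q ^ Suc m / (of_nat (Suc m) * (1 - q ^ Suc m))"
        unfolding z_def [symmetric] N_def [symmetric] by simp
    qed
    finally have "log_qprod q q = log_qprod (q\<^sup>2) q + log_qprod (q\<^sup>2) (q\<^sup>2)"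
      unfolding log_qprod_def[of q q] by (rule sums_unique [symmetric])
    thus ?thesis by (simp add: qprod_def exp_add [symmetric])
  qed
  have tail: "(\<Prod>l<L. 1 - q ^ l * z) = qprod q z / qprod q (q ^ L * z)" if "norm z < 1" for z L
    using qprod_unfold[OF q that, of L] by simp
  have odd: "(\<Prod>l<L. 1 - q ^ (2 * l + 1)) = qprod (q\<^sup>2) q / qprod (q\<^sup>2) ((q\<^sup>2) ^ L * q)" for L
  proof -
    have "q ^ (2 * l + 1) = (q\<^sup>2) ^ l * q" for l by (simp only: power_add power_mult power_one_right)
    thus ?thesis using qprod_unfold[OF q2 q, of L] by (simp only: qprod_nonzero nonzero_mult_div_cancel_right not_False_eq_True)
  qed
  have diag: "(\<Prod>l<L. 1 - q ^ Suc l) = qprod q q / qprod q (q ^ L * q)" for L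
    using tail[OF q, of L] by (simp add: mult.commute)
  have "(\<lambda>L. qprod (q\<^sup>2) q / qprod (q\<^sup>2) ((q\<^sup>2) ^ L * q) /
           (qprod q q / qprod q (q ^ L * q) * (qprod q x / qprod q (q ^ L * x)) * (qprod q y / qprod q (q ^ L * y))))
         \<longlonglongrightarrow> qprod (q\<^sup>2) q / 1 / (qprod q q / 1 * (qprod q x / 1) * (qprod q y / 1))"
    by (intro tendsto_intros qprod_power_tendsto_1 q q2 x y) auto
  also have "qprod (q\<^sup>2) q / 1 / (qprod q q / 1 * (qprod q x / 1) * (qprod q y / 1)) =
       1 / (qprod (q\<^sup>2) (q\<^sup>2) * qprod q x * qprod q y)"
    unfolding split [symmetric] by simp
  finally show ?thesis
    by (simp only: prod_dividef prod.distrib tail[OF x] tail[OF y] odd diag)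
qed

text \<open>Summability comes first: the moduli of the terms are the terms at \<open>norm x\<close>
  and \<open>norm y\<close>, and each finite sum of them is at most the product for some number of
  rows, a convergent and hence bounded sequence. The value is then the limit of the sums over pairs
  with at most \<open>L\<close> rows.\<close>

theorem has_sum_all_steady_pairs:
  fixes x y :: complex
  assumes x: "norm x < 1" and y: "norm y < 1"
  shows "(pair_term x y has_sum
           (1 / (qprod ((x * y)\<^sup>2) ((x * y)\<^sup>2) * qprod (x * y) x * qprod (x * y) y))) all_steady_pairs"
proof -
  define X Y where "X = complex_of_real (norm x)" and "Y = complex_of_real (norm y)"
  have X: "norm X < 1" and Y: "norm Y < 1" using x y by (simp_all add: X_def Y_def)
  define K where "K = (\<lambda>L. \<Prod>l<L. (1 - (X * Y) ^ (2 * l + 1)) / ((1 - (X * Y) ^ Suc l) * (1 - (X * Y) ^ l * X) * (1 - (X * Y) ^ l * Y)))"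
  have nrm: "norm (pair_term x y p) = norm (pair_term X Y p)" for p
    by (simp add: pair_term_def norm_mult norm_power X_def Y_def)
  have real: "pair_term X Y p = of_real (norm (pair_term x y p))" for p
    by (simp add: pair_term_def norm_mult norm_power X_def Y_def)
  have "Bseq K"
    unfolding K_def using steady_product_tendsto[OF X Y] by (intro convergent_imp_Bseq) (auto simp: convergent_def)
  then obtain C where C: "\<And>L. norm (K L) \<le> C" by (auto simp: Bseq_def)
  have "(\<lambda>p. norm (pair_term x y p)) summable_on all_steady_pairs"
  proof (rule nonneg_bdd_above_summable_on)
    show "bdd_above (sum (\<lambda>p. norm (pair_term x y p)) ` {F. F \<subseteq> all_steady_pairs \<and> finite F})"
    proof (rule bdd_aboveI2)
      fix F assume "F \<in> {F. F \<subseteq> all_steady_pairs \<and> finite F}"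
      hence F: "finite F" "F \<subseteq> (\<Union>L. bounded_steady_pairs L)" by (auto simp: all_steady_pairs_eq)
      then obtain L where L: "F \<subseteq> bounded_steady_pairs L"
        using finite_subset_incseq[OF incseq_bounded_steady_pairs] by blast
      have "((\<lambda>p. of_real (norm (pair_term x y p)) :: complex) has_sum K L) (bounded_steady_pairs L)"
        using has_sum_bounded_steady_pairs[OF X Y, of L] unfolding K_def real[abs_def] .
      hence "((\<lambda>p. norm (pair_term x y p)) has_sum Re (K L)) (bounded_steady_pairs L)"
        by (auto dest: has_sum_Re)
      hence "(\<Sum>p\<in>F. norm (pair_term x y p)) \<le> Re (K L)"
        by (rule finite_sum_le_has_sum) (use F L in auto)
      also have "\<dots> \<le> C" using C[of L] complex_Re_le_cmod order_trans by blast
      finally show "(\<Sum>p\<in>F. norm (pair_term x y p)) \<le> C" .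
    qed
  qed auto
  hence sum: "(pair_term x y has_sum infsum (pair_term x y) all_steady_pairs) (\<Union>L. bounded_steady_pairs L)"
    by (simp add: summable_on_iff_abs_summable_on_complex flip: all_steady_pairs_eq)
  have "infsum (pair_term x y) all_steady_pairs = 1 / (qprod ((x * y)\<^sup>2) ((x * y)\<^sup>2) * qprod (x * y) x * qprod (x * y) y)"
    using has_sum_incseq_limit[OF sum incseq_bounded_steady_pairs has_sum_bounded_steady_pairs[OF x y]]
      steady_product_tendsto[OF x y] LIMSEQ_unique by blast
  with sum show ?thesis by (simp add: all_steady_pairs_eq)
qed

section \<open>The double generating functions of the numbers of pairs and of
  \<open>D\<close>\<close>

lemma has_sum_num_steady_pairs:
  fixes x y :: complex
  assumes x: "norm x < 1" and y: "norm y < 1"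
  shows "((\<lambda>(m, n). of_nat (num_steady_pairs m n) * (x ^ m * y ^ n)) has_sum
           (1 / (qprod ((x * y)\<^sup>2) ((x * y)\<^sup>2) * qprod (x * y) x * qprod (x * y) y))) UNIV"
proof -
  have "((\<lambda>z. pair_term x y (snd z)) has_sum
           (1 / (qprod ((x * y)\<^sup>2) ((x * y)\<^sup>2) * qprod (x * y) x * qprod (x * y) y))) (Sigma UNIV (\<lambda>(m, n). steady_pairs m n))"
    using has_sum_all_steady_pairs[OF x y]
    by (rule has_sum_reindex_bij_witness[where i = "\<lambda>(a, b). ((weight a, weight b), (a, b))" and j = snd, THEN iffD2, rotated -1])
       (auto simp: steady_pairs_def all_steady_pairs_def is_partition_of_def weight_def steadily_decreasing_iff)
  moreover have "((\<lambda>p. pair_term x y (snd (mn, p))) has_sum (\<lambda>(m, n). of_nat (num_steady_pairs m n) * (x ^ m * y ^ n)) mn)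
      (case mn of (m, n) \<Rightarrow> steady_pairs m n)" for mn
  proof (cases mn)
    case (Pair m n)
    have "(\<Sum>p\<in>steady_pairs m n. pair_term x y p) = (\<Sum>p\<in>steady_pairs m n. x ^ m * y ^ n)"
      by (intro sum.cong) (auto simp: steady_pairs_def pair_term_def is_partition_of_def weight_def)
    thus ?thesis using finite_steady_pairs[of m n]
      by (simp add: Pair has_sum_finite_iff num_steady_pairs_def)
  qed
  ultimately show ?thesis by (rule has_sum_SigmaD)
qed

text \<open>The factor \<open>1 - x\<close> removes the first factor of
  \<open>qprod (x * y) x\<close>. The two remaining products have arguments \<open>x * y * x\<close>
  and \<open>y\<close>; exchanging these at fixed \<open>x * y\<close> sends the monomial with
  exponents (m, n) to the one with exponents (2 n - m, n), which is the source of the symmetry of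
  \<open>D\<close>.\<close>

theorem has_sum_D:
  fixes x y :: complex
  assumes x: "norm x < 1" and y: "norm y < 1"
  shows "((\<lambda>(m, n). of_int (D m n) * (x ^ m * y ^ n)) has_sum
           (1 / (qprod ((x * y)\<^sup>2) ((x * y)\<^sup>2) * qprod (x * y) (x * y * x) * qprod (x * y) y))) UNIV"
proof -
  define Z where "Z = 1 / (qprod ((x * y)\<^sup>2) ((x * y)\<^sup>2) * qprod (x * y) x * qprod (x * y) y)"
  define f where "f = (\<lambda>(m, n). of_nat (num_steady_pairs m n) * (x ^ m * y ^ n))"
  define g where "g = (\<lambda>(m, n). of_nat (if m = 0 then 0 else num_steady_pairs (m - 1) n) * (x ^ m * y ^ n))"
  have f: "(f has_sum Z) UNIV"
    unfolding f_def Z_def by (rule has_sum_num_steady_pairs[OF x y])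
  have "((\<lambda>p. x * f p) has_sum (x * Z)) UNIV" by (rule has_sum_cmult_right[OF f])
  also have "?this \<longleftrightarrow> (g has_sum (x * Z)) {(m, n). m > 0}"
    by (rule has_sum_reindex_bij_witness[where j = "\<lambda>(m, n). (Suc m, n)" and i = "\<lambda>(m, n). (m - 1, n)"])
       (auto simp: f_def g_def)
  also have "\<dots> \<longleftrightarrow> (g has_sum (x * Z)) UNIV"
    by (rule has_sum_cong_neutral) (auto simp: g_def)
  finally have g: "(g has_sum (x * Z)) UNIV" .
  have "((\<lambda>p. f p + - g p) has_sum (Z + - (x * Z))) UNIV"
    by (intro has_sum_add f has_sum_uminusI g)
  also have "(\<lambda>p. f p + - g p) = (\<lambda>(m, n). of_int (D m n) * (x ^ m * y ^ n))"
    by (auto simp: f_def g_def D_def fun_eq_iff algebra_simps)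
  also have "Z + - (x * Z) = 1 / (qprod ((x * y)\<^sup>2) ((x * y)\<^sup>2) * qprod (x * y) (x * y * x) * qprod (x * y) y)"
  proof -
    have "1 - x \<noteq> 0" using x by auto
    moreover have "Z + - (x * Z) = (1 - x) * Z" by (simp add: algebra_simps)
    ultimately show ?thesis
      unfolding Z_def qprod_rec[OF norm_mult_less_one[OF x y] x] by simp
  qed
  finally show ?thesis .
qed

subsection \<open>An integral formula for the difference\<close>

text \<open>P of the overview. The product in q^2 is inherited from \<open>has_sum_D\<close>, the
  square of \<open>(q; q)\<close> from \<open>crank_identity\<close>.\<close>

definition steady_gf :: "complex \<Rightarrow> complex" where
  "steady_gf q = 1 / (qprod (q\<^sup>2) (q\<^sup>2) * (qprod q q)\<^sup>2)"

text \<open>Replacing x by x e^(i \<theta>) and y by y e^(-i \<theta>) fixes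
  \<open>q = x * y\<close> and multiplies the (m, n) term by e^(i (m - n) \<theta>). Both double
  series therefore represent the same function of \<theta>, and the sums along a diagonal are its
  Fourier coefficients.\<close>

lemma diagonal_sums_eq:
  fixes q x y :: complex and k :: int
  assumes x: "norm x < 1" and y: "norm y < 1"
  defines "q \<equiv> x * y"
  shows "infsum (\<lambda>(m, n). of_int (D m n) * (x ^ m * y ^ n)) {p. int (fst p) - int (snd p) = k} =
         infsum (\<lambda>(j, l). (q * x) ^ j / qfac q j * (y ^ l / qfac q l)) {p. int (fst p) - int (snd p) = k}
            / qprod (q\<^sup>2) (q\<^sup>2)"
    (is "infsum ?f ?K = infsum ?g ?K / ?E")
proof -
  define u where "u \<theta> = exp (\<i> * complex_of_real \<theta>)" for \<theta>
  define F where "F \<theta> = 1 / (?E * qprod q (q * (x * u \<theta>)) * qprod q (y / u \<theta>))" for \<theta>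
  have u: "norm (u \<theta>) = 1" "u \<theta> \<noteq> 0" for \<theta> by (auto simp: u_def)
  have q: "norm q < 1" using norm_mult_less_one[OF x y] by (simp add: q_def)
  have ue: "u \<theta> ^ a * (1 / u \<theta>) ^ b = exp (\<i> * of_int (int a - int b) * complex_of_real \<theta>)" for \<theta> a b
  proof -
    have "u \<theta> ^ a = exp (of_nat a * (\<i> * complex_of_real \<theta>))" by (simp only: u_def exp_of_nat_mult)
    moreover have "(1 / u \<theta>) ^ b = exp (of_nat b * (- (\<i> * complex_of_real \<theta>)))"
      by (simp only: u_def exp_of_nat_mult exp_minus inverse_eq_divide)
    ultimately show ?thesis by (simp add: exp_add [symmetric] algebra_simps)
  qed
  have pr: "x * u \<theta> * (y / u \<theta>) = q" for \<theta> using u by (simp add: q_def)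
  have xu: "norm (x * u \<theta>) < 1" and yu: "norm (y / u \<theta>) < 1" for \<theta>
    using x y u by (simp_all add: norm_mult norm_divide)
  have 1: "((\<lambda>p. ?f p * exp (\<i> * of_int (int (fst p) - int (snd p)) * complex_of_real \<theta>)) has_sum F \<theta>) UNIV" for \<theta>
  proof -
    have "((\<lambda>(m, n). of_int (D m n) * ((x * u \<theta>) ^ m * (y / u \<theta>) ^ n)) has_sum F \<theta>) UNIV"
      using has_sum_D[OF xu yu, of \<theta> \<theta>] unfolding pr F_def .
    also have "(\<lambda>(m, n). of_int (D m n) * ((x * u \<theta>) ^ m * (y / u \<theta>) ^ n)) =
       (\<lambda>p. ?f p * exp (\<i> * of_int (int (fst p) - int (snd p)) * complex_of_real \<theta>))"
      unfolding ue [symmetric] by (auto simp: fun_eq_iff power_mult_distrib power_divide mult_ac)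
    finally show ?thesis .
  qed
  have 2: "((\<lambda>p. ?g p / ?E * exp (\<i> * of_int (int (fst p) - int (snd p)) * complex_of_real \<theta>)) has_sum F \<theta>) UNIV" for \<theta>
  proof -
    have "((\<lambda>p. (case p of (j, l) \<Rightarrow> (q * (x * u \<theta>)) ^ j / qfac q j * ((y / u \<theta>) ^ l / qfac q l)) / ?E) has_sum
           (1 / qprod q (q * (x * u \<theta>)) * (1 / qprod q (y / u \<theta>)) / ?E)) (UNIV \<times> UNIV)"
      by (intro has_sum_Times has_sum_inverse_qfac has_sum_divide_const q yu norm_mult_less_one xu)
    also have "(\<lambda>p. (case p of (j, l) \<Rightarrow> (q * (x * u \<theta>)) ^ j / qfac q j * ((y / u \<theta>) ^ l / qfac q l)) / ?E) =
       (\<lambda>p. ?g p / ?E * exp (\<i> * of_int (int (fst p) - int (snd p)) * complex_of_real \<theta>))"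
      unfolding ue [symmetric] by (auto simp: fun_eq_iff power_mult_distrib power_divide mult_ac)
    finally show ?thesis by (simp add: F_def mult_ac)
  qed
  have f: "?f summable_on UNIV"
    using has_sum_D[OF x y] by (auto simp: summable_on_def)
  have g: "(\<lambda>p. ?g p / ?E) summable_on UNIV"
    using 2[of 0] by (auto simp: summable_on_def)
  have "infsum ?f ?K = infsum (\<lambda>p. ?g p / ?E) ?K"
    using has_integral_unique[OF has_integral_fourier_coefficient[OF f 1, of k]
      has_integral_fourier_coefficient[OF g 2, of k]] by simp
  also have "\<dots> = infsum ?g ?K / ?E"
    using infsum_cmult_left'[of ?g "1 / ?E" ?K] by simp
  finally show ?thesis .
qed

lemma summable_on_D_diagonal:
  fixes x y :: complex
  assumes x: "norm x < 1" and y: "norm y < 1"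
  shows "(\<lambda>(m, n). of_int (D m n) * (x ^ m * y ^ n)) summable_on K"
  by (rule summable_on_subset_banach[of _ UNIV])
     (use has_sum_D[OF x y] in \<open>auto simp: summable_on_def\<close>)

text \<open>On the diagonal the powers of \<open>x\<close> and \<open>y\<close> reduce to powers of
  \<open>q\<close> times a constant: y^r on one side of it, x^r on the other. Cancelling the
  constant leaves \<open>crank_identity\<close>; for m = n + r the argument \<open>q * x\<close> of
  the first product leaves behind the additional \<open>q ^ r\<close>.\<close>

theorem has_sum_D_diagonal:
  fixes q :: complex
  assumes q: "norm q < 1" "q \<noteq> 0"
  shows "((\<lambda>m. of_int (D m (m + r)) * q ^ m) has_sum (steady_gf q * crank_sum r q)) UNIV"
    and "((\<lambda>n. of_int (D (n + r) n) * q ^ n) has_sum (q ^ r * (steady_gf q * crank_sum r q))) UNIV"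
proof -
  \<comment> \<open>The modulus of \<open>q\<close> is shared equally between \<open>x\<close> and
    \<open>y\<close>, so both lie in the punctured unit disc.\<close>
  define x where "x = complex_of_real (sqrt (norm q))"
  define y where "y = q / x"
  have x0: "x \<noteq> 0" using q by (simp add: x_def)
  have y0: "y \<noteq> 0" using q x0 by (simp add: y_def)
  have xy: "x * y = q" using x0 by (simp add: y_def)
  have nx: "norm x < 1" using q by (simp add: x_def real_sqrt_lt_1_iff)
  have ny: "norm y < 1"
  proof -
    have "norm q = norm x * norm y" using xy by (metis norm_mult)
    moreover have "norm q = norm x * norm x" by (simp add: x_def)
    ultimately show ?thesis using nx x0 by simp
  qed
  have b1: "b = a + r" if "int a - int b = - int r" for a b using that by simp
  have b2: "a = b + r" if "int a - int b = int r" for a b using that by simp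
  let ?f = "\<lambda>(m, n). of_int (D m n) * (x ^ m * y ^ n)"
    and ?g = "\<lambda>(j, l). (q * x) ^ j / qfac q j * (y ^ l / qfac q l)"
    and ?K = "{p. int (fst p) - int (snd p) = - int r}" and ?K' = "{p. int (fst p) - int (snd p) = int r}"
  note eq = diagonal_sums_eq[OF nx ny, unfolded xy]
  define S where "S = crank_sum r q / (qprod q q)\<^sup>2"
  have S: "((\<lambda>j. q ^ (2 * j) / (qfac q j * qfac q (j + r))) has_sum S) UNIV"
    unfolding S_def by (rule crank_identity[OF q(1)])
  have "(?f has_sum
        infsum ?f ?K)
        ?K"
    by (rule has_sum_infsum[OF summable_on_D_diagonal[OF nx ny]])
  also have "?this \<longleftrightarrow> ((\<lambda>m. y ^ r * (of_int (D m (m + r)) * q ^ m)) has_sum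
        infsum ?f ?K) UNIV"
    by (rule has_sum_reindex_bij_witness[where j = fst and i = "\<lambda>m. (m, m + r)"])
       (auto dest!: b1 simp: xy [symmetric] power_mult_distrib power_add)
  finally have 1: "((\<lambda>m. y ^ r * (of_int (D m (m + r)) * q ^ m)) has_sum
        infsum ?f ?K) UNIV" .
  have "((\<lambda>j. y ^ r * (q ^ (2 * j) / (qfac q j * qfac q (j + r)))) has_sum (y ^ r * S)) UNIV"
    by (intro has_sum_cmult_right S)
  also have "?this \<longleftrightarrow> (?g has_sum (y ^ r * S))
       ?K"
  proof (rule has_sum_reindex_bij_witness[where i = fst and j = "\<lambda>m. (m, m + r)"])
    fix j :: nat
    have "(q * x) ^ j * y ^ (j + r) = y ^ r * (q ^ j * (x * y) ^ j)"
      by (simp add: power_mult_distrib power_add mult_ac)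
    hence "(q * x) ^ j * y ^ (j + r) = y ^ r * q ^ (2 * j)"
      by (simp add: xy mult_2 power_add)
    thus "(case (j, j + r) of (j, l) \<Rightarrow> (q * x) ^ j / qfac q j * (y ^ l / qfac q l)) = y ^ r * (q ^ (2 * j) / (qfac q j * qfac q (j + r)))"
      by simp
  qed auto
  finally have "infsum ?g ?K = y ^ r * S"
    by (rule infsumI)
  with 1 have "((\<lambda>m. y ^ r * (of_int (D m (m + r)) * q ^ m)) has_sum (y ^ r * (steady_gf q * crank_sum r q))) UNIV"
    unfolding eq by (simp add: S_def steady_gf_def mult_ac)
  thus "((\<lambda>m. of_int (D m (m + r)) * q ^ m) has_sum (steady_gf q * crank_sum r q)) UNIV"
    by (subst (asm) has_sum_cmult_right_iff) (use y0 in auto)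
  have "(?f has_sum
        infsum ?f ?K')
        ?K'"
    by (rule has_sum_infsum[OF summable_on_D_diagonal[OF nx ny]])
  also have "?this \<longleftrightarrow> ((\<lambda>n. x ^ r * (of_int (D (n + r) n) * q ^ n)) has_sum
        infsum ?f ?K') UNIV"
    by (rule has_sum_reindex_bij_witness[where j = snd and i = "\<lambda>n. (n + r, n)"])
       (auto dest!: b2 simp: xy [symmetric] power_mult_distrib power_add)
  finally have 2: "((\<lambda>n. x ^ r * (of_int (D (n + r) n) * q ^ n)) has_sum
        infsum ?f ?K') UNIV" .
  have "((\<lambda>j. (q * x) ^ r * (q ^ (2 * j) / (qfac q j * qfac q (j + r)))) has_sum ((q * x) ^ r * S)) UNIV"
    by (intro has_sum_cmult_right S)
  also have "?this \<longleftrightarrow> (?g has_sum ((q * x) ^ r * S))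
       ?K'"
  proof (rule has_sum_reindex_bij_witness[where i = snd and j = "\<lambda>l. (l + r, l)"])
    fix l :: nat
    have "(q * x) ^ (l + r) * y ^ l = (q * x) ^ r * (q ^ l * (x * y) ^ l)"
      by (simp add: power_mult_distrib power_add mult_ac)
    hence "(q * x) ^ (l + r) * y ^ l = (q * x) ^ r * q ^ (2 * l)"
      by (simp add: xy mult_2 power_add)
    thus "(case (l + r, l) of (j, l) \<Rightarrow> (q * x) ^ j / qfac q j * (y ^ l / qfac q l)) = (q * x) ^ r * (q ^ (2 * l) / (qfac q l * qfac q (l + r)))"
      by simp
  qed auto
  finally have "infsum ?g ?K' = (q * x) ^ r * S"
    by (rule infsumI)
  with 2 have "((\<lambda>n. x ^ r * (of_int (D (n + r) n) * q ^ n)) has_sum (x ^ r * (q ^ r * (steady_gf q * crank_sum r q)))) UNIV"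
    unfolding eq by (simp add: S_def steady_gf_def power_mult_distrib mult_ac)
  thus "((\<lambda>n. of_int (D (n + r) n) * q ^ n) has_sum (q ^ r * (steady_gf q * crank_sum r q))) UNIV"
    by (subst (asm) has_sum_cmult_right_iff) (use x0 in auto)
qed

section \<open>Cauchy's formula for the coefficients on a circle\<close>

lemma has_integral_coefficient:
  fixes c :: "nat \<Rightarrow> complex"
  assumes \<rho>: "0 < \<rho>" and G: "\<And>\<theta>. ((\<lambda>n. c n * (of_real \<rho> * exp (\<i> * complex_of_real \<theta>)) ^ n) has_sum G \<theta>) UNIV"
  shows "((\<lambda>\<theta>. G \<theta> * exp (- (\<i> * of_int (int k) * complex_of_real \<theta>))) has_integral (2 * pi * (c k * of_real \<rho> ^ k))) {-pi..pi}"
proof -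
  have e: "exp (\<i> * complex_of_real \<theta>) ^ n = exp (\<i> * of_int (int n) * complex_of_real \<theta>)" for \<theta> n
    by (simp add: exp_of_nat_mult [symmetric] mult_ac)
  have F: "((\<lambda>n. c n * of_real \<rho> ^ n * exp (\<i> * of_int (int n) * complex_of_real \<theta>)) has_sum G \<theta>) UNIV" for \<theta>
    using G[of \<theta>] by (simp only: power_mult_distrib e mult.assoc)
  have "(\<lambda>n. c n * of_real \<rho> ^ n) summable_on UNIV"
    using F[of 0] by (auto simp: summable_on_def)
  from has_integral_fourier_coefficient[OF this F, of "int k"]
  have "((\<lambda>\<theta>. G \<theta> * exp (- (\<i> * of_int (int k) * complex_of_real \<theta>))) has_integral
          (2 * pi * infsum (\<lambda>n. c n * of_real \<rho> ^ n) {n \<in> UNIV. int n = int k})) {-pi..pi}" .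
  moreover have "{n \<in> UNIV. int n = int k} = {k}" by auto
  ultimately show ?thesis by simp
qed

text \<open>For n < m the factor \<open>q ^ r\<close> shifts the frequency: the coefficient of q^n
  in \<open>q\<^sup>r P T\<^sub>r\<close> is that of q^(n - r) in \<open>P T\<^sub>r\<close>, and n
  - r = 2 n - m. Both cases thus share one integrand, depending only on |n - m| and
  \<open>min m (2 * n - m)\<close>.\<close>

theorem D_has_integral:
  assumes \<rho>: "0 < \<rho>" "\<rho> < 1" and mn: "m \<le> 2 * n"
  defines "z \<equiv> (\<lambda>\<theta>. of_real \<rho> * exp (\<i> * complex_of_real \<theta>))"
  shows "((\<lambda>\<theta>. steady_gf (z \<theta>) * crank_sum (nat \<bar>int n - int m\<bar>) (z \<theta>) *
            exp (- (\<i> * of_nat (min m (2 * n - m)) * complex_of_real \<theta>))) has_integral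
            (2 * pi * (of_int (D m n) * of_real \<rho> ^ min m (2 * n - m)))) {-pi..pi}"
proof -
  have z: "norm (z \<theta>) < 1" "z \<theta> \<noteq> 0" for \<theta> using \<rho> by (auto simp: z_def norm_mult)
  show ?thesis
  proof (cases "m \<le> n")
    case True
    then obtain r where r: "n = m + r" using le_Suc_ex by blast
    have "((\<lambda>k. of_int (D k (k + r)) * (of_real \<rho> * exp (\<i> * complex_of_real \<theta>)) ^ k) has_sum (steady_gf (z \<theta>) * crank_sum r (z \<theta>))) UNIV" for \<theta>
      using has_sum_D_diagonal(1)[OF z, of r \<theta>] unfolding z_def .
    from has_integral_coefficient[OF \<rho>(1) this, of m]
    show ?thesis using r by (simp add: min_def)
  next
    case False
    then obtain r where r: "m = n + r" by (metis le_Suc_ex nat_le_linear)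
    with mn have rn: "r \<le> n" by simp
    have "((\<lambda>k. of_int (D (k + r) k) * (of_real \<rho> * exp (\<i> * complex_of_real \<theta>)) ^ k) has_sum (z \<theta> ^ r * (steady_gf (z \<theta>) * crank_sum r (z \<theta>)))) UNIV" for \<theta>
      using has_sum_D_diagonal(2)[OF z, of r \<theta>] unfolding z_def .
    from has_integral_coefficient[OF \<rho>(1) this, of n]
    have I: "((\<lambda>\<theta>. z \<theta> ^ r * (steady_gf (z \<theta>) * crank_sum r (z \<theta>)) * exp (- (\<i> * of_int (int n) * complex_of_real \<theta>))) has_integral
            (2 * pi * (of_int (D m n) * of_real \<rho> ^ n))) {-pi..pi}"
      by (simp add: r)
    have *: "z \<theta> ^ r * (steady_gf (z \<theta>) * crank_sum r (z \<theta>)) * exp (- (\<i> * of_int (int n) * complex_of_real \<theta>))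
      = of_real \<rho> ^ r * (steady_gf (z \<theta>) * crank_sum r (z \<theta>) * exp (- (\<i> * of_nat (n - r) * complex_of_real \<theta>)))" for \<theta>
    proof -
      have "z \<theta> ^ r = of_real \<rho> ^ r * exp (of_nat r * (\<i> * complex_of_real \<theta>))"
        by (simp only: z_def power_mult_distrib exp_of_nat_mult)
      moreover have "exp (of_nat r * (\<i> * complex_of_real \<theta>)) * exp (- (\<i> * of_int (int n) * complex_of_real \<theta>)) =
          exp (- (\<i> * of_nat (n - r) * complex_of_real \<theta>))"
        using rn by (simp add: exp_add [symmetric] of_nat_diff algebra_simps)
      ultimately show ?thesis by (simp add: mult_ac)
    qed
    have "((\<lambda>\<theta>. (1 / of_real \<rho> ^ r) * (of_real \<rho> ^ r * (steady_gf (z \<theta>) * crank_sum r (z \<theta>) * exp (- (\<i> * of_nat (n - r) * complex_of_real \<theta>)))))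
      has_integral ((1 / of_real \<rho> ^ r) * complex_of_real (2 * pi * (of_int (D m n) * of_real \<rho> ^ n)))) {-pi..pi}"
      using I unfolding * by (rule has_integral_mult_right)
    moreover have "complex_of_real \<rho> ^ n = of_real \<rho> ^ r * of_real \<rho> ^ (n - r)"
      using rn by (simp add: power_add [symmetric])
    ultimately have "((\<lambda>\<theta>. steady_gf (z \<theta>) * crank_sum r (z \<theta>) * exp (- (\<i> * of_nat (n - r) * complex_of_real \<theta>)))
      has_integral (2 * pi * (of_int (D m n) * of_real \<rho> ^ (n - r)))) {-pi..pi}"
      using \<rho> by (simp add: mult_ac)
    moreover have "nat \<bar>int n - int m\<bar> = r" "min m (2 * n - m) = n - r" using r rn by auto
    ultimately show ?thesis by simp
  qed
qed

subsection \<open>The alternating sum near the positive real axis\<close>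

text \<open>Splitting the factor \<open>1 - q ^ (i + 1)\<close> of \<open>crank_term\<close>
  expresses a crank sum through the partial theta series at s and s + 1. Unlike the crank sums,
  these satisfy a recurrence of first order, obtained by detaching the initial term.\<close>

definition theta_term :: "nat \<Rightarrow> complex \<Rightarrow> nat \<Rightarrow> complex" where
  "theta_term s q i = (-1) ^ i * q ^ (i * s + i * (i + 1) div 2)"

definition partial_theta :: "nat \<Rightarrow> complex \<Rightarrow> complex" where
  "partial_theta s q = suminf (theta_term s q)"

lemma summable_partial_theta:
  fixes q :: complex
  assumes q: "norm q < 1"
  shows "summable (theta_term s q)"
proof (rule summable_comparison_test'[where N = 0])
  show "summable (\<lambda>i. norm q ^ i)" using q by (intro summable_geometric) auto
  fix i :: nat
  have "i \<le> i * s + i * (i + 1) div 2" by (cases i) auto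
  thus "norm (theta_term s q i) \<le> norm q ^ i"
    using q unfolding theta_term_def norm_mult norm_power by (simp add: power_decreasing)
qed

lemma partial_theta_rec:
  assumes q: "norm q < 1"
  shows "partial_theta s q = 1 - q ^ Suc s * partial_theta (Suc s) q"
proof -
  have "(\<lambda>i. - (q ^ Suc s) * theta_term (Suc s) q i) sums
          (- (q ^ Suc s) * partial_theta (Suc s) q)"
    unfolding partial_theta_def by (intro sums_mult summable_sums summable_partial_theta q)
  also have "(\<lambda>i. - (q ^ Suc s) * theta_term (Suc s) q i) =
             (\<lambda>i. theta_term s q (Suc i))"
  proof
    fix i
    have "Suc i * s + Suc i * (Suc i + 1) div 2 = Suc s + (i * Suc s + i * (i + 1) div 2)"
    proof -
      have "Suc i * (Suc i + 1) = i * (i + 1) + (i + 1) * 2" by simp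
      hence "Suc i * (Suc i + 1) div 2 = i * (i + 1) div 2 + (i + 1)"
        by (metis div_mult_self1 add.commute zero_neq_numeral)
      thus ?thesis by simp
    qed
    thus "- (q ^ Suc s) * theta_term (Suc s) q i =
          theta_term s q (Suc i)"
      unfolding theta_term_def by (simp only: power_add) simp
  qed
  finally have "theta_term s q sums (- (q ^ Suc s) * partial_theta (Suc s) q + 1)"
    by (subst (asm) sums_Suc_iff) (simp add: theta_term_def)
  thus ?thesis unfolding partial_theta_def[of s] by (simp add: sums_iff)
qed

lemma crank_sum_partial_theta:
  assumes q: "norm q < 1"
  shows "crank_sum s q = partial_theta s q - q * partial_theta (Suc s) q"
proof -
  have "(\<lambda>i. theta_term s q i - q * theta_term (Suc s) q i) sums
          (partial_theta s q - q * partial_theta (Suc s) q)"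
    unfolding partial_theta_def by (intro sums_diff sums_mult summable_sums summable_partial_theta q)
  also have "(\<lambda>i. theta_term s q i - q * theta_term (Suc s) q i) =
     crank_term s q"
  proof
    fix i
    have "i * Suc s + i * (i + 1) div 2 = (i * s + i * (i + 1) div 2) + i" by simp
    hence "q ^ (i * Suc s + i * (i + 1) div 2) = q ^ (i * s + i * (i + 1) div 2) * q ^ i"
      by (simp only: power_add)
    thus "theta_term s q i - q * theta_term (Suc s) q i =
          crank_term s q i"
      unfolding theta_term_def crank_term_def by (simp only:) (simp add: algebra_simps)
  qed
  finally show ?thesis unfolding crank_sum_def by (simp add: sums_iff)
qed

text \<open>The recurrence is followed towards infinity, where no value is known; boundedness takes
  its place. The distance to the fixed point \<open>E / (1 - \<kappa>)\<close> picks up a factor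
  \<kappa> per step, and \<kappa>^n times a bounded quantity tends to 0.\<close>

lemma bounded_recurrence_le:
  fixes w :: "nat \<Rightarrow> real"
  assumes \<kappa>: "0 \<le> \<kappa>" "\<kappa> < 1" and W: "\<And>s. w s \<le> W"
    and rec: "\<And>s. s \<ge> M \<Longrightarrow> w s \<le> E + \<kappa> * w (Suc s)" and E: "0 \<le> E" and s: "s \<ge> M"
  shows "w s \<le> E / (1 - \<kappa>)"
proof -
  have "w s - E / (1 - \<kappa>) \<le> \<kappa> ^ n * (w (s + n) - E / (1 - \<kappa>))" for n
  proof (induction n)
    case (Suc n)
    have "w (s + n) - E / (1 - \<kappa>) \<le> \<kappa> * (w (Suc (s + n)) - E / (1 - \<kappa>))"
    proof -
      have "E / (1 - \<kappa>) - \<kappa> * (E / (1 - \<kappa>)) = (1 - \<kappa>) * (E / (1 - \<kappa>))"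
        by (simp only: left_diff_distrib mult_1)
      also have "\<dots> = E" using \<kappa> by simp
      finally show ?thesis using rec[of "s + n"] s by (simp add: right_diff_distrib)
    qed
    hence "\<kappa> ^ n * (w (s + n) - E / (1 - \<kappa>)) \<le> \<kappa> ^ n * (\<kappa> * (w (Suc (s + n)) - E / (1 - \<kappa>)))"
      using \<kappa> by (intro mult_left_mono) auto
    with Suc show ?case by (simp add: mult_ac)
  qed auto
  hence "w s - E / (1 - \<kappa>) \<le> \<kappa> ^ n * (W - E / (1 - \<kappa>))" for n
    using W[of "s + n"] \<kappa> by (meson diff_right_mono mult_left_mono order_trans zero_le_power)
  moreover have "(\<lambda>n. \<kappa> ^ n * (W - E / (1 - \<kappa>))) \<longlonglongrightarrow> 0 * (W - E / (1 - \<kappa>))"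
    using \<kappa> by (intro tendsto_intros LIMSEQ_power_zero) auto
  ultimately have "w s - E / (1 - \<kappa>) \<le> 0 * (W - E / (1 - \<kappa>))"
    by (intro tendsto_lowerbound[of _ _ sequentially]) (auto intro!: always_eventually)
  thus ?thesis by simp
qed

lemma exp_neg_le_half:
  fixes x :: real
  assumes "x \<ge> 1"
  shows "exp (- x) \<le> 1 / 2"
proof -
  have "2 \<le> exp x" using exp_ge_add_one_self[of x] assms by linarith
  thus ?thesis by (simp add: exp_minus field_simps)
qed

lemma exp_minus_le_one_minus_half:
  fixes x :: real
  assumes "0 \<le> x" "x \<le> 1"
  shows "exp (- x) \<le> 1 - x / 2"
proof -
  have "exp (- x) \<le> 1 / (1 + x)"
    unfolding exp_minus inverse_eq_divide using assms by (intro frac_le) auto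
  also have "(1 - x / 2) * (1 + x) = 1 + x * (1 - x) / 2" by (simp add: field_simps)
  hence "1 \<le> (1 - x / 2) * (1 + x)" using assms by simp
  hence "1 / (1 + x) \<le> 1 - x / 2" using assms by (subst pos_divide_le_eq) auto
  finally show ?thesis .
qed

text \<open>If s Re \<tau> is at most 1, the sector keeps the argument of the power below pi / 2, so
  its real part is nonnegative; otherwise its modulus is at most 1 / e.\<close>

lemma norm_one_plus_exp_ge:
  fixes \<tau> :: complex
  assumes t: "0 < Re \<tau>" and sector: "\<bar>Im \<tau>\<bar> \<le> Re \<tau>"
  shows "norm (1 + exp (- \<tau>) ^ s) \<ge> 1 / 2"
proof -
  have e: "exp (- \<tau>) ^ s = exp (- (of_nat s * \<tau>))" by (simp add: exp_of_nat_mult [symmetric])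
  show ?thesis
  proof (cases "real s * Re \<tau> \<le> 1")
    case True
    have "\<bar>real s * Im \<tau>\<bar> \<le> real s * Re \<tau>" using sector by (simp add: abs_mult mult_left_mono)
    hence "\<bar>real s * Im \<tau>\<bar> \<le> 1" using True by linarith
    hence "cos (real s * Im \<tau>) \<ge> 0" using pi_gt3 by (intro cos_ge_zero) auto
    hence "Re (exp (- \<tau>) ^ s) \<ge> 0" unfolding e by (simp add: Re_exp)
    hence "Re (1 + exp (- \<tau>) ^ s) \<ge> 1" by simp
    thus ?thesis using complex_Re_le_cmod[of "1 + exp (- \<tau>) ^ s"] by linarith
  next
    case False
    have "norm (exp (- \<tau>) ^ s) \<le> 1 / 2"
      unfolding e norm_exp_eq_Re using exp_neg_le_half[of "real s * Re \<tau>"] False by simp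
    thus ?thesis using norm_triangle_ineq4[of "1 + exp (- \<tau>) ^ s" "exp (- \<tau>) ^ s"] by simp
  qed
qed

text \<open>Mean value inequality on the left half-plane, where the derivative of \<open>exp\<close>
  has modulus at most 1.\<close>

lemma norm_one_minus_exp_le:
  fixes \<tau> :: complex
  assumes t: "0 \<le> Re \<tau>"
  shows "norm (1 - exp (- \<tau>)) \<le> norm \<tau>"
proof -
  have "norm (exp (- \<tau>) - exp 0) \<le> 1 * norm (- \<tau> - 0)"
  proof (rule field_differentiable_bound[where S = "{z. Re z \<le> 0}" and f' = exp])
    show "convex {z. Re z \<le> 0}" by (rule convex_halfspace_Re_le)
    show "(exp has_field_derivative exp z) (at z within {z. Re z \<le> 0})" for z
      by (auto intro!: derivative_eq_intros)
  qed (use t in \<open>auto simp: norm_exp_eq_Re\<close>)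
  thus ?thesis by (simp add: norm_minus_commute)
qed

text \<open>
  With \<open>z = q\<^sup>s\<close>, the quotient \<open>v\<^sub>s = T\<^sub>s(q) / ((1 - q) (1 + z))\<close> satisfies
  \<open>v\<^sub>s + z q\<^sup>2 v\<^bsub>s+1\<^esub> = 1 / ((1 + z) (1 + q z))\<close>. For \<open>q = 1\<close> this is solved by \<open>(1 + z)\<^sup>-\<^sup>3\<close>, and the error
  obeys a recurrence that contracts after about \<open>(Re \<tau>)\<^bsup>-1/2\<^esup>\<close> steps.
\<close>

theorem crank_sum_approx:
  fixes \<tau> :: complex
  assumes t: "0 < Re \<tau>" "Re \<tau> \<le> 1" and sector: "\<bar>Im \<tau>\<bar> \<le> Re \<tau>"
  defines "q \<equiv> exp (- \<tau>)"
  shows "norm (crank_sum r q / (1 - q) - 1 / (1 + q ^ r)\<^sup>2) \<le> 1344 * sqrt (Re \<tau>)"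
proof -
  define \<rho> where "\<rho> = norm q"
  have \<rho>: "\<rho> = exp (- Re \<tau>)" by (simp add: \<rho>_def q_def norm_exp_eq_Re)
  have q: "norm q < 1" "q \<noteq> 0" using t by (auto simp: q_def norm_exp_eq_Re)
  have q1: "1 - q \<noteq> 0" using q by auto
  have ge: "norm (1 + q ^ s) \<ge> 1 / 2" for s
    unfolding q_def by (rule norm_one_plus_exp_ge[OF t(1) sector])
  hence nz: "1 + q ^ s \<noteq> 0" for s by (metis norm_zero not_one_le_zero zero_less_divide_1_iff zero_less_numeral not_le)
  define v where "v s = crank_sum s q / ((1 - q) * (1 + q ^ s))" for s
  define w where "w s = v s - 1 / (1 + q ^ s) ^ 3" for s
  have n1: "norm (1 - q) \<le> 2 * Re \<tau>"
  proof -
    have "norm (1 - q) \<le> norm \<tau>" unfolding q_def using t by (intro norm_one_minus_exp_le) auto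
    also have "\<dots> \<le> \<bar>Re \<tau>\<bar> + \<bar>Im \<tau>\<bar>" by (rule cmod_le)
    finally show ?thesis using sector t by linarith
  qed
  have v_rec: "v s + q ^ s * q\<^sup>2 * v (Suc s) = 1 / ((1 + q ^ s) * (1 + q ^ Suc s))" for s
  proof -
    define \<Theta>0 \<Theta>1 \<Theta>2 where "\<Theta>0 = partial_theta s q" and "\<Theta>1 = partial_theta (Suc s) q"
      and "\<Theta>2 = partial_theta (Suc (Suc s)) q"
    define z where "z = q ^ s"
    have z: "z \<noteq> 0" "1 + z \<noteq> 0" "1 + q * z \<noteq> 0" using nz[of s] nz[of "Suc s"] q by (auto simp: z_def)
    have r: "\<Theta>0 = 1 - q * z * \<Theta>1" "\<Theta>1 = 1 - q * (q * z) * \<Theta>2"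
      using partial_theta_rec[OF q(1), of s] partial_theta_rec[OF q(1), of "Suc s"]
      by (simp_all add: \<Theta>0_def \<Theta>1_def \<Theta>2_def z_def)
    \<comment> \<open>Multiplying by \<open>z\<close> brings in \<open>q * z * \<Theta>1\<close>,
      which the recurrence turns into \<open>1 - \<Theta>0\<close>. Each crank sum then involves a
      single theta value, and one more use of the recurrence eliminates these from the combination
      of \<open>v s\<close> and \<open>v (Suc s)\<close>.\<close>
    have v0: "z * (1 - q) * v s = \<Theta>0 - 1 / (1 + z)"
    proof -
      have "z * (\<Theta>0 - q * \<Theta>1) = (1 + z) * \<Theta>0 - 1" using r(1) by (simp add: algebra_simps)
      hence "z * (1 - q) * v s = ((1 + z) * \<Theta>0 - 1) / (1 + z)"
        using q1 unfolding v_def crank_sum_partial_theta[OF q(1)]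
        by (simp add: \<Theta>0_def \<Theta>1_def z_def)
      also have "\<dots> = \<Theta>0 - 1 / (1 + z)" using z by (simp add: diff_divide_distrib)
      finally show ?thesis .
    qed
    have v1: "q * z * (1 - q) * v (Suc s) = \<Theta>1 - 1 / (1 + q * z)"
    proof -
      have "q * z * (\<Theta>1 - q * \<Theta>2) = (1 + q * z) * \<Theta>1 - 1" using r(2) by (simp add: algebra_simps)
      hence "q * z * (1 - q) * v (Suc s) = ((1 + q * z) * \<Theta>1 - 1) / (1 + q * z)"
        using q1 unfolding v_def crank_sum_partial_theta[OF q(1)]
        by (simp add: \<Theta>1_def \<Theta>2_def z_def mult.assoc)
      also have "\<dots> = \<Theta>1 - 1 / (1 + q * z)" using z by (simp add: diff_divide_distrib)
      finally show ?thesis .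
    qed
    have "z * (1 - q) * (v s + z * q\<^sup>2 * v (Suc s)) = z * (1 - q) * v s + q * z * (q * z * (1 - q) * v (Suc s))"
      by (simp add: algebra_simps power2_eq_square)
    also have "\<dots> = 1 - 1 / (1 + z) - q * z / (1 + q * z)"
      unfolding v0 v1 using r(1) by (simp add: algebra_simps)
    also have "\<dots> = z * (1 - q) / ((1 + z) * (1 + q * z))"
    proof -
      have "1 - 1 / (1 + z) = z / (1 + z)" using z by (simp add: field_simps)
      moreover have "z / (1 + z) - q * z / (1 + q * z) = (z * (1 + q * z) - q * z * (1 + z)) / ((1 + z) * (1 + q * z))"
        using z by (simp add: diff_frac_eq)
      ultimately show ?thesis by (simp add: algebra_simps)
    qed
    finally have "z * (1 - q) * (v s + z * q\<^sup>2 * v (Suc s)) = z * (1 - q) * (1 / ((1 + z) * (1 + q * z)))"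
      by simp
    moreover have "z * (1 - q) \<noteq> 0" using z q1 by simp
    ultimately have "v s + z * q\<^sup>2 * v (Suc s) = 1 / ((1 + z) * (1 + q * z))"
      by (metis mult_left_cancel)
    thus ?thesis by (simp add: z_def)
  qed
  \<comment> \<open>84 = 8 + 64 + 12, one summand for each of the three error terms below, using
    |A|, |B| at most 2 and |A - B| at most 4 |1 - q|.\<close>
  define E where "E = 84 * norm (1 - q)"
  have w_rec: "norm (w s) \<le> E + \<rho> ^ s * norm (w (Suc s))" for s
  proof -
    define A B where "A = 1 / (1 + q ^ s)" and "B = 1 / (1 + q ^ Suc s)"
    have "norm (1 / (1 + q ^ n)) \<le> 1 / (1 / 2)" for n
      unfolding norm_divide norm_one using ge[of n] by (intro frac_le) auto
    hence A2: "norm A \<le> 2" and B2: "norm B \<le> 2" by (simp_all add: A_def B_def del: power_Suc)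
    have zle: "norm (q ^ s) \<le> 1" using q by (simp add: norm_power power_le_one)
    have AB: "A - B = - (q ^ s * (1 - q) * A * B)"
    proof -
      have "A - B = (1 * (1 + q ^ Suc s) - 1 * (1 + q ^ s)) / ((1 + q ^ s) * (1 + q ^ Suc s))"
        unfolding A_def B_def by (rule diff_frac_eq[OF nz nz])
      also have "1 * (1 + q ^ Suc s) - 1 * (1 + q ^ s) = - (q ^ s * (1 - q))" by (simp add: algebra_simps)
      finally show ?thesis by (simp add: A_def B_def)
    qed
    have "norm (A - B) \<le> 1 * norm (1 - q) * 2 * 2"
      unfolding AB norm_minus_cancel norm_mult using zle A2 B2 by (intro mult_mono) auto
    hence AB': "norm (A - B) \<le> 4 * norm (1 - q)" by simp
    have zB: "q ^ s * q * B = 1 - B" using nz[of "Suc s"] by (simp add: B_def field_simps)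
    have "w s = A * B - A ^ 3 - q * (q ^ s * q * B) * B ^ 2 - q ^ s * q\<^sup>2 * w (Suc s)"
      using v_rec[of s] unfolding w_def A_def B_def
      by (simp add: algebra_simps power2_eq_square power3_eq_cube power_one_over)
    \<comment> \<open>For q = 1 the inhomogeneous part vanishes, since then A = B. The regrouping
      shows a factor A - B or 1 - q in every summand.\<close>
    also have "\<dots> = (A * (B - A) + (A - B) * (A + B - (A\<^sup>2 + A * B + B\<^sup>2)) + (1 - q) * (B\<^sup>2 - B ^ 3)) - q ^ s * q\<^sup>2 * w (Suc s)"
      unfolding zB by (simp add: algebra_simps power2_eq_square power3_eq_cube)
    finally have "norm (w s) \<le> norm (A * (B - A) + (A - B) * (A + B - (A\<^sup>2 + A * B + B\<^sup>2)) + (1 - q) * (B\<^sup>2 - B ^ 3))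
        + norm (q ^ s * q\<^sup>2 * w (Suc s))" by (simp only:) (rule norm_triangle_ineq4)
    moreover have "norm (A * (B - A) + (A - B) * (A + B - (A\<^sup>2 + A * B + B\<^sup>2)) + (1 - q) * (B\<^sup>2 - B ^ 3)) \<le> E"
    proof -
      have "norm (A * (B - A)) \<le> 2 * (4 * norm (1 - q))"
        unfolding norm_mult using A2 AB' by (intro mult_mono) (auto simp: norm_minus_commute)
      moreover have "norm (A + B - (A\<^sup>2 + A * B + B\<^sup>2)) \<le> (2 + 2) + (2\<^sup>2 + 2 * 2 + 2\<^sup>2)"
      proof -
        have "norm (A\<^sup>2) \<le> 2\<^sup>2" "norm (B\<^sup>2) \<le> 2\<^sup>2" "norm (A * B) \<le> 2 * 2"
          using power_mono[OF A2 norm_ge_zero, of 2] power_mono[OF B2 norm_ge_zero, of 2] mult_mono[OF A2 B2]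
          by (auto simp: norm_power norm_mult)
        moreover have "norm (A\<^sup>2 + A * B + B\<^sup>2) \<le> norm (A\<^sup>2) + norm (A * B) + norm (B\<^sup>2)"
          using norm_triangle_ineq[of "A\<^sup>2 + A * B" "B\<^sup>2"] norm_triangle_ineq[of "A\<^sup>2" "A * B"] by linarith
        ultimately show ?thesis
          using norm_triangle_ineq4[of "A + B" "A\<^sup>2 + A * B + B\<^sup>2"] norm_triangle_ineq[of A B] A2 B2 by linarith
      qed
      hence "norm ((A - B) * (A + B - (A\<^sup>2 + A * B + B\<^sup>2))) \<le> (4 * norm (1 - q)) * 16"
        unfolding norm_mult using AB' by (intro mult_mono) auto
      moreover have "norm (B\<^sup>2 - B ^ 3) \<le> 2\<^sup>2 + 2 ^ 3"
        using norm_triangle_ineq4[of "B\<^sup>2" "B ^ 3"] power_mono[OF B2 norm_ge_zero, of 2] power_mono[OF B2 norm_ge_zero, of 3]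
        unfolding norm_power by linarith
      hence "norm ((1 - q) * (B\<^sup>2 - B ^ 3)) \<le> norm (1 - q) * 12"
        unfolding norm_mult by (intro mult_mono) auto
      ultimately show ?thesis
        using norm_triangle_ineq[of "A * (B - A) + (A - B) * (A + B - (A\<^sup>2 + A * B + B\<^sup>2))" "(1 - q) * (B\<^sup>2 - B ^ 3)"]
          norm_triangle_ineq[of "A * (B - A)" "(A - B) * (A + B - (A\<^sup>2 + A * B + B\<^sup>2))"]
        unfolding E_def by linarith
    qed
    moreover have "norm (q ^ s * q\<^sup>2 * w (Suc s)) \<le> \<rho> ^ s * 1 * norm (w (Suc s))"
      unfolding norm_mult norm_power \<rho>_def using q by (intro mult_mono) (auto intro: power_le_one)
    ultimately show ?thesis by simp
  qed
  \<comment> \<open>A crude bound that degenerates as q tends to 1, but is uniform in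
    \<open>s\<close>, which is all that \<open>bounded_recurrence_le\<close> asks for.\<close>
  have bounded: "norm (w s) \<le> 2 / (1 - norm q) / (norm (1 - q) * (1 / 2)) + 8" for s
  proof -
    have "norm (v s) \<le> 2 / (1 - norm q) / (norm (1 - q) * (1 / 2))"
      unfolding v_def norm_divide norm_mult using q q1 ge[of s] norm_crank_sum_le[OF q(1), of s]
      by (intro frac_le mult_left_mono mult_pos_pos) auto
    moreover have "norm (1 / (1 + q ^ s) ^ 3) \<le> 1 / (1 / 2) ^ 3"
      unfolding norm_divide norm_power norm_one using ge[of s] by (intro frac_le power_mono) auto
    ultimately show ?thesis using norm_triangle_ineq4[of "v s" "1 / (1 + q ^ s) ^ 3"]
      unfolding w_def by (simp add: power3_eq_cube)
  qed
  \<comment> \<open>From index 1 / sqrt (Re \<tau>) on, the contraction factor is at most 1 - sqrt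
    (Re \<tau>) / 2, so the error is O(E / sqrt (Re \<tau>)). Descending through the indices below
    \<open>M\<close> without contraction costs about as much again.\<close>
  define M where "M = nat \<lceil>1 / sqrt (Re \<tau>)\<rceil>"
  have M: "1 / sqrt (Re \<tau>) \<le> real M" "real M \<le> 1 / sqrt (Re \<tau>) + 1"
    unfolding M_def using t by (auto simp: real_nat_ceiling_ge intro: of_nat_ceiling order.trans[OF of_nat_ceiling])
  have E0: "E \<ge> 0" by (simp add: E_def)
  have st: "sqrt (Re \<tau>) > 0" "sqrt (Re \<tau>) \<le> 1" using t by auto
  have \<kappa>: "0 \<le> \<rho> ^ M" "\<rho> ^ M \<le> 1 - sqrt (Re \<tau>) / 2"
  proof -
    show "0 \<le> \<rho> ^ M" by (simp add: \<rho>)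
    have "Re \<tau> * (1 / sqrt (Re \<tau>)) \<le> Re \<tau> * real M"
      using M(1) t by (intro mult_left_mono) auto
    moreover have "Re \<tau> * (1 / sqrt (Re \<tau>)) = sqrt (Re \<tau>)" using t by (simp add: real_div_sqrt)
    moreover have "\<rho> ^ M = exp (- (Re \<tau> * real M))" by (simp add: \<rho> exp_of_nat_mult [symmetric] mult.commute)
    ultimately have "\<rho> ^ M \<le> exp (- sqrt (Re \<tau>))" by simp
    also have "\<dots> \<le> 1 - sqrt (Re \<tau>) / 2"
      using st by (intro exp_minus_le_one_minus_half) linarith+
    finally show "\<rho> ^ M \<le> 1 - sqrt (Re \<tau>) / 2" .
  qed
  have big: "norm (w s) \<le> 2 * E / sqrt (Re \<tau>)" if "s \<ge> M" for s
  proof -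
    have "norm (w s) \<le> E / (1 - \<rho> ^ M)"
    proof (rule bounded_recurrence_le[where M = M, OF \<kappa>(1) _ bounded _ E0 that])
      show "\<rho> ^ M < 1" using \<kappa>(2) st by linarith
      fix s assume "s \<ge> M"
      hence "\<rho> ^ s \<le> \<rho> ^ M" using q by (intro power_decreasing) (auto simp: \<rho>_def)
      hence "\<rho> ^ s * norm (w (Suc s)) \<le> \<rho> ^ M * norm (w (Suc s))" by (intro mult_right_mono) auto
      thus "norm (w s) \<le> E + \<rho> ^ M * norm (w (Suc s))" using w_rec[of s] by linarith
    qed
    also have "\<dots> \<le> E / (sqrt (Re \<tau>) / 2)"
      using \<kappa> st E0 by (intro divide_left_mono mult_pos_pos) linarith+
    finally show ?thesis by (simp add: mult.commute)
  qed
  \<comment> \<open>Descent from \<open>M\<close>, each step adding at most \<open>E\<close>. Once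
    \<open>d\<close> exceeds \<open>M\<close>, truncated subtraction keeps the index at 0 and the
    bound merely grows.\<close>
  have "norm (w (M - d)) \<le> real d * E + 2 * E / sqrt (Re \<tau>)" for d
  proof (induction d)
    case 0 thus ?case using big[of M] by simp
  next
    case (Suc d)
    show ?case
    proof (cases "d < M")
      case True
      have "\<rho> ^ (M - Suc d) * norm (w (M - d)) \<le> 1 * norm (w (M - d))"
        using q by (intro mult_right_mono) (auto simp: \<rho>_def power_le_one)
      moreover have "Suc (M - Suc d) = M - d" using True by simp
      ultimately have "norm (w (M - Suc d)) \<le> E + norm (w (M - d))" using w_rec[of "M - Suc d"] by simp
      with Suc show ?thesis by (simp add: algebra_simps)
    next
      case False
      hence "M - Suc d = M - d" by simp
      thus ?thesis using Suc E0 by (simp add: algebra_simps)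
    qed
  qed note small = this
  have wr: "norm (w r) \<le> real M * E + 2 * E / sqrt (Re \<tau>)"
  proof (cases "r \<ge> M")
    case True
    have "0 \<le> real M * E" using E0 by simp
    with big[OF True] show ?thesis by linarith
  next
    case False
    hence "norm (w r) \<le> real (M - r) * E + 2 * E / sqrt (Re \<tau>)" using small[of "M - r"] by simp
    moreover have "real (M - r) * E \<le> real M * E" using E0 by (intro mult_right_mono) auto
    ultimately show ?thesis by linarith
  qed
  also have "\<dots> \<le> (2 / sqrt (Re \<tau>)) * E + 2 * E / sqrt (Re \<tau>)"
  proof -
    have "1 / 1 \<le> 1 / sqrt (Re \<tau>)" using st by (intro divide_left_mono) auto
    moreover have "2 / sqrt (Re \<tau>) = 1 / sqrt (Re \<tau>) + 1 / sqrt (Re \<tau>)" by simp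
    ultimately have "real M \<le> 2 / sqrt (Re \<tau>)" using M(2) by linarith
    thus ?thesis using E0 by (intro add_right_mono mult_right_mono) auto
  qed
  also have "\<dots> = 4 * E / sqrt (Re \<tau>)" by simp
  also have "\<dots> \<le> 4 * (168 * Re \<tau>) / sqrt (Re \<tau>)"
    using n1 st unfolding E_def by (intro divide_right_mono) auto
  also have "\<dots> = 672 * sqrt (Re \<tau>)" using st by (simp add: field_simps)
  finally have w: "norm (w r) \<le> 672 * sqrt (Re \<tau>)" .
  \<comment> \<open>\<open>v\<close> carries a divisor \<open>1 + q ^ r\<close>; undoing it costs a
    factor 2 and turns 672 into 1344.\<close>
  have "crank_sum r q / (1 - q) - 1 / (1 + q ^ r)\<^sup>2 = (1 + q ^ r) * w r"
    using nz[of r] q1 by (simp add: w_def v_def power2_eq_square power3_eq_cube right_diff_distrib)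
  also have "norm \<dots> \<le> 2 * (672 * sqrt (Re \<tau>))"
  proof -
    have "norm (1 + q ^ r) \<le> 1 + norm (q ^ r)" using norm_triangle_ineq[of 1 "q ^ r"] by simp
    also have "\<dots> \<le> 2" using q by (simp add: norm_power power_le_one)
    finally show ?thesis unfolding norm_mult using w by (intro mult_mono) auto
  qed
  finally show ?thesis by simp
qed

subsection \<open>Decay away from the positive real axis\<close>

lemma steady_gf_eq_exp: "steady_gf q = exp (2 * log_qprod q q + log_qprod (q\<^sup>2) (q\<^sup>2))"
proof -
  have "exp (2 * log_qprod q q + log_qprod (q\<^sup>2) (q\<^sup>2)) = exp (log_qprod q q) ^ 2 * exp (log_qprod (q\<^sup>2) (q\<^sup>2))"
    by (simp only: exp_add exp_double)
  thus ?thesis by (simp add: steady_gf_def qprod_def exp_minus field_simps)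
qed

lemma log_qprod_of_real_sums:
  assumes \<rho>: "0 \<le> \<rho>" "\<rho> < 1"
  shows "(\<lambda>m. \<rho> ^ Suc m / (real (Suc m) * (1 - \<rho> ^ Suc m))) sums Re (log_qprod (of_real \<rho>) (of_real \<rho>))"
    and "log_qprod (of_real \<rho>) (of_real \<rho>) \<in> \<real>"
proof -
  define b where "b m = \<rho> ^ Suc m / (real (Suc m) * (1 - \<rho> ^ Suc m))" for m
  have "of_real \<rho> ^ Suc m / (of_nat (Suc m) * (1 - of_real \<rho> ^ Suc m)) = complex_of_real (b m)" for m
    by (simp add: b_def)
  moreover have "summable (\<lambda>m. of_real \<rho> ^ Suc m / (of_nat (Suc m) * (1 - of_real \<rho> ^ Suc m)) :: complex)"
    using \<rho> by (intro summable_log_qprod) auto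
  ultimately have s: "(\<lambda>m. complex_of_real (b m)) sums log_qprod (of_real \<rho>) (of_real \<rho>)"
    unfolding log_qprod_def by (simp only: summable_sums)
  from sums_Re[OF s] show "(\<lambda>m. \<rho> ^ Suc m / (real (Suc m) * (1 - \<rho> ^ Suc m))) sums Re (log_qprod (of_real \<rho>) (of_real \<rho>))"
    by (simp add: b_def)
  from sums_Im[OF s] show "log_qprod (of_real \<rho>) (of_real \<rho>) \<in> \<real>"
    by (simp add: sums_iff complex_is_Real_iff)
qed

lemma Re_lambert_term_le:
  fixes q :: complex
  assumes q: "norm q < 1"
  shows "Re (q ^ Suc m / (of_nat (Suc m) * (1 - q ^ Suc m)))
           \<le> norm q ^ Suc m / (real (Suc m) * (1 - norm q ^ Suc m))"
proof -
  have "norm q ^ Suc m < 1" using norm_power_Suc_less[OF q, of m] q unfolding norm_power by linarith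
  have "1 - norm q ^ Suc m \<le> norm (1 - q ^ Suc m)"
    using norm_triangle_ineq2[of 1 "q ^ Suc m"] unfolding norm_power by simp
  have "Re (q ^ Suc m / (of_nat (Suc m) * (1 - q ^ Suc m))) \<le> norm (q ^ Suc m / (of_nat (Suc m) * (1 - q ^ Suc m)))"
    by (rule complex_Re_le_cmod)
  also have "\<dots> = norm q ^ Suc m / (real (Suc m) * norm (1 - q ^ Suc m))"
    by (simp only: norm_divide norm_mult norm_power norm_of_nat)
  also have "\<dots> \<le> norm q ^ Suc m / (real (Suc m) * (1 - norm q ^ Suc m))"
    using \<open>1 - norm q ^ Suc m \<le> norm (1 - q ^ Suc m)\<close> \<open>norm q ^ Suc m < 1\<close>
    by (intro divide_left_mono mult_left_mono mult_pos_pos) (auto simp del: of_nat_Suc power_Suc)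
  finally show ?thesis .
qed

text \<open>Only the term \<open>m = 1\<close> of the Lambert series is compared exactly; it already gives
  all the decay away from the positive real axis that is needed.\<close>

lemma Re_log_qprod_le:
  fixes q :: complex
  assumes q: "norm q < 1"
  shows "Re (log_qprod q q) \<le> Re (log_qprod (of_real (norm q)) (of_real (norm q)))"
    and "Re (log_qprod q q) \<le> Re (log_qprod (of_real (norm q)) (of_real (norm q)))
            - (1 / (1 - norm q) - Re (1 / (1 - q)))"
proof -
  define a where "a m = Re (q ^ Suc m / (of_nat (Suc m) * (1 - q ^ Suc m)))" for m
  define b where "b m = norm q ^ Suc m / (real (Suc m) * (1 - norm q ^ Suc m))" for m
  have a: "a sums Re (log_qprod q q)"
    unfolding a_def log_qprod_def by (intro sums_Re summable_sums summable_log_qprod q)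
  have b: "b sums Re (log_qprod (of_real (norm q)) (of_real (norm q)))"
    unfolding b_def using log_qprod_of_real_sums[of "norm q"] q by simp
  have ab: "a m \<le> b m" for m unfolding a_def b_def by (rule Re_lambert_term_le[OF q])
  show "Re (log_qprod q q) \<le> Re (log_qprod (of_real (norm q)) (of_real (norm q)))"
    using sums_le[OF ab a b] .
  have "(\<lambda>m. b m - a m) sums (Re (log_qprod (of_real (norm q)) (of_real (norm q))) - Re (log_qprod q q))"
    by (intro sums_diff a b)
  hence "(\<Sum>m\<in>{0}. b m - a m) \<le> Re (log_qprod (of_real (norm q)) (of_real (norm q))) - Re (log_qprod q q)"
    by (metis ab diff_ge_0_iff_ge finite.emptyI finite_insert sum_le_suminf sums_summable sums_unique)
  moreover have "a 0 = Re (1 / (1 - q)) - 1"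
  proof -
    have "1 - q \<noteq> 0" using q by auto
    hence "q / (1 - q) = 1 / (1 - q) - 1" by (simp add: field_simps)
    thus ?thesis by (simp add: a_def)
  qed
  moreover have "b 0 = 1 / (1 - norm q) - 1" using q by (simp add: b_def field_simps)
  ultimately show "Re (log_qprod q q) \<le> Re (log_qprod (of_real (norm q)) (of_real (norm q)))
            - (1 / (1 - norm q) - Re (1 / (1 - q)))" by simp
qed

text \<open>The gain is taken twice, from the square of \<open>(q; q)\<close>; for the product in
  q^2 the plain comparison of moduli is enough.\<close>

lemma norm_steady_gf_le:
  fixes q :: complex
  assumes q: "norm q < 1"
  shows "norm (steady_gf q) \<le> norm (steady_gf (of_real (norm q))) * exp (- 2 * (1 / (1 - norm q) - Re (1 / (1 - q))))"
proof -
  have q2: "norm (q\<^sup>2) < 1" using norm_mult_less_one[OF q q] by (simp add: power2_eq_square)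
  have "norm (steady_gf q) = exp (2 * Re (log_qprod q q) + Re (log_qprod (q\<^sup>2) (q\<^sup>2)))"
    by (simp add: steady_gf_eq_exp norm_exp_eq_Re)
  also have "\<dots> \<le> exp (2 * Re (log_qprod (of_real (norm q)) (of_real (norm q))) + Re (log_qprod (of_real (norm (q\<^sup>2))) (of_real (norm (q\<^sup>2))))
           + (- 2 * (1 / (1 - norm q) - Re (1 / (1 - q)))))"
    using Re_log_qprod_le(2)[OF q] Re_log_qprod_le(1)[OF q2] by simp
  also have "\<dots> = norm (steady_gf (of_real (norm q))) * exp (- 2 * (1 / (1 - norm q) - Re (1 / (1 - q))))"
    by (subst exp_add) (simp add: steady_gf_eq_exp norm_exp_eq_Re norm_power)
  finally show ?thesis .
qed

lemma pi_squared_le_10: "pi\<^sup>2 \<le> 10"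
proof -
  have "pi\<^sup>2 \<le> (3.16)\<^sup>2" using pi_approx by (intro power_mono) auto
  thus ?thesis by (simp add: power2_eq_square)
qed

text \<open>Concavity of the sine gives sin u at least 2 u / pi for u = |\<theta>| / 2; the rest is
  1 - cos \<theta> = 2 (sin u)^2 and pi^2 at most 10.\<close>

lemma one_minus_cos_ge:
  assumes "\<bar>\<theta>\<bar> \<le> pi"
  shows "1 - cos \<theta> \<ge> \<theta>\<^sup>2 / 5"
proof -
  define u where "u = \<bar>\<theta>\<bar> / 2"
  have u: "0 \<le> u" "u \<le> pi / 2" using assms by (auto simp: u_def)
  have "convex_on {0..pi} (\<lambda>x. - sin x)"
    by (rule f''_ge0_imp_convex[where f' = "\<lambda>x. - cos x" and f'' = sin])
       (auto intro!: derivative_eq_intros sin_ge_zero)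
  from convex_onD[OF this, of "2 * u / pi" 0 "pi / 2"]
  have "sin u \<ge> 2 * u / pi" using u by (simp add: field_simps)
  hence "(2 * u / pi)\<^sup>2 \<le> (sin u)\<^sup>2" using u by (intro power_mono) auto
  moreover have "(2 * u / pi)\<^sup>2 \<ge> \<theta>\<^sup>2 / 10"
  proof -
    have "\<theta>\<^sup>2 / 10 \<le> \<theta>\<^sup>2 / pi\<^sup>2" using pi_squared_le_10 by (intro divide_left_mono) auto
    thus ?thesis by (simp add: u_def power_divide)
  qed
  moreover have "1 - cos \<theta> = 2 * (sin u)\<^sup>2"
  proof -
    have "cos \<theta> = cos (2 * u)" by (simp add: u_def)
    thus ?thesis using cos_double_sin[of u] by simp
  qed
  ultimately show ?thesis by simp
qed

lemma cross_mult_le: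
  fixes a b c d :: real
  assumes "0 < b" "0 < d" "a * d \<le> c * b"
  shows "a / b \<le> c / d"
  using assms by (simp add: field_simps)

text \<open>With y = 1 - cos \<theta> and N = |1 - q|^2 the gap equals \<rho> (1 + \<rho>) y / ((1 -
  \<rho>) N). Here \<rho> (1 + \<rho>) is at least 1/3, 1 - \<rho> at most t and N at most t^2 + 2
  y; the resulting bound increases with y, so y may be replaced by \<theta>^2 / 5.\<close>

lemma minor_arc_gap:
  fixes t \<theta> :: real
  assumes t: "0 < t" "t \<le> 1" and \<theta>: "\<bar>\<theta>\<bar> \<le> pi"
  defines "q \<equiv> exp (- t) * exp (\<i> * complex_of_real \<theta>)"
  shows "1 / (1 - norm q) - Re (1 / (1 - q)) \<ge> \<theta>\<^sup>2 / (3 * t * (5 * t\<^sup>2 + 2 * \<theta>\<^sup>2))"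
proof -
  define \<rho> y where "\<rho> = exp (- t)" and "y = 1 - cos \<theta>"
  have \<rho>: "1 / 3 \<le> \<rho>" "\<rho> < 1" "1 - \<rho> \<le> t"
  proof -
    have "exp (- 1) \<le> \<rho>" using t by (simp add: \<rho>_def)
    moreover have "exp (1::real) \<le> 3" by (rule exp_le)
    hence "1 / 3 \<le> exp (- 1 :: real)" by (simp add: exp_minus field_simps)
    ultimately show "1 / 3 \<le> \<rho>" by linarith
    show "\<rho> < 1" using t by (simp add: \<rho>_def)
    show "1 - \<rho> \<le> t" using exp_ge_add_one_self[of "- t"] by (simp add: \<rho>_def)
  qed
  have nq: "norm q = \<rho>" by (simp add: q_def \<rho>_def norm_mult)
  have y: "y \<ge> \<theta>\<^sup>2 / 5" using one_minus_cos_ge[OF \<theta>] by (simp add: y_def)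
  hence y0: "y \<ge> 0" by (smt (verit) divide_nonneg_nonneg zero_le_power2)
  have Req: "Re q = \<rho> * (1 - y)" and Imq: "Im q = \<rho> * sin \<theta>"
    by (simp_all add: q_def \<rho>_def y_def Re_exp Im_exp exp_of_real [symmetric])
  have sc: "(\<rho> * sin \<theta>)\<^sup>2 = \<rho>\<^sup>2 * (1 - (1 - y)\<^sup>2)"
    by (simp add: y_def power_mult_distrib sin_squared_eq)
  define N where "N = (1 - \<rho>)\<^sup>2 + 2 * \<rho> * y"
  have N: "(1 - Re q)\<^sup>2 + (Im q)\<^sup>2 = N"
    unfolding Req Imq sc N_def by (simp add: power2_eq_square algebra_simps)
  have N0: "N > 0" using \<rho> y0 by (auto simp: N_def intro!: add_pos_nonneg)
  have "Re (1 / (1 - q)) = (1 - \<rho> * (1 - y)) / N"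
    using N by (simp add: Re_divide Req [symmetric])
  hence "1 / (1 - norm q) - Re (1 / (1 - q)) = (N - (1 - \<rho> * (1 - y)) * (1 - \<rho>)) / ((1 - \<rho>) * N)"
    using \<rho> N0 by (simp add: nq diff_frac_eq)
  also have "N - (1 - \<rho> * (1 - y)) * (1 - \<rho>) = \<rho> * (1 + \<rho>) * y"
    by (simp add: N_def power2_eq_square algebra_simps)
  finally have eq: "1 / (1 - norm q) - Re (1 / (1 - q)) = \<rho> * (1 + \<rho>) * y / ((1 - \<rho>) * N)" .
  have "\<theta>\<^sup>2 / (3 * t * (5 * t\<^sup>2 + 2 * \<theta>\<^sup>2)) = (1 / 3) * (\<theta>\<^sup>2 / 5) / (t * (t\<^sup>2 + 2 * (\<theta>\<^sup>2 / 5)))"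
  proof -
    have "t\<^sup>2 + 2 * (\<theta>\<^sup>2 / 5) = (5 * t\<^sup>2 + 2 * \<theta>\<^sup>2) / 5" by (simp add: field_simps)
    thus ?thesis by simp
  qed
  also have "\<dots> \<le> (1 / 3) * y / (t * (t\<^sup>2 + 2 * y))"
  proof -
    have p1: "t * (t\<^sup>2 + 2 * (\<theta>\<^sup>2 / 5)) > 0" and p2: "t * (t\<^sup>2 + 2 * y) > 0"
      using t y0 by (auto intro!: mult_pos_pos add_pos_nonneg)
    have "(\<theta>\<^sup>2 / 5) * t\<^sup>2 \<le> y * t\<^sup>2" using y by (intro mult_right_mono) auto
    hence "(\<theta>\<^sup>2 / 5) * (t\<^sup>2 + 2 * y) \<le> y * (t\<^sup>2 + 2 * (\<theta>\<^sup>2 / 5))" by (simp add: algebra_simps)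
    hence "(1 / 3 * t) * ((\<theta>\<^sup>2 / 5) * (t\<^sup>2 + 2 * y)) \<le> (1 / 3 * t) * (y * (t\<^sup>2 + 2 * (\<theta>\<^sup>2 / 5)))"
      using t by (intro mult_left_mono) auto
    hence "(1 / 3) * (\<theta>\<^sup>2 / 5) * (t * (t\<^sup>2 + 2 * y)) \<le> (1 / 3) * y * (t * (t\<^sup>2 + 2 * (\<theta>\<^sup>2 / 5)))"
      by (simp only: mult_ac)
    thus ?thesis using p1 p2 by (rule cross_mult_le[rotated -1])
  qed
  also have "\<dots> \<le> \<rho> * (1 + \<rho>) * y / ((1 - \<rho>) * N)"
  proof (intro frac_le mult_right_mono mult_mono)
    show "1 / 3 \<le> \<rho> * (1 + \<rho>)" using \<rho> mult_mono[of "1/3" \<rho> 1 "1 + \<rho>"] by simp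
    have "(1 - \<rho>)\<^sup>2 \<le> t\<^sup>2" using \<rho> by (intro power_mono) auto
    moreover have "2 * \<rho> * y \<le> 2 * y" using \<rho> y0 by (simp add: mult_left_le_one_le)
    ultimately show "N \<le> t\<^sup>2 + 2 * y" by (simp add: N_def)
  qed (use \<rho> N0 y0 t in \<open>auto intro!: mult_pos_pos mult_nonneg_nonneg\<close>)
  finally show ?thesis using eq by simp
qed

text \<open>The two regimes of the integral: at \<theta> = t^(3/2) s the first bound is s^2 / 21,
  hence Gaussian decay in s; the second gives decay exp (- const / t) on the rest of the
  circle.\<close>

lemma minor_arc_gap_cases:
  fixes t \<theta> :: real
  assumes t: "0 < t" "t \<le> 1" and \<theta>: "\<bar>\<theta>\<bar> \<le> pi"
  defines "q \<equiv> exp (- t) * exp (\<i> * complex_of_real \<theta>)"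
  shows "\<bar>\<theta>\<bar> \<le> t \<Longrightarrow> 1 / (1 - norm q) - Re (1 / (1 - q)) \<ge> \<theta>\<^sup>2 / (21 * t ^ 3)"
    and "\<bar>\<theta>\<bar> \<ge> t \<Longrightarrow> 1 / (1 - norm q) - Re (1 / (1 - q)) \<ge> 1 / (21 * t)"
proof -
  note gap = minor_arc_gap[OF t \<theta>, folded q_def]
  show "1 / (1 - norm q) - Re (1 / (1 - q)) \<ge> \<theta>\<^sup>2 / (21 * t ^ 3)" if "\<bar>\<theta>\<bar> \<le> t"
  proof -
    have "\<theta>\<^sup>2 \<le> t\<^sup>2" using power_mono[OF that, of 2] by simp
    hence "3 * t * (5 * t\<^sup>2 + 2 * \<theta>\<^sup>2) \<le> 3 * t * (7 * t\<^sup>2)" using t by (intro mult_left_mono) auto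
    hence "\<theta>\<^sup>2 / (3 * t * (7 * t\<^sup>2)) \<le> \<theta>\<^sup>2 / (3 * t * (5 * t\<^sup>2 + 2 * \<theta>\<^sup>2))"
      using t by (intro divide_left_mono mult_pos_pos add_pos_nonneg) auto
    moreover have "3 * t * (7 * t\<^sup>2) = 21 * t ^ 3" by (simp add: power2_eq_square power3_eq_cube)
    ultimately show ?thesis using gap by simp
  qed
  show "1 / (1 - norm q) - Re (1 / (1 - q)) \<ge> 1 / (21 * t)" if "\<bar>\<theta>\<bar> \<ge> t"
  proof -
    have t2: "t\<^sup>2 \<le> \<theta>\<^sup>2" using power_mono[OF that, of 2] t by simp
    have pos: "5 * t\<^sup>2 + 2 * \<theta>\<^sup>2 > 0" using t by (intro add_pos_nonneg) auto
    have "5 * t\<^sup>2 + 2 * \<theta>\<^sup>2 \<le> 7 * \<theta>\<^sup>2" using t2 by simp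
    hence "1 / 7 \<le> \<theta>\<^sup>2 / (5 * t\<^sup>2 + 2 * \<theta>\<^sup>2)" using pos by (simp add: field_simps)
    hence "1 / (3 * t) * (1 / 7) \<le> 1 / (3 * t) * (\<theta>\<^sup>2 / (5 * t\<^sup>2 + 2 * \<theta>\<^sup>2))"
      using t by (intro mult_left_mono) auto
    thus ?thesis using gap by simp
  qed
qed

subsection \<open>Lambert series in a sector\<close>

lemma half_sector_norm:
  fixes w :: complex
  assumes "0 < Re w" "\<bar>Im w\<bar> \<le> Re w"
  shows "(norm w)\<^sup>2 \<le> 2 * (Re w)\<^sup>2"
proof -
  have "(Im w)\<^sup>2 \<le> (Re w)\<^sup>2" using assms by (simp add: abs_le_square_iff [symmetric])
  thus ?thesis by (simp add: cmod_power2)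
qed

lemma sinh_ge_self:
  fixes x :: real
  assumes "x \<ge> 0"
  shows "exp (x / 2) - exp (- x / 2) \<ge> x"
proof -
  have "(exp (0 / 2) - exp (- 0 / 2)) - 0 \<le> (exp (x / 2) - exp (- x / 2)) - x"
  proof (rule DERIV_nonneg_imp_nondecreasing[OF assms])
    fix y :: real
    have "((\<lambda>x. (exp (x / 2) - exp (- x / 2)) - x) has_real_derivative (exp (y / 2) / 2 + exp (- y / 2) / 2 - 1)) (at y)"
      by (auto intro!: derivative_eq_intros)
    moreover have "exp (y / 2) / 2 + exp (- y / 2) / 2 - 1 \<ge> 0"
    proof -
      have "0 \<le> (exp (y / 4) - exp (- y / 4))\<^sup>2" by simp
      also have "\<dots> = exp (y / 2) + exp (- y / 2) - 2"
        by (simp add: power2_diff exp_double [symmetric] exp_add [symmetric])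
      finally show ?thesis by simp
    qed
    ultimately show "\<exists>z. ((\<lambda>x. (exp (x / 2) - exp (- x / 2)) - x) has_real_derivative z) (at y) \<and> 0 \<le> z" by blast
  qed
  thus ?thesis by simp
qed

text \<open>The quadratic Taylor polynomials at v and -v differ by exactly 2 v, and each remainder
  is at most |v|^3 because exp (1/2) is at most 2.\<close>

lemma exp_cubic_bound:
  fixes v :: complex
  assumes "norm v \<le> 1 / 2"
  shows "norm (exp v - exp (- v) - 2 * v) \<le> 2 * norm v ^ 3"
proof -
  have T: "norm (exp z - (1 + z + z\<^sup>2 / 2)) \<le> norm z ^ 3" if "norm z \<le> 1 / 2" for z :: complex
  proof -
    have "norm (exp z - (\<Sum>i\<le>2. z ^ i / fact i)) \<le> exp (norm z) * norm z ^ Suc 2 / fact 2"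
      by (rule Taylor_exp_field)
    also have "(\<Sum>i\<le>2. z ^ i / fact i) = 1 + z + z\<^sup>2 / 2"
      by (simp add: numeral_2_eq_2)
    also have "exp (norm z) * norm z ^ Suc 2 / fact 2 \<le> 2 * norm z ^ Suc 2 / fact 2"
      using order.trans[OF _ exp_half_le2, of "exp (norm z)"] that
      by (intro divide_right_mono mult_right_mono) auto
    finally show ?thesis by (simp add: power3_eq_cube eval_nat_numeral)
  qed
  have "exp v - exp (- v) - 2 * v = (exp v - (1 + v + v\<^sup>2 / 2)) - (exp (- v) - (1 + (- v) + (- v)\<^sup>2 / 2))"
    by simp
  also have "norm \<dots> \<le> norm v ^ 3 + norm (- v) ^ 3"
    using T[of v] T[of "- v"] assms norm_triangle_ineq4[of "exp v - (1 + v + v\<^sup>2 / 2)" "exp (- v) - (1 + (- v) + (- v)\<^sup>2 / 2)"]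
    by simp
  finally show ?thesis by simp
qed

text \<open>Term m of the logarithmic series at q = e^(-\<tau>) is 1 / (m (e^(m \<tau>) - 1)). The
  subtracted poles 1 / (m^2 \<tau>) add up to pi^2 / (6 \<tau>).\<close>

definition lambert_remainder :: "complex \<Rightarrow> complex" where
  "lambert_remainder w = 1 / (exp w - 1) - 1 / w"

text \<open>The second denominator is the square of 2 sinh (w / 2), an odd function w + O(w^3); in
  this form the double poles at 0 visibly cancel.\<close>

definition lambert_remainder_deriv :: "complex \<Rightarrow> complex" where
  "lambert_remainder_deriv w = 1 / w\<^sup>2 - 1 / (exp (w / 2) - exp (- w / 2))\<^sup>2"

lemma exp_neq_1_halfplane:
  fixes w :: complex
  assumes "0 < Re w"
  shows "exp w \<noteq> 1"
proof
  assume "exp w = 1"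
  hence "norm (exp w) = 1" by simp
  thus False using assms by (simp add: norm_exp_eq_Re)
qed

lemma norm_sinh_ge:
  fixes w :: complex
  assumes "0 < Re w"
  shows "norm (exp (w / 2) - exp (- w / 2)) \<ge> Re w"
proof -
  have "Re w \<le> exp (Re w / 2) - exp (- Re w / 2)" using assms by (intro sinh_ge_self) auto
  also have "\<dots> = norm (exp (w / 2)) - norm (exp (- w / 2))" by (simp add: norm_exp_eq_Re)
  also have "\<dots> \<le> norm (exp (w / 2) - exp (- w / 2))" by (rule norm_triangle_ineq2)
  finally show ?thesis .
qed

lemma DERIV_lambert_remainder:
  assumes w: "0 < Re w"
  shows "(lambert_remainder has_field_derivative lambert_remainder_deriv w) (at w within S)"
proof -
  have nz: "exp w - 1 \<noteq> 0" "w \<noteq> 0" using exp_neq_1_halfplane[OF w] w by auto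
  have "(exp (w / 2) - exp (- w / 2))\<^sup>2 * exp w = (exp w - 1)\<^sup>2"
  proof -
    have e: "exp w = exp (w / 2) * exp (w / 2)" by (simp add: exp_add [symmetric])
    have "(exp (w / 2) - exp (- w / 2)) * exp (w / 2) = exp w - 1"
      by (simp add: left_diff_distrib e exp_minus)
    thus ?thesis unfolding e by (metis (no_types) e mult.assoc mult.commute power2_eq_square)
  qed
  hence eq: "1 / (exp (w / 2) - exp (- w / 2))\<^sup>2 = exp w / (exp w - 1)\<^sup>2"
    using nz by (metis (no_types) divide_eq_eq exp_not_eq_zero mult_cancel_left mult_zero_left nonzero_mult_divide_mult_cancel_right2 mult.commute mult_1 power2_eq_square zero_neq_one)
  show ?thesis
    unfolding lambert_remainder_def [abs_def] lambert_remainder_deriv_def eq using nz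
    by (auto intro!: derivative_eq_intros simp: power2_eq_square)
qed

text \<open>For |w| at most 1, 2 sinh (w / 2) = w + B with |B| at most |w|^3 / 4 bounds the
  difference by 4. For larger w both denominators are at least (Re w)^2, and the sector forces (Re
  w)^2 to be at least 1/2. The common form of the bound is chosen so that it can be summed over
  multiples of w.\<close>

lemma norm_lambert_remainder_deriv_le:
  fixes w :: complex
  assumes w: "0 < Re w" "\<bar>Im w\<bar> \<le> Re w"
  shows "norm (lambert_remainder_deriv w) \<le> 64 / (1 + (Re w)\<^sup>2)"
proof (cases "norm w \<le> 1")
  case True
  define B where "B = exp (w / 2) - exp (- w / 2) - w"
  define n where "n = norm w"
  have n: "0 < n" "n \<le> 1" using True w by (auto simp: n_def)
  have "norm (exp (w / 2) - exp (- (w / 2)) - 2 * (w / 2)) \<le> 2 * norm (w / 2) ^ 3"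
    using True by (intro exp_cubic_bound) (simp add: norm_divide)
  hence B: "norm B \<le> n ^ 3 / 4" by (simp add: B_def n_def norm_divide power3_eq_cube)
  have n3: "n ^ 3 \<le> n" using n by (simp add: power3_eq_cube mult_le_one mult_left_le_one_le)
  have "norm w - norm B \<le> norm (w + B)" using norm_triangle_ineq2[of w "- B"] by simp
  hence wB: "norm (w + B) \<ge> n / 2"
    using B n3 n(1) unfolding n_def by linarith
  have "lambert_remainder_deriv w = ((w + B)\<^sup>2 - w\<^sup>2) / (w\<^sup>2 * (w + B)\<^sup>2)"
  proof -
    have "w + B \<noteq> 0" "w \<noteq> 0" using wB n by (auto simp: n_def)
    moreover have "exp (w / 2) - exp (- w / 2) = w + B" by (simp add: B_def)
    ultimately show ?thesis by (simp add: lambert_remainder_deriv_def diff_frac_eq)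
  qed
  also have "(w + B)\<^sup>2 - w\<^sup>2 = (w + (w + B)) * B" by (simp add: power2_eq_square algebra_simps)
  finally have "norm (lambert_remainder_deriv w) = norm (w + (w + B)) * norm B / (n\<^sup>2 * (norm (w + B))\<^sup>2)"
    by (simp add: norm_divide norm_mult norm_power n_def)
  also have "\<dots> \<le> (4 * n) * (n ^ 3 / 4) / (n\<^sup>2 * (n / 2)\<^sup>2)"
  proof (intro frac_le mult_mono power_mono mult_left_mono)
    have "norm (w + (w + B)) \<le> norm w + (norm w + norm B)"
      by (meson add_left_mono norm_triangle_ineq order_trans)
    thus "norm (w + (w + B)) \<le> 4 * n" using B n3 n(1) unfolding n_def by linarith
  qed (use B wB n in auto)
  also have "\<dots> = 4" using n by (simp add: power2_eq_square power3_eq_cube)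
  also have "4 \<le> 64 / (1 + (Re w)\<^sup>2)"
  proof -
    have "(Re w)\<^sup>2 \<le> 1"
      using True complex_Re_le_cmod[of w] w by (intro power_le_one) auto
    thus ?thesis by (simp add: field_simps add_pos_nonneg)
  qed
  finally show ?thesis .
next
  case False
  have r: "(norm w)\<^sup>2 \<le> 2 * (Re w)\<^sup>2" by (rule half_sector_norm[OF w])
  have "1\<^sup>2 \<le> (norm w)\<^sup>2" using False by (intro power_mono) auto
  hence R: "1 / 2 \<le> (Re w)\<^sup>2" using r by simp
  have "norm (lambert_remainder_deriv w) \<le> norm (1 / w\<^sup>2) + norm (1 / (exp (w / 2) - exp (- w / 2))\<^sup>2)"
    unfolding lambert_remainder_deriv_def by (rule norm_triangle_ineq4)
  also have "\<dots> = 1 / (norm w)\<^sup>2 + 1 / (norm (exp (w / 2) - exp (- w / 2)))\<^sup>2"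
    by (simp only: norm_divide norm_power norm_one)
  also have "\<dots> \<le> 1 / (Re w)\<^sup>2 + 1 / (Re w)\<^sup>2"
    using norm_sinh_ge[OF w(1)] complex_Re_le_cmod[of w] w
    by (intro add_mono divide_left_mono power_mono mult_pos_pos zero_less_power) auto
  also have "\<dots> \<le> 64 / (1 + (Re w)\<^sup>2)"
  proof -
    have "(2 :: real) * (1 + (Re w)\<^sup>2) \<le> 64 * (Re w)\<^sup>2" using R by simp
    moreover have "(Re w)\<^sup>2 > 0" using R by linarith
    ultimately show ?thesis by (simp add: field_simps add_pos_pos)
  qed
  finally show ?thesis .
qed

text \<open>Mean value inequality on the vertical segment between the two points: the real part is
  constant there, and the sector condition holds throughout.\<close>

lemma lambert_remainder_diff:
  assumes t: "0 < Re \<tau>" and sector: "\<bar>Im \<tau>\<bar> \<le> Re \<tau>" and N: "N > 0"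
  shows "norm (lambert_remainder (of_real N * \<tau>) - lambert_remainder (of_real N * of_real (Re \<tau>)))
           \<le> 64 / (1 + (N * Re \<tau>)\<^sup>2) * (N * \<bar>Im \<tau>\<bar>)"
proof -
  define S where "S = closed_segment (of_real N * of_real (Re \<tau>)) (of_real N * \<tau>)"
  have S: "Re z = N * Re \<tau>" "\<bar>Im z\<bar> \<le> N * Re \<tau>" if z: "z \<in> S" for z
  proof -
    obtain u where u: "0 \<le> u" "u \<le> 1" "z = (1 - u) *\<^sub>R (of_real N * of_real (Re \<tau>)) + u *\<^sub>R (of_real N * \<tau>)"
      using z by (auto simp: S_def closed_segment_def)
    show "Re z = N * Re \<tau>" by (simp add: u(3) algebra_simps)
    have "Im z = N * (u * Im \<tau>)" by (simp add: u(3))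
    moreover have "\<bar>u * Im \<tau>\<bar> \<le> Re \<tau>" using u sector mult_mono[of u 1 "\<bar>Im \<tau>\<bar>" "Re \<tau>"] by (simp add: abs_mult)
    ultimately show "\<bar>Im z\<bar> \<le> N * Re \<tau>" using N by (simp add: abs_mult)
  qed
  have "norm (lambert_remainder (of_real N * \<tau>) - lambert_remainder (of_real N * of_real (Re \<tau>)))
         \<le> 64 / (1 + (N * Re \<tau>)\<^sup>2) * norm (of_real N * \<tau> - of_real N * of_real (Re \<tau>))"
  proof (rule field_differentiable_bound[where S = S and f' = lambert_remainder_deriv])
    show "convex S" by (simp add: S_def)
    fix z assume z: "z \<in> S"
    have Rz: "0 < Re z" using S(1)[OF z] N t by simp
    thus "(lambert_remainder has_field_derivative lambert_remainder_deriv z) (at z within S)"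
      by (rule DERIV_lambert_remainder)
    show "norm (lambert_remainder_deriv z) \<le> 64 / (1 + (N * Re \<tau>)\<^sup>2)"
      using norm_lambert_remainder_deriv_le[OF Rz] S[OF z] by simp
  qed (auto simp: S_def)
  also have "norm (of_real N * \<tau> - of_real N * of_real (Re \<tau>)) = N * \<bar>Im \<tau>\<bar>"
  proof -
    have "of_real N * \<tau> - of_real N * of_real (Re \<tau>) = of_real N * (\<i> * of_real (Im \<tau>))"
      by (simp add: complex_eq_iff)
    thus ?thesis using N by (simp add: norm_mult)
  qed
  finally show ?thesis .
qed

text \<open>Comparison with the integral: by the mean value theorem each term is at most the
  increment of arctan divided by t, and the increments telescope.\<close>

lemma sum_inverse_quadratic_le:
  assumes t: "t > 0"
  shows "(\<Sum>m<n. 1 / (1 + (real (Suc m) * t)\<^sup>2)) \<le> pi / 2 / t"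
proof -
  have "(\<Sum>m<n. 1 / (1 + (real (Suc m) * t)\<^sup>2)) \<le> (\<Sum>m<n. (arctan (real (Suc m) * t) - arctan (real m * t)) / t)"
  proof (rule sum_mono)
    fix m
    have "\<exists>z>real m * t. z < real (Suc m) * t \<and> arctan (real (Suc m) * t) - arctan (real m * t) =
           (real (Suc m) * t - real m * t) * inverse (1 + z\<^sup>2)"
      using t by (intro MVT2) (auto intro!: derivative_eq_intros)
    then obtain z where z: "real m * t < z" "z < real (Suc m) * t"
      "arctan (real (Suc m) * t) - arctan (real m * t) = (real (Suc m) * t - real m * t) * inverse (1 + z\<^sup>2)" by blast
    have "0 \<le> real m * t" using t by simp
    hence "z\<^sup>2 \<le> (real (Suc m) * t)\<^sup>2" using z by (intro power_mono) auto
    hence "1 / (1 + (real (Suc m) * t)\<^sup>2) \<le> inverse (1 + z\<^sup>2)"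
      unfolding inverse_eq_divide by (intro frac_le) (auto simp: add_pos_nonneg)
    moreover have "(arctan (real (Suc m) * t) - arctan (real m * t)) / t = inverse (1 + z\<^sup>2)"
    proof -
      have "real (Suc m) * t - real m * t = t" by (simp add: algebra_simps)
      thus ?thesis unfolding z(3) using t by simp
    qed
    ultimately show "1 / (1 + (real (Suc m) * t)\<^sup>2) \<le> (arctan (real (Suc m) * t) - arctan (real m * t)) / t" by simp
  qed
  also have "\<dots> = (\<Sum>m<n. (arctan (real (Suc m) * t) - arctan (real m * t))) / t"
    by (simp add: sum_divide_distrib)
  also have "(\<Sum>m<n. (arctan (real (Suc m) * t) - arctan (real m * t))) = arctan (real n * t)"
    using sum_lessThan_telescope[of "\<lambda>m. arctan (real m * t)" n] by simp
  also have "arctan (real n * t) / t \<le> pi / 2 / t"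
    using t arctan_ubound[of "real n * t"] by (intro divide_right_mono) auto
  finally show ?thesis .
qed

lemma summable_inverse_quadratic:
  assumes t: "t > 0"
  shows "summable (\<lambda>m. 1 / (1 + (real (Suc m) * t)\<^sup>2))"
proof (rule bounded_imp_summable)
  fix n
  show "(\<Sum>m\<le>n. 1 / (1 + (real (Suc m) * t)\<^sup>2)) \<le> pi / 2 / t"
    using sum_inverse_quadratic_le[OF t, of "Suc n"] by (simp only: lessThan_Suc_atMost)
qed (auto intro!: divide_nonneg_nonneg)

text \<open>The weight 1 / m of the series cancels the length m |Im \<tau>| of the segment in
  \<open>lambert_remainder_diff\<close>, leaving 64 |Im \<tau>| times a sum that is at most pi / (2
  Re \<tau>). The bound is small only if |Im \<tau>| is much less than Re \<tau>, which is the case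
  on the peak.\<close>

theorem log_qprod_sector:
  fixes \<tau> :: complex
  assumes t: "0 < Re \<tau>" and sector: "\<bar>Im \<tau>\<bar> \<le> Re \<tau>"
  shows "norm ((log_qprod (exp (- \<tau>)) (exp (- \<tau>)) - complex_of_real (pi\<^sup>2 / 6) / \<tau>)
             - (log_qprod (exp (- of_real (Re \<tau>))) (exp (- of_real (Re \<tau>))) - complex_of_real (pi\<^sup>2 / 6) / of_real (Re \<tau>)))
         \<le> 32 * pi * \<bar>Im \<tau>\<bar> / Re \<tau>"
proof -
  have S: "(\<lambda>m. 1 / of_nat (Suc m) * lambert_remainder (of_real (real (Suc m)) * \<sigma>)) sums
            (log_qprod (exp (- \<sigma>)) (exp (- \<sigma>)) - complex_of_real (pi\<^sup>2 / 6) / \<sigma>)" if \<sigma>: "0 < Re \<sigma>" for \<sigma> :: complex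
  proof -
    have \<sigma>0: "\<sigma> \<noteq> 0" using \<sigma> by auto
    have "(\<lambda>m. complex_of_real (1 / (real m + 1)\<^sup>2) * (1 / \<sigma>)) sums (complex_of_real (pi\<^sup>2 / 6) * (1 / \<sigma>))"
      using inverse_squares_sums by (intro sums_mult2 sums_of_real) (simp add: add.commute)
    moreover have "(\<lambda>m. exp (- \<sigma>) ^ Suc m / (of_nat (Suc m) * (1 - exp (- \<sigma>) ^ Suc m))) sums
                     log_qprod (exp (- \<sigma>)) (exp (- \<sigma>))"
      unfolding log_qprod_def using \<sigma>
      by (intro summable_sums summable_log_qprod) (auto simp: norm_exp_eq_Re)
    ultimately have "(\<lambda>m. exp (- \<sigma>) ^ Suc m / (of_nat (Suc m) * (1 - exp (- \<sigma>) ^ Suc m)) -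
         complex_of_real (1 / (real m + 1)\<^sup>2) * (1 / \<sigma>)) sums
         (log_qprod (exp (- \<sigma>)) (exp (- \<sigma>)) - complex_of_real (pi\<^sup>2 / 6) * (1 / \<sigma>))"
      by (intro sums_diff)
    moreover have "exp (- \<sigma>) ^ Suc m / (of_nat (Suc m) * (1 - exp (- \<sigma>) ^ Suc m)) -
         complex_of_real (1 / (real m + 1)\<^sup>2) * (1 / \<sigma>) = 1 / of_nat (Suc m) * lambert_remainder (of_real (real (Suc m)) * \<sigma>)" for m
    proof -
      define N where "N = (of_nat (Suc m) :: complex)"
      define e where "e = exp (N * \<sigma>)"
      have N: "N \<noteq> 0" by (simp add: N_def del: of_nat_Suc)
      have "Re (N * \<sigma>) > 0" using \<sigma> by (simp add: N_def del: of_nat_Suc)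
      hence e: "e \<noteq> 1" unfolding e_def by (rule exp_neq_1_halfplane)
      have e0: "e \<noteq> 0" by (simp add: e_def)
      have "exp (- \<sigma>) ^ Suc m = exp (N * - \<sigma>)" by (simp only: N_def exp_of_nat_mult)
      hence "exp (- \<sigma>) ^ Suc m = 1 / e"
        by (simp only: e_def exp_minus mult_minus_right inverse_eq_divide)
      moreover have "(1 / e) / (N * (1 - 1 / e)) = 1 / N * (1 / (e - 1))"
      proof -
        have "1 - 1 / e = (e - 1) / e" using e0 by (simp add: diff_divide_distrib)
        thus ?thesis using e e0 N by simp
      qed
      moreover have "complex_of_real (1 / (real m + 1)\<^sup>2) = 1 / (N * N)"
        by (simp add: N_def power2_eq_square add.commute)
      moreover have "of_real (real (Suc m)) = N" by (simp add: N_def)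
      ultimately show ?thesis
        unfolding lambert_remainder_def N_def [symmetric] e_def [symmetric]
        using N \<sigma>0 by (simp add: e_def right_diff_distrib mult_ac)
    qed
    ultimately show ?thesis by simp
  qed
  define d where "d m = 1 / of_nat (Suc m) * lambert_remainder (of_real (real (Suc m)) * \<tau>) -
           1 / of_nat (Suc m) * lambert_remainder (of_real (real (Suc m)) * of_real (Re \<tau>))" for m
  have d: "d sums ((log_qprod (exp (- \<tau>)) (exp (- \<tau>)) - complex_of_real (pi\<^sup>2 / 6) / \<tau>)
             - (log_qprod (exp (- of_real (Re \<tau>))) (exp (- of_real (Re \<tau>))) - complex_of_real (pi\<^sup>2 / 6) / of_real (Re \<tau>)))"
    unfolding d_def using t by (intro sums_diff S[of \<tau>] S[of "of_real (Re \<tau>)"]) auto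
  have le: "norm (d m) \<le> 64 * \<bar>Im \<tau>\<bar> * (1 / (1 + (real (Suc m) * Re \<tau>)\<^sup>2))" for m
  proof -
    have "d m = 1 / of_nat (Suc m) * (lambert_remainder (of_real (real (Suc m)) * \<tau>) -
           lambert_remainder (of_real (real (Suc m)) * of_real (Re \<tau>)))"
      by (simp only: d_def right_diff_distrib)
    hence "norm (d m) = 1 / real (Suc m) * norm (lambert_remainder (of_real (real (Suc m)) * \<tau>) -
           lambert_remainder (of_real (real (Suc m)) * of_real (Re \<tau>)))"
      by (simp only: norm_mult norm_divide norm_one norm_of_nat)
    also have "\<dots> \<le> 1 / real (Suc m) * (64 / (1 + (real (Suc m) * Re \<tau>)\<^sup>2) * (real (Suc m) * \<bar>Im \<tau>\<bar>))"
      by (intro mult_left_mono lambert_remainder_diff t sector) auto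
    also have "\<dots> = 64 * \<bar>Im \<tau>\<bar> * (1 / (1 + (real (Suc m) * Re \<tau>)\<^sup>2))"
      by (simp del: of_nat_Suc)
    finally show ?thesis .
  qed
  have sum: "summable (\<lambda>m. 64 * \<bar>Im \<tau>\<bar> * (1 / (1 + (real (Suc m) * Re \<tau>)\<^sup>2)))"
    by (intro summable_mult summable_inverse_quadratic t)
  have "norm (suminf d) \<le> (\<Sum>m. 64 * \<bar>Im \<tau>\<bar> * (1 / (1 + (real (Suc m) * Re \<tau>)\<^sup>2)))"
    by (rule norm_suminf_le[OF le sum])
  also have "\<dots> = 64 * \<bar>Im \<tau>\<bar> * (\<Sum>m. 1 / (1 + (real (Suc m) * Re \<tau>)\<^sup>2))"
    by (intro suminf_mult summable_inverse_quadratic t)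
  also have "\<dots> \<le> 64 * \<bar>Im \<tau>\<bar> * (pi / 2 / Re \<tau>)"
    by (intro mult_left_mono suminf_le_const summable_inverse_quadratic sum_inverse_quadratic_le t) auto
  finally show ?thesis using d by (simp add: sums_iff)
qed

subsection \<open>The trapezoid rule, Stirling's formula and the dilogarithm\<close>

text \<open>The error of the trapezoid rule for a concave \<open>h\<close> is governed by the decrease of
  \<open>k = h'\<close>, which telescopes.\<close>

lemma trapezoid_interval:
  fixes H h k :: "real \<Rightarrow> real"
  assumes ab: "a < b"
    and H: "\<And>x. a \<le> x \<Longrightarrow> x \<le> b \<Longrightarrow> (H has_real_derivative h x) (at x)"
    and h: "\<And>x. a \<le> x \<Longrightarrow> x \<le> b \<Longrightarrow> (h has_real_derivative k x) (at x)"
    and k: "\<And>x y. a \<le> x \<Longrightarrow> x \<le> y \<Longrightarrow> y \<le> b \<Longrightarrow> k y \<le> k x"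
  shows "0 \<le> H b - H a - (b - a) * (h a + h b) / 2"
    and "H b - H a - (b - a) * (h a + h b) / 2 \<le> (b - a)\<^sup>2 * (k a - k b) / 2"
proof -
  define \<phi> where "\<phi> x = H x - H a - (x - a) * (h a + h x) / 2" for x
  define \<phi>' where "\<phi>' x = h x - (h a + h x + (x - a) * k x) / 2" for x
  have deriv: "(\<phi> has_real_derivative \<phi>' x) (at x)" if "a \<le> x" "x \<le> b" for x
    unfolding \<phi>_def \<phi>'_def using H[OF that] h[OF that]
    by (auto intro!: derivative_eq_intros simp: field_simps)
  have bounds: "0 \<le> \<phi>' x" "\<phi>' x \<le> (b - a) * (k a - k b) / 2" if x: "a < x" "x < b" for x
  proof -
    have "\<exists>z>a. z < x \<and> h x - h a = (x - a) * k z"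
      using x by (intro MVT2 h) auto
    then obtain z where z: "a < z" "z < x" "h x - h a = (x - a) * k z" by blast
    have eq: "\<phi>' x = (x - a) * (k z - k x) / 2" using z(3) by (simp add: \<phi>'_def field_simps)
    have kz: "0 \<le> k z - k x" "k z - k x \<le> k a - k b"
      using k[of z x] k[of a z] k[of x b] z x by auto
    show "0 \<le> \<phi>' x" unfolding eq using kz x by simp
    have "(x - a) * (k z - k x) \<le> (b - a) * (k a - k b)"
      using kz x by (intro mult_mono) auto
    thus "\<phi>' x \<le> (b - a) * (k a - k b) / 2" unfolding eq by simp
  qed
  have "\<exists>z>a. z < b \<and> \<phi> b - \<phi> a = (b - a) * \<phi>' z"
    using ab deriv by (intro MVT2) auto
  then obtain z where z: "a < z" "z < b" "\<phi> b - \<phi> a = (b - a) * \<phi>' z" by blast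
  have "\<phi> a = 0" by (simp add: \<phi>_def)
  hence b: "\<phi> b = (b - a) * \<phi>' z" using z by simp
  show "0 \<le> H b - H a - (b - a) * (h a + h b) / 2"
    using b bounds[OF z(1,2)] ab by (simp add: \<phi>_def)
  have "\<phi> b \<le> (b - a) * ((b - a) * (k a - k b) / 2)"
    unfolding b using bounds[OF z(1,2)] ab by (intro mult_left_mono) auto
  thus "H b - H a - (b - a) * (h a + h b) / 2 \<le> (b - a)\<^sup>2 * (k a - k b) / 2"
    by (simp add: \<phi>_def power2_eq_square mult.assoc)
qed

text \<open>The nodes are t, 2 t, ..., (n + 1) t. They start at t because the functions are
  controlled only for positive arguments; the interval from 0 to t is treated separately where it is
  needed.\<close>

lemma trapezoid_sum:
  fixes H h k :: "real \<Rightarrow> real"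
  assumes t: "t > 0"
    and H: "\<And>x. x > 0 \<Longrightarrow> (H has_real_derivative h x) (at x)"
    and h: "\<And>x. x > 0 \<Longrightarrow> (h has_real_derivative k x) (at x)"
    and k: "\<And>x y. 0 < x \<Longrightarrow> x \<le> y \<Longrightarrow> k y \<le> k x"
  defines "\<epsilon> \<equiv> (\<lambda>n. H (real (Suc n) * t) - H t + t * (h t + h (real (Suc n) * t)) / 2 - t * (\<Sum>i\<le>n. h (real (Suc i) * t)))"
  shows "incseq \<epsilon>" and "0 \<le> \<epsilon> n" and "\<epsilon> n \<le> t\<^sup>2 * (k t - k (real (Suc n) * t)) / 2"
proof -
  have step: "0 \<le> \<epsilon> (Suc n) - \<epsilon> n" "\<epsilon> (Suc n) - \<epsilon> n \<le> t\<^sup>2 * (k (real (Suc n) * t) - k (real (Suc (Suc n)) * t)) / 2" for n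
  proof -
    have 1: "0 < real (Suc n) * t" "real (Suc n) * t < real (Suc (Suc n)) * t" using t by auto
    have 2: "real (Suc (Suc n)) * t - real (Suc n) * t = t" by (simp add: algebra_simps)
    note T = trapezoid_interval[of "real (Suc n) * t" "real (Suc (Suc n)) * t" H h k, unfolded 2]
    have eq: "\<epsilon> (Suc n) - \<epsilon> n = H (real (Suc (Suc n)) * t) - H (real (Suc n) * t) - t * (h (real (Suc n) * t) + h (real (Suc (Suc n)) * t)) / 2"
      unfolding \<epsilon>_def sum.atMost_Suc by (simp add: field_simps del: of_nat_Suc)
    show "0 \<le> \<epsilon> (Suc n) - \<epsilon> n" unfolding eq using 1 by (intro T H h k) auto
    show "\<epsilon> (Suc n) - \<epsilon> n \<le> t\<^sup>2 * (k (real (Suc n) * t) - k (real (Suc (Suc n)) * t)) / 2"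
      unfolding eq using 1 by (intro T H h k) auto
  qed
  show "incseq \<epsilon>" using step(1) by (intro incseq_SucI) simp
  have e0: "\<epsilon> 0 = 0" by (simp add: \<epsilon>_def)
  show "0 \<le> \<epsilon> n" using \<open>incseq \<epsilon>\<close> e0 by (metis incseq_def le0)
  show "\<epsilon> n \<le> t\<^sup>2 * (k t - k (real (Suc n) * t)) / 2"
  proof (induction n)
    case 0 show ?case by (simp add: e0)
  next
    case (Suc n)
    have "t\<^sup>2 * (k t - k (real (Suc n) * t)) / 2 + t\<^sup>2 * (k (real (Suc n) * t) - k (real (Suc (Suc n)) * t)) / 2
        = t\<^sup>2 * (k t - k (real (Suc (Suc n)) * t)) / 2" by (simp add: field_simps del: of_nat_Suc)
    with Suc step(2)[of n] show ?case by linarith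
  qed
qed

section \<open>Stirling's formula\<close>

definition stirling_remainder :: "nat \<Rightarrow> real" where
  "stirling_remainder n = ln (fact n) - (real n + 1 / 2) * ln (real n) + real n"

lemma sum_ln_eq_ln_fact: "(\<Sum>i\<le>n. ln (real (Suc i))) = ln (fact (Suc n))"
proof (induction n)
  case (Suc n)
  have "ln (fact (Suc (Suc n)) :: real) = ln (real (Suc (Suc n))) + ln (fact (Suc n))"
    unfolding fact_Suc[of "Suc n"] of_nat_mult by (rule ln_mult_pos) auto
  thus ?case using Suc by simp
qed auto

text \<open>The trapezoid errors of \<open>ln\<close> with step 1 increase and are bounded, so a
  limit exists; Wallis' product identifies it.\<close>

theorem stirling_remainder_tendsto: "stirling_remainder \<longlonglongrightarrow> ln (2 * pi) / 2"
proof -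
  define \<epsilon> where "\<epsilon> = (\<lambda>n. (real (Suc n) * 1) * ln (real (Suc n) * 1) - (real (Suc n) * 1) - (1 * ln 1 - 1)
      + 1 * (ln 1 + ln (real (Suc n) * 1)) / 2 - 1 * (\<Sum>i\<le>n. ln (real (Suc i) * 1)))"
  note T = trapezoid_sum[of 1 "\<lambda>x. x * ln x - x" ln "\<lambda>x. 1 / x"]
  have d: "((\<lambda>x. x * ln x - x) has_real_derivative ln x) (at x)" "(ln has_real_derivative 1 / x) (at x)"
    if "x > 0" for x :: real using that by (auto intro!: derivative_eq_intros)
  have k: "1 / y \<le> 1 / x" if "0 < x" "x \<le> y" for x y :: real using that by (simp add: frac_le)
  have \<epsilon>: "incseq \<epsilon>" "\<epsilon> n \<le> 1 / 2" for n
  proof -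
    show "incseq \<epsilon>" unfolding \<epsilon>_def by (rule T) (simp_all only: d k zero_less_one)
    have "\<epsilon> n \<le> 1\<^sup>2 * (1 / 1 - 1 / (real (Suc n) * 1)) / 2"
      unfolding \<epsilon>_def by (rule T) (simp_all only: d k zero_less_one)
    also have "\<dots> \<le> 1 / 2" by simp
    finally show "\<epsilon> n \<le> 1 / 2" .
  qed
  have "\<forall>n. \<epsilon> n \<le> 1 / 2" using \<epsilon>(2) by blast
  from incseq_convergent[OF \<epsilon>(1) this] obtain L where "\<epsilon> \<longlonglongrightarrow> L" by blast
  moreover have "stirling_remainder (Suc n) = 1 - \<epsilon> n" for n
    using sum_ln_eq_ln_fact[of n] by (simp add: stirling_remainder_def \<epsilon>_def field_simps)
  ultimately have "(\<lambda>n. stirling_remainder (Suc n)) \<longlonglongrightarrow> 1 - L"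
    by (auto intro!: tendsto_intros)
  hence S: "stirling_remainder \<longlonglongrightarrow> 1 - L" by (simp add: filterlim_sequentially_Suc)
  define W where "W n = (\<Prod>k=1..n. (4 * real k ^ 2) / (4 * real k ^ 2 - 1))" for n
  have lnW: "ln (W n) = 4 * real n * ln 2 + 4 * ln (fact n) - 2 * ln (fact (2 * n)) - ln (2 * real n + 1) \<and> W n > 0" for n
  proof (induction n)
    case (Suc n)
    have pos: "(4 * real (Suc n) ^ 2) / (4 * real (Suc n) ^ 2 - 1) > 0"
      by (auto simp: power2_eq_square field_simps intro!: divide_pos_pos add_pos_nonneg)
    have W: "W (Suc n) = W n * ((4 * real (Suc n) ^ 2) / (4 * real (Suc n) ^ 2 - 1))"
      unfolding W_def by simp
    have fac: "(4 * real (Suc n) ^ 2) / (4 * real (Suc n) ^ 2 - 1) = (2 * real n + 2) * (2 * real n + 2) / ((2 * real n + 1) * (2 * real n + 3))"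
    proof -
      have "4 * real (Suc n) ^ 2 = (2 * real n + 2) * (2 * real n + 2)"
        "4 * real (Suc n) ^ 2 - 1 = (2 * real n + 1) * (2 * real n + 3)"
        by (simp_all add: power2_eq_square algebra_simps)
      thus ?thesis by simp
    qed
    have "ln (W (Suc n)) = ln (W n) + ln ((4 * real (Suc n) ^ 2) / (4 * real (Suc n) ^ 2 - 1))"
      unfolding W using Suc pos by (intro ln_mult_pos) auto
    also have "ln ((4 * real (Suc n) ^ 2) / (4 * real (Suc n) ^ 2 - 1)) = 2 * ln (2 * real n + 2) - ln (2 * real n + 1) - ln (2 * real n + 3)"
      unfolding fac by (simp add: ln_div ln_mult add_pos_nonneg)
    finally have 1: "ln (W (Suc n)) = ln (W n) + (2 * ln (2 * real n + 2) - ln (2 * real n + 1) - ln (2 * real n + 3))" .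
    have 2: "ln (fact (Suc n) :: real) = ln (real n + 1) + ln (fact n)"
      by (simp add: ln_mult add_pos_nonneg add.commute)
    have 3: "ln (fact (2 * Suc n) :: real) = ln (2 * real n + 2) + (ln (2 * real n + 1) + ln (fact (2 * n)))"
    proof -
      have "(fact (2 * Suc n) :: real) = (2 * real n + 2) * ((2 * real n + 1) * fact (2 * n))"
        by (simp add: algebra_simps)
      thus ?thesis by (simp add: ln_mult add_pos_nonneg del: fact_Suc)
    qed
    have 4: "ln (2 * real n + 2) = ln 2 + ln (real n + 1)"
    proof -
      have "2 * real n + 2 = 2 * (real n + 1)" by simp
      thus ?thesis by (simp only: ln_mult_pos[of 2 "real n + 1"])
    qed
    have "ln (W (Suc n)) = 4 * real (Suc n) * ln 2 + 4 * ln (fact (Suc n)) - 2 * ln (fact (2 * Suc n)) - ln (2 * real (Suc n) + 1)"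
      unfolding 1 2 3 using Suc 4 by (simp add: algebra_simps)
    moreover have "W (Suc n) > 0" unfolding W by (rule mult_pos_pos[OF Suc[THEN conjunct2] pos])
    ultimately show ?case by blast
  qed (simp add: W_def)
  have "(\<lambda>n. ln (W n)) \<longlonglongrightarrow> ln (pi / 2)"
    unfolding W_def by (intro tendsto_ln wallis) auto
  moreover have "(\<lambda>n. ln (W n)) \<longlonglongrightarrow> 2 * (1 - L) - 2 * ln 2"
  proof -
    \<comment> \<open>Factorials enter \<open>ln (W n)\<close> as 4 ln n! - 2 ln (2 n)!. In the same
      combination of remainders the terms n ln n and n cancel, and twice the unknown limit
      survives.\<close>
    have "(\<lambda>n. 4 * stirling_remainder n - 2 * stirling_remainder (2 * n) + (ln (real n) - ln 2 - ln (2 * real n + 1)))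
            \<longlonglongrightarrow> 4 * (1 - L) - 2 * (1 - L) + (- 2 * ln 2)"
    proof (intro tendsto_add tendsto_diff tendsto_mult tendsto_const S)
      show "(\<lambda>n. stirling_remainder (2 * n)) \<longlonglongrightarrow> 1 - L"
        by (rule filterlim_compose[OF S]) (auto intro!: filterlim_subseq strict_monoI)
      show "(\<lambda>n. ln (real n) - ln 2 - ln (2 * real n + 1)) \<longlonglongrightarrow> - 2 * ln 2" by real_asymp
    qed
    moreover have "\<forall>\<^sub>F n in sequentially. 4 * stirling_remainder n - 2 * stirling_remainder (2 * n) + (ln (real n) - ln 2 - ln (2 * real n + 1)) = ln (W n)"
      using eventually_gt_at_top[of 0]
    proof eventually_elim
      case (elim n)
      have "ln (real (2 * n)) = ln 2 + ln (real n)" using elim by (simp add: ln_mult)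
      thus ?case using lnW[of n] by (simp add: stirling_remainder_def algebra_simps)
    qed
    ultimately show ?thesis by (rule Lim_transform_eventually[where l = "4 * (1 - L) - 2 * (1 - L) + (- 2 * ln 2)", THEN tendsto_eq_rhs]) simp
  qed
  ultimately have "ln (pi / 2) = 2 * (1 - L) - 2 * ln 2" using LIMSEQ_unique by blast
  hence "1 - L = ln (2 * pi) / 2" by (simp add: ln_div ln_mult)
  with S show ?thesis by simp
qed

section \<open>The dilogarithm of exp (- u)\<close>

text \<open>The term \<open>n = 0\<close> is \<open>1 / 0 = 0\<close>.\<close>

definition dilog_exp :: "real \<Rightarrow> real" where
  "dilog_exp u = (\<Sum>n. 1 / (real n)\<^sup>2 * exp (- u) ^ n)"

lemma summable_inverse_squares: "summable (\<lambda>n. 1 / (real n)\<^sup>2)"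
  using inverse_squares_sums by (subst summable_Suc_iff [symmetric]) (simp add: sums_iff add.commute)

lemma suminf_inverse_squares: "(\<Sum>n. 1 / (real n)\<^sup>2) = pi\<^sup>2 / 6"
  using suminf_split_head[OF summable_inverse_squares] inverse_squares_sums by (simp add: sums_iff add.commute)

text \<open>The point u = 0 corresponds to the circle of convergence, out of reach for power series
  arguments; the series of inverse squares dominates uniformly up to it.\<close>

lemma continuous_on_dilog_exp: "continuous_on {0..} dilog_exp"
  unfolding dilog_exp_def [abs_def]
proof (rule uniform_limit_theorem)
  show "uniform_limit {0..} (\<lambda>N u. \<Sum>n<N. 1 / (real n)\<^sup>2 * exp (- u) ^ n) (\<lambda>u. \<Sum>n. 1 / (real n)\<^sup>2 * exp (- u) ^ n) sequentially"
  proof (rule Weierstrass_m_test[OF _ summable_inverse_squares])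
    fix n :: nat and u :: real assume "u \<in> {0..}"
    hence "1 / (real n)\<^sup>2 * exp (- u) ^ n \<le> 1 / (real n)\<^sup>2 * 1"
      by (intro mult_left_mono power_le_one) auto
    thus "norm (1 / (real n)\<^sup>2 * exp (- u) ^ n) \<le> 1 / (real n)\<^sup>2" by simp
  qed
qed (intro always_eventually allI continuous_on_sum continuous_on_mult continuous_on_const
      continuous_on_power continuous_on_exp continuous_on_minus continuous_on_id | simp)+

lemma dilog_exp_0: "dilog_exp 0 = pi\<^sup>2 / 6"
  by (simp add: dilog_exp_def suminf_inverse_squares)

lemma DERIV_dilog_exp:
  assumes u: "u > 0"
  shows "(dilog_exp has_real_derivative ln (1 - exp (- u))) (at u)"
proof -
  define x where "x = exp (- u)"
  have x: "0 < x" "x < 1" using u by (auto simp: x_def)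
  define c where "c n = 1 / (real n)\<^sup>2" for n
  have "DERIV (\<lambda>x. \<Sum>n. c n * x ^ n) x :> (\<Sum>n. diffs c n * x ^ n)"
    by (rule termdiffs_strong[where K = 1]) (use x summable_inverse_squares in \<open>auto simp: c_def\<close>)
  hence "((\<lambda>u. \<Sum>n. c n * exp (- u) ^ n) has_real_derivative ((\<Sum>n. diffs c n * x ^ n) * (- x))) (at u)"
    unfolding x_def by (rule DERIV_chain2) (auto intro!: derivative_eq_intros)
  moreover have "(\<Sum>n. diffs c n * x ^ n) * (- x) = ln (1 - x)"
  proof -
    have "(\<lambda>n. - (x ^ n) / real n) sums ln (1 - x)"
      using ln_series'[of "- x"] x by simp
    hence s: "(\<lambda>n. - (x ^ Suc n) / real (Suc n)) sums ln (1 - x)"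
      by (subst sums_Suc_iff) simp
    have "- (x ^ Suc n) / real (Suc n) = (- x) * (diffs c n * x ^ n)" for n
    proof -
      have "diffs c n = 1 / real (Suc n)" by (simp add: diffs_def c_def power2_eq_square del: of_nat_Suc)
      thus ?thesis by simp
    qed
    hence s: "(\<lambda>n. (- x) * (diffs c n * x ^ n)) sums ln (1 - x)" using s by presburger
    hence "(\<lambda>n. (- 1 / x) * ((- x) * (diffs c n * x ^ n))) sums ((- 1 / x) * ln (1 - x))"
      by (rule sums_mult)
    hence "(\<lambda>n. diffs c n * x ^ n) sums ((- 1 / x) * ln (1 - x))" using x by simp
    thus ?thesis using x by (simp add: sums_iff)
  qed
  ultimately show ?thesis unfolding dilog_exp_def [abs_def] c_def x_def by simp
qed

lemma dilog_exp_tendsto_0: "(dilog_exp \<longlongrightarrow> 0) at_top"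
proof (rule Lim_null_comparison)
  show "\<forall>\<^sub>F u in at_top. norm (dilog_exp u) \<le> exp (- u) * (pi\<^sup>2 / 6)"
    using eventually_ge_at_top[of 0]
  proof eventually_elim
    case (elim u)
    have le: "norm (1 / (real n)\<^sup>2 * exp (- u) ^ n) \<le> exp (- u) * (1 / (real n)\<^sup>2)" for n
    proof (cases n)
      case (Suc m)
      have "exp (- u) ^ Suc m \<le> exp (- u) * 1"
        unfolding power_Suc using elim by (intro mult_left_mono power_le_one) auto
      hence "1 / (real n)\<^sup>2 * exp (- u) ^ n \<le> 1 / (real n)\<^sup>2 * exp (- u)"
        unfolding Suc by (intro mult_left_mono) auto
      thus ?thesis by (simp add: mult.commute)
    qed auto
    have "norm (dilog_exp u) \<le> (\<Sum>n. exp (- u) * (1 / (real n)\<^sup>2))"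
      unfolding dilog_exp_def by (intro norm_suminf_le le summable_mult summable_inverse_squares)
    also have "\<dots> = exp (- u) * (pi\<^sup>2 / 6)"
      by (subst suminf_mult[OF summable_inverse_squares]) (simp add: suminf_inverse_squares)
    finally show ?case .
  qed
  show "((\<lambda>u. exp (- u) * (pi\<^sup>2 / 6)) \<longlongrightarrow> 0) at_top" by real_asymp
qed

section \<open>The logarithm of the product on the real axis\<close>

lemma inverse_minus_inverse_exp_antimono:
  fixes x y :: real
  assumes "0 < x" "x \<le> y"
  shows "1 / y - 1 / (exp y - 1) \<le> 1 / x - 1 / (exp x - 1)"
proof (rule DERIV_nonpos_imp_nonincreasing[OF assms(2)])
  fix u assume u: "x \<le> u" "u \<le> y"
  hence u0: "u > 0" "exp u \<noteq> 1" using assms by auto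
  \<comment> \<open>After division by \<open>exp u\<close> this is the square of u \<le> 2 sinh (u /
    2).\<close>
  have "u\<^sup>2 * exp u \<le> (exp u - 1)\<^sup>2"
  proof -
    have e: "exp u = exp (u / 2) * exp (u / 2)" by (simp add: exp_add [symmetric])
    have "u * exp (u / 2) \<le> (exp (u / 2) - exp (- u / 2)) * exp (u / 2)"
      using sinh_ge_self[of u] u0 by (intro mult_right_mono) auto
    also have "\<dots> = exp u - 1" by (simp add: left_diff_distrib e exp_minus)
    finally have "(u * exp (u / 2))\<^sup>2 \<le> (exp u - 1)\<^sup>2" using u0 by (intro power_mono) auto
    moreover have "(u * exp (u / 2))\<^sup>2 = u\<^sup>2 * exp u" unfolding e by (simp add: power2_eq_square)
    ultimately show ?thesis by simp
  qed
  hence "exp u / (exp u - 1)\<^sup>2 \<le> 1 / u\<^sup>2"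
    using u0 by (intro cross_mult_le) (auto simp: mult.commute)
  moreover have "((\<lambda>x. 1 / x - 1 / (exp x - 1)) has_real_derivative (- 1 / u\<^sup>2 + exp u / (exp u - 1)\<^sup>2)) (at u)"
    using u0 by (auto intro!: derivative_eq_intros simp: power2_eq_square)
  ultimately show "\<exists>z. ((\<lambda>x. 1 / x - 1 / (exp x - 1)) has_real_derivative z) (at u) \<and> z \<le> 0"
    by (intro exI[of _ "- 1 / u\<^sup>2 + exp u / (exp u - 1)\<^sup>2"]) simp
qed

lemma inverse_minus_inverse_exp_bounds:
  fixes u :: real
  assumes u: "u > 0"
  shows "0 \<le> 1 / u - 1 / (exp u - 1)" "1 / u - 1 / (exp u - 1) \<le> 1"
proof -
  have "1 / (exp u - 1) \<le> 1 / u"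
  proof (rule divide_left_mono)
    show "u \<le> exp u - 1" using exp_ge_add_one_self[of u] by linarith
  qed (use u in auto)
  thus "0 \<le> 1 / u - 1 / (exp u - 1)" by simp
  have e: "1 - exp (- u) > 0" using u by simp
  have e': "1 - exp (- u) \<le> u" using exp_ge_add_one_self[of "- u"] by linarith
  have "1 / u \<le> 1 / (1 - exp (- u))" using e e' u by (intro divide_left_mono) auto
  also have "\<dots> = 1 + 1 / (exp u - 1)"
  proof -
    have "exp u - 1 > 0" using u by simp
    moreover have "1 - exp (- u) = (exp u - 1) / exp u" by (simp add: exp_minus field_simps)
    ultimately show ?thesis by (simp add: field_simps)
  qed
  finally show "1 / u - 1 / (exp u - 1) \<le> 1" by simp
qed

text \<open>Links the Lambert series to logarithms of the factors: take \<open>ln\<close> of the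
  norms in \<open>qprod_unfold\<close>, whose last factor tends to 1.\<close>

lemma log_qprod_real_sum:
  assumes t: "t > 0"
  shows "(\<lambda>n. \<Sum>i\<le>n. - ln (1 - exp (- (real (Suc i) * t)))) \<longlonglongrightarrow>
           Re (log_qprod (exp (- complex_of_real t)) (exp (- complex_of_real t)))"
proof -
  define q where "q = exp (- complex_of_real t)"
  have q: "norm q < 1" using t by (simp add: q_def norm_exp_eq_Re)
  have "1 - exp (- (real (Suc i) * t)) > 0" for i using t by (simp del: of_nat_Suc)
  note pos = this
  have "norm (1 - q ^ i * q) = 1 - exp (- (real (Suc i) * t))" for i
  proof -
    have "q ^ i * q = q ^ Suc i" by simp
    also have "\<dots> = exp (of_nat (Suc i) * - complex_of_real t)" by (simp only: q_def exp_of_nat_mult)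
    also have "\<dots> = complex_of_real (exp (- (real (Suc i) * t)))"
      by (simp add: exp_of_real [symmetric] del: of_nat_Suc)
    finally have "1 - q ^ i * q = complex_of_real (1 - exp (- (real (Suc i) * t)))" by simp
    thus ?thesis using pos[of i] by (simp only: norm_of_real abs_of_pos)
  qed
  note nf = this
  have S: "(\<Sum>i\<le>n. - ln (1 - exp (- (real (Suc i) * t)))) = Re (log_qprod q q) + ln (norm (qprod q (q ^ Suc n * q)))" for n
  proof -
    have "norm (qprod q q) = (\<Prod>i<Suc n. 1 - exp (- (real (Suc i) * t))) * norm (qprod q (q ^ Suc n * q))"
      by (subst qprod_unfold[OF q q, of "Suc n"]) (simp only: norm_mult prod_norm [symmetric] nf)
    hence "ln (norm (qprod q q)) = ln (\<Prod>i<Suc n. 1 - exp (- (real (Suc i) * t))) + ln (norm (qprod q (q ^ Suc n * q)))"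
      using pos by (simp only:) (intro ln_mult_pos prod_pos, auto)
    also have "ln (\<Prod>i<Suc n. 1 - exp (- (real (Suc i) * t))) = (\<Sum>i<Suc n. ln (1 - exp (- (real (Suc i) * t))))"
      using pos by (intro ln_prod) auto
    also have "ln (norm (qprod q q)) = - Re (log_qprod q q)" by (simp add: qprod_def norm_exp_eq_Re)
    finally show ?thesis by (simp add: sum_negf lessThan_Suc_atMost del: of_nat_Suc)
  qed
  have "(\<lambda>n. qprod q (q ^ n * q)) \<longlonglongrightarrow> 1" by (rule qprod_power_tendsto_1[OF q q])
  hence "(\<lambda>n. qprod q (q ^ Suc n * q)) \<longlonglongrightarrow> 1" by (rule LIMSEQ_Suc)
  hence "(\<lambda>n. Re (log_qprod q q) + ln (norm (qprod q (q ^ Suc n * q)))) \<longlonglongrightarrow> Re (log_qprod q q) + ln (norm (1::complex))"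
    by (intro tendsto_intros) auto
  thus ?thesis unfolding S q_def [symmetric] by simp
qed

text \<open>Trapezoid rule with step t for h(u) = ln (u / (1 - exp (- u))), which, unlike - ln (1 -
  exp (- u)), has a finite limit at 0. The added logarithms sum to a factorial, and Stirling's
  formula turns them into the term ln (t / (2 pi)) / 2; the dilogarithm supplies the primitive, and
  pi^2 / 6 is its value at 0. As h is concave, the errors have a sign: the upper bound has no error
  term, and the lower one loses at most t, half of it on the first interval.\<close>

theorem log_qprod_real_bounds:
  assumes t: "t > 0"
  shows "Re (log_qprod (exp (- complex_of_real t)) (exp (- complex_of_real t))) \<le> pi\<^sup>2 / (6 * t) + ln (t / (2 * pi)) / 2"
    and "Re (log_qprod (exp (- complex_of_real t)) (exp (- complex_of_real t))) \<ge> pi\<^sup>2 / (6 * t) + ln (t / (2 * pi)) / 2 - t"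
proof -
  define H where "H u = - dilog_exp u + u * ln u - u" for u
  define h where "h u = ln u - ln (1 - exp (- u))" for u :: real
  define k where "k u = 1 / u - 1 / (exp u - 1)" for u :: real
  have H: "(H has_real_derivative h u) (at u)" if "u > 0" for u
    unfolding H_def [abs_def] h_def using that
    by (auto intro!: derivative_eq_intros DERIV_dilog_exp)
  have h: "(h has_real_derivative k u) (at u)" if "u > 0" for u
  proof -
    have "(h has_real_derivative (1 / u - exp (- u) / (1 - exp (- u)))) (at u)"
      unfolding h_def [abs_def] using that by (auto intro!: derivative_eq_intros)
    moreover have "exp (- u) / (1 - exp (- u)) = 1 / (exp u - 1)"
    proof -
      have "1 - exp (- u) = (exp u - 1) / exp u" by (simp add: exp_minus field_simps)
      thus ?thesis by (simp add: exp_minus field_simps)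
    qed
    ultimately show ?thesis by (simp add: k_def)
  qed
  have k: "k y \<le> k x" if "0 < x" "x \<le> y" for x y
    unfolding k_def by (rule inverse_minus_inverse_exp_antimono[OF that])
  have k01: "0 \<le> k u" "k u \<le> 1" if "u > 0" for u
    unfolding k_def using inverse_minus_inverse_exp_bounds[OF that] by auto
  \<comment> \<open>Trapezoid error of the interval from 0 to t, with the limits - pi^2 / 6 of
    \<open>H\<close> and 0 of \<open>h\<close> as values at 0. It is bounded by applying
    \<open>trapezoid_interval\<close> from \<delta> to t and letting \<delta> tend to 0.\<close>
  define \<beta> where "\<beta> = H t + pi\<^sup>2 / 6 - t * h t / 2"
  have \<beta>: "0 \<le> \<beta>" "\<beta> \<le> t\<^sup>2 / 2"
  proof -
    have "(dilog_exp \<longlongrightarrow> dilog_exp 0) (at 0 within {0..})"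
      using continuous_on_dilog_exp by (auto simp: continuous_on_def)
    hence "(dilog_exp \<longlongrightarrow> pi\<^sup>2 / 6) (at_right 0)"
      unfolding dilog_exp_0 by (rule tendsto_within_subset) auto
    moreover have "((\<lambda>u::real. u * ln u - u) \<longlongrightarrow> 0) (at_right 0)" by real_asymp
    ultimately have "((\<lambda>u. - dilog_exp u + (u * ln u - u)) \<longlongrightarrow> - (pi\<^sup>2 / 6) + 0) (at_right 0)"
      by (intro tendsto_intros)
    hence Hlim: "(H \<longlongrightarrow> - (pi\<^sup>2 / 6)) (at_right 0)" by (simp add: H_def [abs_def] algebra_simps)
    have hlim: "(h \<longlongrightarrow> 0) (at_right 0)" unfolding h_def [abs_def] by real_asymp
    have "((\<lambda>\<delta>. H t - H \<delta> - (t - \<delta>) * (h \<delta> + h t) / 2) \<longlongrightarrow> H t - - (pi\<^sup>2 / 6) - (t - 0) * (0 + h t) / 2) (at_right 0)"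
      by (intro tendsto_intros Hlim hlim) auto
    hence lim: "((\<lambda>\<delta>. H t - H \<delta> - (t - \<delta>) * (h \<delta> + h t) / 2) \<longlongrightarrow> \<beta>) (at_right 0)"
      by (simp add: \<beta>_def)
    have ev: "\<forall>\<^sub>F \<delta> in at_right 0. \<delta> \<in> {0<..<t}" by (rule eventually_at_right_real[OF t])
    show "0 \<le> \<beta>"
    proof (rule tendsto_lowerbound[OF lim])
      show "\<forall>\<^sub>F \<delta> in at_right 0. 0 \<le> H t - H \<delta> - (t - \<delta>) * (h \<delta> + h t) / 2"
        using ev by eventually_elim (intro trapezoid_interval[of _ t H h k] H h k, auto)
    qed simp
    show "\<beta> \<le> t\<^sup>2 / 2"
    proof (rule tendsto_upperbound[OF lim])
      show "\<forall>\<^sub>F \<delta> in at_right 0. H t - H \<delta> - (t - \<delta>) * (h \<delta> + h t) / 2 \<le> t\<^sup>2 / 2"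
        using ev
      proof eventually_elim
        case (elim \<delta>)
        have "H t - H \<delta> - (t - \<delta>) * (h \<delta> + h t) / 2 \<le> (t - \<delta>)\<^sup>2 * (k \<delta> - k t) / 2"
          using elim by (intro trapezoid_interval[of _ t H h k] H h k) auto
        also have "\<dots> \<le> t\<^sup>2 * 1 / 2"
          using k01[of \<delta>] k01[of t] k[of \<delta> t] elim
          by (intro divide_right_mono mult_mono power_mono) auto
        finally show ?case by simp
      qed
    qed simp
  qed
  define \<epsilon> where "\<epsilon> = (\<lambda>n. (H (real (Suc n) * t) - H t + t * (h t + h (real (Suc n) * t)) / 2 - t * (\<Sum>i\<le>n. h (real (Suc i) * t))))"
  have \<epsilon>: "0 \<le> \<epsilon> n" "\<epsilon> n \<le> t\<^sup>2 / 2" for n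
  proof -
    show "0 \<le> \<epsilon> n" unfolding \<epsilon>_def by (rule trapezoid_sum(2)[OF t H h k])
    have "\<epsilon> n \<le> t\<^sup>2 * (k t - k (real (Suc n) * t)) / 2" unfolding \<epsilon>_def by (rule trapezoid_sum(3)[OF t H h k])
    also have "\<dots> \<le> t\<^sup>2 * 1 / 2"
      using k01[of t] k01[of "real (Suc n) * t"] t
      by (intro divide_right_mono mult_left_mono) (auto simp del: of_nat_Suc)
    finally show "\<epsilon> n \<le> t\<^sup>2 / 2" by simp
  qed
  \<comment> \<open>What still depends on \<open>n\<close> once the growing terms of Stirling's
    formula have cancelled against \<open>H\<close>. The dilogarithm and the logarithm vanish in the
    limit.\<close>
  define A where "A n = - dilog_exp (real (Suc n) * t) / t - ln (1 - exp (- (real (Suc n) * t))) / 2 + ln t / 2 - stirling_remainder (Suc n)" for n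
  define S where "S n = (\<Sum>i\<le>n. - ln (1 - exp (- (real (Suc i) * t))))" for n
  have S: "S n = pi\<^sup>2 / (6 * t) + A n - (\<beta> + \<epsilon> n) / t" for n
  proof -
    define N X where "N = real (Suc n)" and "X = real (Suc n) * t"
    have N: "N > 0" by (simp add: N_def)
    have X: "X > 0" "X = N * t" using t by (simp_all add: X_def N_def del: of_nat_Suc)
    have "(\<Sum>i\<le>n. h (real (Suc i) * t)) = (\<Sum>i\<le>n. (ln (real (Suc i)) + ln t) + - ln (1 - exp (- (real (Suc i) * t))))"
      unfolding h_def using t by (intro sum.cong refl) (simp add: ln_mult_pos del: of_nat_Suc)
    also have "\<dots> = ln (fact (Suc n)) + N * ln t + S n"
      unfolding sum.distrib sum_ln_eq_ln_fact S_def by (simp add: N_def)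
    also have "ln (fact (Suc n)) = stirling_remainder (Suc n) + (N + 1 / 2) * ln N - N"
      by (simp add: stirling_remainder_def N_def)
    finally have sumh: "(\<Sum>i\<le>n. h (real (Suc i) * t)) = stirling_remainder (Suc n) + (N + 1 / 2) * ln N - N + N * ln t + S n" .
    have "\<epsilon> n + \<beta> = H X + pi\<^sup>2 / 6 + t * h X / 2 - t * (stirling_remainder (Suc n) + (N + 1 / 2) * ln N - N + N * ln t + S n)"
      unfolding \<epsilon>_def \<beta>_def sumh X_def by (simp add: field_simps)
    moreover have "H X = - dilog_exp X + t * (N * (ln N + ln t)) - t * N"
      unfolding H_def using X N t by (simp add: ln_mult_pos)
    moreover have "h X = ln N + ln t - ln (1 - exp (- X))"
      unfolding h_def using X N t by (simp add: ln_mult_pos)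
    ultimately have "\<epsilon> n + \<beta> = - dilog_exp X + pi\<^sup>2 / 6 + t * (ln t / 2 - ln (1 - exp (- X)) / 2 - stirling_remainder (Suc n) - S n)"
      by (simp add: field_simps)
    hence "(\<beta> + \<epsilon> n) / t = - dilog_exp X / t + pi\<^sup>2 / 6 / t + (ln t / 2 - ln (1 - exp (- X)) / 2 - stirling_remainder (Suc n) - S n)"
      using t by (simp add: add_divide_distrib diff_divide_distrib add.commute)
    thus ?thesis by (simp add: A_def X_def)
  qed
  have A: "A \<longlonglongrightarrow> ln (t / (2 * pi)) / 2"
  proof -
    have X: "filterlim (\<lambda>n. real (Suc n) * t) at_top sequentially"
      using t by real_asymp
    have "(\<lambda>n. ln (1 - exp (- (real (Suc n) * t)))) \<longlonglongrightarrow> 0"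
      using t by real_asymp
    moreover have "(\<lambda>n. dilog_exp (real (Suc n) * t)) \<longlonglongrightarrow> 0"
      by (rule filterlim_compose[OF dilog_exp_tendsto_0 X])
    moreover have "(\<lambda>n. stirling_remainder (Suc n)) \<longlonglongrightarrow> ln (2 * pi) / 2"
      by (rule LIMSEQ_Suc[OF stirling_remainder_tendsto])
    ultimately have "A \<longlonglongrightarrow> - 0 / t - 0 / 2 + ln t / 2 - ln (2 * pi) / 2"
      unfolding A_def [abs_def] using t by (intro tendsto_intros) auto
    also have "- 0 / t - 0 / 2 + ln t / 2 - ln (2 * pi) / 2 = ln (t / (2 * pi)) / 2"
      using t by (simp add: ln_div diff_divide_distrib)
    finally show ?thesis .
  qed
  have SL: "S \<longlonglongrightarrow> Re (log_qprod (exp (- complex_of_real t)) (exp (- complex_of_real t)))"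
    unfolding S_def [abs_def] by (rule log_qprod_real_sum[OF t])
  have bnd: "0 \<le> (\<beta> + \<epsilon> n) / t" "(\<beta> + \<epsilon> n) / t \<le> t" for n
  proof -
    show "0 \<le> (\<beta> + \<epsilon> n) / t" using \<beta> \<epsilon>[of n] t by simp
    have "\<beta> + \<epsilon> n \<le> t * t" using \<beta> \<epsilon>[of n] by (simp add: power2_eq_square)
    thus "(\<beta> + \<epsilon> n) / t \<le> t" using t by (simp add: divide_le_eq)
  qed
  show "Re (log_qprod (exp (- complex_of_real t)) (exp (- complex_of_real t))) \<le> pi\<^sup>2 / (6 * t) + ln (t / (2 * pi)) / 2"
  proof (rule LIMSEQ_le[OF SL])
    show "(\<lambda>n. pi\<^sup>2 / (6 * t) + A n) \<longlonglongrightarrow> pi\<^sup>2 / (6 * t) + ln (t / (2 * pi)) / 2"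
      by (intro tendsto_intros A)
    show "\<exists>N. \<forall>n\<ge>N. S n \<le> pi\<^sup>2 / (6 * t) + A n" using S bnd(1) by (intro exI[of _ 0]) simp
  qed
  show "Re (log_qprod (exp (- complex_of_real t)) (exp (- complex_of_real t))) \<ge> pi\<^sup>2 / (6 * t) + ln (t / (2 * pi)) / 2 - t"
  proof (rule LIMSEQ_le[OF _ SL])
    show "(\<lambda>n. pi\<^sup>2 / (6 * t) + A n - t) \<longlonglongrightarrow> pi\<^sup>2 / (6 * t) + ln (t / (2 * pi)) / 2 - t"
      by (intro tendsto_intros A)
    show "\<exists>N. \<forall>n\<ge>N. pi\<^sup>2 / (6 * t) + A n - t \<le> S n"
    proof (intro exI[of _ 0] allI impI)
      fix n show "pi\<^sup>2 / (6 * t) + A n - t \<le> S n" using S[of n] bnd(2)[of n] by linarith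
    qed
  qed
qed

subsection \<open>The saddle point method\<close>

definition real_steady_gf :: "real \<Rightarrow> real" where
  "real_steady_gf t = norm (steady_gf (exp (- of_real t)))"

lemma steady_gf_of_real:
  assumes t: "t > 0"
  shows "steady_gf (exp (- of_real t)) = of_real (real_steady_gf t)"
    and "real_steady_gf t = exp (2 * Re (log_qprod (exp (- complex_of_real t)) (exp (- complex_of_real t)))
           + Re (log_qprod (exp (- complex_of_real (2 * t))) (exp (- complex_of_real (2 * t)))))"
proof -
  define L where "L t = Re (log_qprod (exp (- complex_of_real t)) (exp (- complex_of_real t)))" for t
  have e: "exp (- complex_of_real t) = complex_of_real (exp (- t))" for t
    by (simp add: exp_of_real [symmetric])
  have L: "log_qprod (exp (- complex_of_real t)) (exp (- complex_of_real t)) = of_real (L t)" if "t > 0" for t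
    unfolding L_def e using log_qprod_of_real_sums(2)[of "exp (- t)"] that by (simp add: of_real_Re)
  have "(exp (- complex_of_real t))\<^sup>2 = exp (- complex_of_real (2 * t))"
    by (simp add: exp_double [symmetric])
  hence "steady_gf (exp (- of_real t)) = exp (2 * of_real (L t) + of_real (L (2 * t)))"
    using L[of t] L[of "2 * t"] t by (simp add: steady_gf_eq_exp)
  also have "\<dots> = of_real (exp (2 * L t + L (2 * t)))" by (simp add: exp_of_real [symmetric])
  finally have *: "steady_gf (exp (- of_real t)) = of_real (exp (2 * L t + L (2 * t)))" .
  thus "real_steady_gf t = exp (2 * Re (log_qprod (exp (- complex_of_real t)) (exp (- complex_of_real t)))
           + Re (log_qprod (exp (- complex_of_real (2 * t))) (exp (- complex_of_real (2 * t)))))"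
    by (simp add: real_steady_gf_def L_def)
  show "steady_gf (exp (- of_real t)) = of_real (real_steady_gf t)"
    unfolding real_steady_gf_def * by simp
qed

text \<open>The bounds at t enter twice and those at 2 t once, so the logarithm is off by at most 2
  t + 2 t. The factor sqrt (t / pi) comes from the argument 2 t.\<close>

lemma real_steady_gf_asymp:
  "((\<lambda>t. real_steady_gf t / (exp (5 * pi\<^sup>2 / 12 / t) * (t / (2 * pi)) * sqrt (t / pi))) \<longlongrightarrow> 1) (at_right 0)"
proof -
  define f where "f t = real_steady_gf t / (exp (5 * pi\<^sup>2 / 12 / t) * (t / (2 * pi)) * sqrt (t / pi))" for t
  have f: "exp (- 4 * t) \<le> f t" "f t \<le> 1" if t: "t > 0" for t
  proof -
    define M where "M = exp (5 * pi\<^sup>2 / 12 / t) * (t / (2 * pi)) * sqrt (t / pi)"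
    have M: "M > 0" using t by (simp add: M_def)
    have fM: "f t = real_steady_gf t / M" by (simp only: f_def M_def)
    have "ln M = 5 * pi\<^sup>2 / 12 / t + ln (t / (2 * pi)) + ln (t / pi) / 2"
    proof -
      have "ln M = ln (exp (5 * pi\<^sup>2 / 12 / t) * (t / (2 * pi))) + ln (sqrt (t / pi))"
        unfolding M_def using t by (intro ln_mult_pos) auto
      also have "ln (exp (5 * pi\<^sup>2 / 12 / t) * (t / (2 * pi))) = ln (exp (5 * pi\<^sup>2 / 12 / t)) + ln (t / (2 * pi))"
        using t by (intro ln_mult_pos) auto
      finally show ?thesis using t by (simp add: ln_sqrt)
    qed
    also have "\<dots> = 2 * (pi\<^sup>2 / (6 * t) + ln (t / (2 * pi)) / 2) + (pi\<^sup>2 / (6 * (2 * t)) + ln ((2 * t) / (2 * pi)) / 2)"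
      using t by (simp add: field_simps)
    finally have lnM: "ln M = 2 * (pi\<^sup>2 / (6 * t) + ln (t / (2 * pi)) / 2) + (pi\<^sup>2 / (6 * (2 * t)) + ln ((2 * t) / (2 * pi)) / 2)" .
    have P: "real_steady_gf t \<le> exp (ln M)" "real_steady_gf t \<ge> exp (ln M - 4 * t)"
      unfolding steady_gf_of_real(2)[OF t] exp_le_cancel_iff lnM
      using log_qprod_real_bounds[OF t] log_qprod_real_bounds[of "2 * t"] t by (simp_all del: of_real_mult)
    show "f t \<le> 1" using P(1) M by (simp add: fM)
    have "exp (ln M - 4 * t) = exp (- 4 * t) * M" using M by (simp add: exp_diff exp_minus field_simps)
    thus "exp (- 4 * t) \<le> f t" using P(2) M by (simp add: fM le_divide_eq)
  qed
  have ev: "\<forall>\<^sub>F t in at_right 0. (t :: real) > 0" by (rule eventually_at_right_less)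
  have "(f \<longlongrightarrow> 1) (at_right 0)"
  proof (rule tendsto_sandwich)
    show "\<forall>\<^sub>F t in at_right 0. exp (- 4 * t) \<le> f t" using ev by eventually_elim (rule f)
    show "\<forall>\<^sub>F t in at_right 0. f t \<le> 1" using ev by eventually_elim (rule f)
    show "((\<lambda>t :: real. exp (- 4 * t)) \<longlongrightarrow> 1) (at_right 0)" by real_asymp
  qed auto
  thus ?thesis unfolding f_def [abs_def] .
qed

text \<open>\<open>log_qprod_sector\<close> is used twice at \<tau> and once at 2 \<tau>. The ratio
  |Im| / Re is the same for both points, so the constant is 3 * 32 = 96; the poles add up to 2 (pi^2
  / 6) + pi^2 / 12.\<close>

lemma steady_gf_sector:
  fixes \<tau> :: complex
  assumes t: "0 < Re \<tau>" and sector: "\<bar>Im \<tau>\<bar> \<le> Re \<tau>"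
  shows "\<exists>\<delta>. norm \<delta> \<le> 96 * pi * \<bar>Im \<tau>\<bar> / Re \<tau> \<and>
           steady_gf (exp (- \<tau>)) = steady_gf (exp (- of_real (Re \<tau>))) *
             exp (complex_of_real (5 * pi\<^sup>2 / 12) / \<tau> - complex_of_real (5 * pi\<^sup>2 / 12) / of_real (Re \<tau>) + \<delta>)"
proof -
  define c where "c = complex_of_real (pi\<^sup>2 / 6)"
  define L where "L \<tau> = log_qprod (exp (- \<tau>)) (exp (- \<tau>))" for \<tau>
  define d where "d \<tau> = (L \<tau> - c / \<tau>) - (L (of_real (Re \<tau>)) - c / of_real (Re \<tau>))" for \<tau>
  have gf: "steady_gf (exp (- \<tau>)) = exp (2 * L \<tau> + L (2 * \<tau>))" for \<tau>
  proof -
    have "(exp (- \<tau>))\<^sup>2 = exp (- (2 * \<tau>))" by (simp add: exp_double [symmetric])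
    thus ?thesis by (simp add: steady_gf_eq_exp L_def)
  qed
  have d1: "norm (d \<tau>) \<le> 32 * pi * \<bar>Im \<tau>\<bar> / Re \<tau>"
    unfolding d_def L_def c_def by (rule log_qprod_sector[OF t sector])
  have d2: "norm (d (2 * \<tau>)) \<le> 32 * pi * \<bar>Im (2 * \<tau>)\<bar> / Re (2 * \<tau>)"
    unfolding d_def L_def c_def by (rule log_qprod_sector) (use t sector in auto)
  define \<delta> where "\<delta> = 2 * d \<tau> + d (2 * \<tau>)"
  have "norm \<delta> \<le> 2 * norm (d \<tau>) + norm (d (2 * \<tau>))"
    unfolding \<delta>_def using norm_triangle_ineq[of "2 * d \<tau>" "d (2 * \<tau>)"] by (simp add: norm_mult)
  also have "\<dots> \<le> 2 * (32 * pi * \<bar>Im \<tau>\<bar> / Re \<tau>) + 32 * pi * \<bar>Im \<tau>\<bar> / Re \<tau>"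
    using d1 d2 by (intro add_mono mult_left_mono) (auto simp: abs_mult)
  finally have 1: "norm \<delta> \<le> 96 * pi * \<bar>Im \<tau>\<bar> / Re \<tau>" by simp
  have \<tau>0: "\<tau> \<noteq> 0" using t by auto
  have "2 * L \<tau> + L (2 * \<tau>) = (2 * L (of_real (Re \<tau>)) + L (2 * of_real (Re \<tau>))) +
          (complex_of_real (5 * pi\<^sup>2 / 12) / \<tau> - complex_of_real (5 * pi\<^sup>2 / 12) / of_real (Re \<tau>) + \<delta>)"
  proof -
    have c: "2 * (c / z) + c / (2 * z) = complex_of_real (5 * pi\<^sup>2 / 12) / z" for z
    proof (cases "z = 0")
      case False
      thus ?thesis by (simp add: c_def field_simps)
    qed auto
    have "\<delta> = (2 * L \<tau> + L (2 * \<tau>)) - (2 * L (of_real (Re \<tau>)) + L (2 * of_real (Re \<tau>)))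
        - (2 * (c / \<tau>) + c / (2 * \<tau>)) + (2 * (c / of_real (Re \<tau>)) + c / (2 * of_real (Re \<tau>)))"
      unfolding \<delta>_def d_def by (simp add: algebra_simps)
    thus ?thesis unfolding c by (simp add: algebra_simps)
  qed
  hence 2: "steady_gf (exp (- \<tau>)) = steady_gf (exp (- of_real (Re \<tau>))) *
             exp (complex_of_real (5 * pi\<^sup>2 / 12) / \<tau> - complex_of_real (5 * pi\<^sup>2 / 12) / of_real (Re \<tau>) + \<delta>)"
    by (simp only: gf exp_add)
  from 1 2 show ?thesis by blast
qed

section \<open>Majorant and pointwise limit of the rescaled integrand\<close>

lemma gaussian_has_integral:
  fixes a :: real
  assumes a: "a > 0"
  shows "((\<lambda>x. exp (- (a * x\<^sup>2))) has_integral sqrt (pi / a)) UNIV"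
proof -
  define \<sigma> where "\<sigma> = sqrt (1 / (2 * a))"
  have \<sigma>: "\<sigma>\<^sup>2 = 1 / (2 * a)" "\<sigma> > 0" using a by (auto simp: \<sigma>_def)
  have nd: "sqrt (pi / a) * normal_density 0 \<sigma> x = exp (- (a * x\<^sup>2))" for x
  proof -
    have "2 * pi * \<sigma>\<^sup>2 = pi / a" using a by (simp add: \<sigma>)
    moreover have "x\<^sup>2 / (2 * \<sigma>\<^sup>2) = a * x\<^sup>2" using a by (simp add: \<sigma>)
    ultimately show ?thesis using a by (simp add: normal_density_def)
  qed
  have "(normal_density 0 \<sigma> has_integral 1) UNIV"
    using has_integral_integral_lborel[OF integrable_normal_density[OF \<sigma>(2), of 0]] integral_normal_density[OF \<sigma>(2), of 0] by simp
  from has_integral_mult_right[OF this, of "sqrt (pi / a)"] show ?thesis by (simp add: nd)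
qed

lemma inverse_quadratic_integrable_on: "(\<lambda>x::real. 1 / (1 + x\<^sup>2)) integrable_on UNIV"
proof -
  have "einterval (-\<infinity>) \<infinity> = UNIV" by (auto simp: einterval_def)
  hence "integrable lborel (\<lambda>x::real. inverse (1 + x\<^sup>2))"
    using integrable_inverse_1_plus_square(1) by (simp add: set_integrable_def)
  from integrable_on_lborel[OF this] show ?thesis by (simp add: inverse_eq_divide)
qed

text \<open>The integrand of the coefficient formula at \<open>\<theta> = t\<^sup>3\<^sup>/\<^sup>2 s\<close>, divided by its
  expected size at \<open>\<theta> = 0\<close>.\<close>

definition saddle_term :: "real \<Rightarrow> real \<Rightarrow> nat \<Rightarrow> real \<Rightarrow> complex" where
  "saddle_term t k r s =
     (let \<theta> = t * sqrt t * s; q = exp (- complex_of_real t) * exp (\<i> * complex_of_real \<theta>) in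
       steady_gf q * crank_sum r q * exp (- (\<i> * complex_of_real (k * \<theta>))) *
       of_real ((1 + exp (- t) ^ r)\<^sup>2 / (real_steady_gf t * t)))"

lemma real_steady_gf_pos [simp]: "real_steady_gf t > 0"
  by (simp add: real_steady_gf_def steady_gf_def)

text \<open>An integrable majorant uniform in t, k and r. For |\<theta>| at most t,
  \<open>crank_sum_approx\<close> bounds the crank sum by a multiple of t, and Gaussian decay
  provides 1 / (1 + s^2). On the rest of the circle only |\<open>crank_sum\<close>| \<le> 4 / t is
  used, against the exponentially small P.\<close>

lemma norm_saddle_term_le:
  assumes t: "0 < t" "t \<le> 1" and s: "\<bar>t * sqrt t * s\<bar> \<le> pi"
  shows "norm (saddle_term t k r s) \<le> (176 * (105 / 2) ^ 5 + 113232) / (1 + s\<^sup>2)"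
proof -
  define \<theta> where "\<theta> = t * sqrt t * s"
  define q where "q = exp (- t) * exp (\<i> * complex_of_real \<theta>)"
  define \<rho> where "\<rho> = exp (- t)"
  have \<theta>2: "\<theta>\<^sup>2 = t ^ 3 * s\<^sup>2"
    using t by (simp add: \<theta>_def power_mult_distrib power2_eq_square power3_eq_cube)
  have nq: "norm q = \<rho>" by (simp add: q_def \<rho>_def norm_mult)
  have \<rho>: "0 < \<rho>" "\<rho> < 1" using t by (auto simp: \<rho>_def)
  have q1: "norm q < 1" using nq \<rho> by simp
  have qe: "q = exp (- complex_of_real t) * exp (\<i> * complex_of_real \<theta>)"
    by (simp add: q_def exp_of_real [symmetric])
  define \<Delta> where "\<Delta> = 1 / (1 - norm q) - Re (1 / (1 - q))"
  have "norm (steady_gf q) \<le> real_steady_gf t * exp (- 2 * \<Delta>)"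
  proof -
    have "complex_of_real (norm q) = exp (- complex_of_real t)"
      unfolding nq \<rho>_def by (simp add: exp_of_real [symmetric])
    thus ?thesis using norm_steady_gf_le[OF q1] by (simp add: real_steady_gf_def \<Delta>_def)
  qed
  hence gf: "norm (steady_gf q) / real_steady_gf t \<le> exp (- 2 * \<Delta>)"
    by (simp add: divide_le_eq mult.commute)
  have "norm (saddle_term t k r s) = norm (steady_gf q) / real_steady_gf t * (norm (crank_sum r q) / t) * (1 + \<rho> ^ r)\<^sup>2"
  proof -
    have "norm (complex_of_real ((1 + \<rho> ^ r)\<^sup>2 / (real_steady_gf t * t))) = (1 + \<rho> ^ r)\<^sup>2 / (real_steady_gf t * t)"
      unfolding norm_of_real using t by (intro abs_of_nonneg divide_nonneg_nonneg) (auto simp: less_imp_le)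
    moreover have "norm (exp (- (\<i> * complex_of_real (k * \<theta>)))) = 1" by (simp add: norm_exp_eq_Re)
    ultimately show ?thesis
      unfolding saddle_term_def Let_def \<theta>_def [symmetric] qe [symmetric] \<rho>_def [symmetric] norm_mult
      by simp
  qed
  also have "\<dots> \<le> exp (- 2 * \<Delta>) * (norm (crank_sum r q) / t) * 4"
  proof -
    have "(1 + \<rho> ^ r)\<^sup>2 \<le> 2\<^sup>2" using \<rho> by (intro power_mono) (auto simp: power_le_one)
    thus ?thesis using gf t by (intro mult_mono mult_nonneg_nonneg) auto
  qed
  finally have main: "norm (saddle_term t k r s) \<le> exp (- 2 * \<Delta>) * (norm (crank_sum r q) / t) * 4" .
  have s1: "1 + s\<^sup>2 > 0" by (simp add: add_pos_nonneg)
  show ?thesis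
  proof (cases "\<bar>\<theta>\<bar> \<le> t")
    case True
    have "\<Delta> \<ge> \<theta>\<^sup>2 / (21 * t ^ 3)"
      unfolding \<Delta>_def q_def using minor_arc_gap_cases(1)[OF t _ True] s by (simp add: \<theta>_def)
    also have "\<theta>\<^sup>2 / (21 * t ^ 3) = s\<^sup>2 / 21" using t by (simp add: \<theta>2)
    finally have "exp (- 2 * \<Delta>) \<le> exp (- (2 / 21 * s\<^sup>2))" by simp
    also have "\<dots> = 1 / exp (2 / 21 * s\<^sup>2)" by (simp add: exp_minus inverse_eq_divide)
    also have "\<dots> \<le> 1 / (2 / 21 * (1 + s\<^sup>2))"
    proof (intro divide_left_mono)
      have "1 + 2 / 21 * s\<^sup>2 \<le> exp (2 / 21 * s\<^sup>2)" by (rule exp_ge_add_one_self)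
      moreover have "2 / 21 * (1 + s\<^sup>2) \<le> 1 + 2 / 21 * s\<^sup>2" by (simp add: algebra_simps)
      ultimately show "2 / 21 * (1 + s\<^sup>2) \<le> exp (2 / 21 * s\<^sup>2)" by (rule order.trans[rotated])
    qed (use s1 in auto)
    finally have e: "exp (- 2 * \<Delta>) \<le> 21 / 2 / (1 + s\<^sup>2)" by simp
    define \<tau> where "\<tau> = Complex t (- \<theta>)"
    have q\<tau>: "q = exp (- \<tau>)"
    proof -
      have "- \<tau> = - complex_of_real t + \<i> * complex_of_real \<theta>" by (simp add: \<tau>_def complex_eq_iff)
      thus ?thesis unfolding qe by (simp only: exp_add)
    qed
    have \<tau>: "0 < Re \<tau>" "Re \<tau> \<le> 1" "\<bar>Im \<tau>\<bar> \<le> Re \<tau>" using t True by (auto simp: \<tau>_def)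
    have "norm (1 - q) \<le> norm \<tau>" unfolding q\<tau> using \<tau> by (intro norm_one_minus_exp_le) auto
    also have "\<dots> \<le> 2 * t" using cmod_le[of \<tau>] True t by (simp add: \<tau>_def)
    finally have n1: "norm (1 - q) \<le> 2 * t" .
    have q0: "1 - q \<noteq> 0" using q1 by auto
    have ge: "norm (1 + q ^ r) \<ge> 1 / 2" unfolding q\<tau> by (rule norm_one_plus_exp_ge[OF \<tau>(1,3)])
    have "norm (1 / (1 + q ^ r)\<^sup>2) \<le> 1 / (1 / 2)\<^sup>2"
      unfolding norm_divide norm_power norm_one using ge by (intro frac_le power_mono) auto
    moreover have "norm (crank_sum r q / (1 - q) - 1 / (1 + q ^ r)\<^sup>2) \<le> 1344"
    proof -
      have "norm (crank_sum r q / (1 - q) - 1 / (1 + q ^ r)\<^sup>2) \<le> 1344 * sqrt (Re \<tau>)"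
        unfolding q\<tau> by (rule crank_sum_approx[OF \<tau>])
      moreover have "sqrt (Re \<tau>) \<le> 1" using \<tau> by simp
      ultimately show ?thesis by linarith
    qed
    ultimately have "norm (crank_sum r q / (1 - q)) \<le> 1348"
      using norm_triangle_ineq[of "crank_sum r q / (1 - q) - 1 / (1 + q ^ r)\<^sup>2" "1 / (1 + q ^ r)\<^sup>2"]
      by (simp add: power2_eq_square)
    hence "norm (crank_sum r q / (1 - q)) * norm (1 - q) \<le> 1348 * (2 * t)"
      using n1 by (intro mult_mono) auto
    hence "norm (crank_sum r q) \<le> 2696 * t" using q0 by (simp add: norm_divide)
    hence c: "norm (crank_sum r q) / t \<le> 2696" using t by (simp add: divide_le_eq)
    have "exp (- 2 * \<Delta>) * (norm (crank_sum r q) / t) * 4 \<le> 21 / 2 / (1 + s\<^sup>2) * 2696 * 4"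
      using e c t s1 by (intro mult_right_mono mult_mono) auto
    also have "21 / 2 / S * 2696 * 4 = 113232 / S" for S :: real by simp
    also have "113232 / (1 + s\<^sup>2) \<le> (176 * (105 / 2) ^ 5 + 113232) / (1 + s\<^sup>2)"
      using s1 by (intro divide_right_mono) auto
    finally show ?thesis using main by linarith
  next
    case False
    \<comment> \<open>The fifth power used below is dictated by the powers of t: two are lost to 4 /
      t^2, and the remaining t^3 yields 1 / (1 + s^2), because t^3 s^2 = \<theta>^2 is at most
      pi^2.\<close>
    define x where "x = 2 / (21 * t)"
    have x: "x > 0" using t by (simp add: x_def)
    have "\<Delta> \<ge> 1 / (21 * t)"
      unfolding \<Delta>_def q_def using minor_arc_gap_cases(2)[OF t, of \<theta>] False s by (simp add: \<theta>_def)
    hence "exp (- 2 * \<Delta>) \<le> exp (- x)" by (simp add: x_def)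
    also have "\<dots> \<le> (5 / x) ^ 5"
    proof -
      have "x / 5 \<le> exp (x / 5)" using exp_ge_add_one_self[of "x / 5"] by linarith
      hence "(x / 5) ^ 5 \<le> exp (x / 5) ^ 5" using x by (intro power_mono) auto
      also have "exp (x / 5) ^ 5 = exp x" by (simp add: exp_of_nat_mult [symmetric])
      finally have "1 / exp x \<le> 1 / (x / 5) ^ 5" using x by (intro divide_left_mono) auto
      thus ?thesis by (simp add: exp_minus inverse_eq_divide power_divide)
    qed
    also have "5 / x = 105 / 2 * t" using t by (simp add: x_def)
    finally have e: "exp (- 2 * \<Delta>) \<le> (105 / 2 * t) ^ 5" .
    have "1 - \<rho> \<ge> t / 2"
      using exp_minus_le_one_minus_half[of t] t by (simp add: \<rho>_def)
    hence "2 / (1 - \<rho>) \<le> 2 / (t / 2)" using t by (intro divide_left_mono mult_pos_pos) auto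
    hence "norm (crank_sum r q) \<le> 4 / t" using norm_crank_sum_le[OF q1, of r] unfolding nq by simp
    hence c: "norm (crank_sum r q) / t \<le> 4 / t / t" using t by (intro divide_right_mono) auto
    have "exp (- 2 * \<Delta>) * (norm (crank_sum r q) / t) * 4 \<le> (105 / 2 * t) ^ 5 * (4 / t / t) * 4"
      using e c t by (intro mult_right_mono mult_mono) auto
    also have "\<dots> = 16 * (105 / 2) ^ 5 * t ^ 3"
      using t by (simp add: power_mult_distrib eval_nat_numeral)
    also have "\<dots> \<le> 16 * (105 / 2) ^ 5 * (11 / (1 + s\<^sup>2))"
    proof (intro mult_left_mono)
      have "\<theta>\<^sup>2 \<le> pi\<^sup>2" using s unfolding \<theta>_def [symmetric] by (metis abs_le_square_iff abs_of_pos pi_gt_zero)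
      hence "t ^ 3 * s\<^sup>2 \<le> 10" unfolding \<theta>2 using pi_squared_le_10 by linarith
      moreover have "t ^ 3 \<le> 1" using t by (simp add: power_le_one)
      ultimately have "t ^ 3 * (1 + s\<^sup>2) \<le> 11" by (simp add: distrib_left)
      thus "t ^ 3 \<le> 11 / (1 + s\<^sup>2)" using s1 by (simp add: le_divide_eq)
    qed auto
    also have "16 * (105 / 2) ^ 5 * (11 / S) = 176 * (105 / 2) ^ 5 / S" for S :: real by simp
    also have "176 * (105 / 2) ^ 5 / (1 + s\<^sup>2) \<le> (176 * (105 / 2) ^ 5 + 113232) / (1 + s\<^sup>2)"
      using s1 by (intro divide_right_mono) auto
    finally show ?thesis using main by linarith
  qed
qed

lemma exp_difference_quotient_tendsto:
  fixes \<tau> :: "nat \<Rightarrow> complex"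
  assumes "\<tau> \<longlonglongrightarrow> 0" "\<And>j. \<tau> j \<noteq> 0"
  shows "(\<lambda>j. (1 - exp (- \<tau> j)) / \<tau> j) \<longlonglongrightarrow> 1"
proof -
  have "(exp has_field_derivative exp 0) (at (0 :: complex))" by (rule DERIV_exp)
  hence "(\<lambda>h. (exp h - 1) / h) \<midarrow>(0::complex)\<rightarrow> 1" by (simp add: DERIV_def)
  moreover have "filterlim (\<lambda>j. - \<tau> j) (at 0) sequentially"
    using assms tendsto_minus[OF assms(1)] by (auto simp: filterlim_at)
  ultimately have "(\<lambda>j. (exp (- \<tau> j) - 1) / (- \<tau> j)) \<longlonglongrightarrow> 1"
    by (rule filterlim_compose)
  moreover have "(exp (- \<tau> j) - 1) / (- \<tau> j) = (1 - exp (- \<tau> j)) / \<tau> j" for j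
    by (simp add: minus_divide_right [symmetric] minus_divide_left)
  ultimately show ?thesis by simp
qed

text \<open>With y = \<theta> / t = sqrt t * s, the choice k = a / t^2 cancels the linear term of a
  / \<tau> - a / t - i k \<theta>, and the exponent is exactly - a s^2 / (1 - i y). The sequence
  \<open>r\<close> is arbitrary; every estimate involving it depends on y and t alone.\<close>

lemma saddle_term_tendsto:
  fixes t :: "nat \<Rightarrow> real" and r :: "nat \<Rightarrow> nat"
  assumes t: "\<And>j. 0 < t j" "\<And>j. t j \<le> 1" "t \<longlonglongrightarrow> 0"
  defines "a \<equiv> 5 * pi\<^sup>2 / 12"
  shows "(\<lambda>j. saddle_term (t j) (a / (t j)\<^sup>2) (r j) s) \<longlonglongrightarrow> of_real (exp (- (a * s\<^sup>2)))"
proof -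
  define y where "y j = sqrt (t j) * s" for j
  define \<tau> where "\<tau> j = Complex (t j) (- (t j * y j))" for j
  define q where "q j = exp (- \<tau> j)" for j
  define R where "R j = exp (- t j) ^ r j" for j
  have y0: "y \<longlonglongrightarrow> 0" unfolding y_def using tendsto_mult[OF tendsto_real_sqrt[OF t(3)] tendsto_const[of s]] by simp
  have y2: "(y j)\<^sup>2 = t j * s\<^sup>2" for j using t(1)[of j] by (simp add: y_def power_mult_distrib)
  have \<tau>t: "\<tau> j = of_real (t j) * (1 - \<i> * of_real (y j))" for j
    by (simp add: \<tau>_def complex_eq_iff)
  have t0: "t j \<noteq> 0" for j using t(1)[of j] by simp
  have iy: "1 - \<i> * of_real (y j) \<noteq> 0" for j by (auto simp: complex_eq_iff)
  have \<tau>nz: "\<tau> j \<noteq> 0" for j using t0 iy by (simp add: \<tau>t)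
  have \<tau>0: "\<tau> \<longlonglongrightarrow> 0"
  proof -
    have "(\<lambda>j. of_real (t j) * (1 - \<i> * of_real (y j))) \<longlonglongrightarrow> of_real 0 * (1 - \<i> * of_real 0)"
      by (intro tendsto_intros t(3) y0)
    thus ?thesis by (simp add: \<tau>t [abs_def])
  qed
  have Re: "Re (\<tau> j) = t j" and Im: "\<bar>Im (\<tau> j)\<bar> = t j * \<bar>y j\<bar>" for j
    using t(1)[of j] by (simp_all add: \<tau>_def abs_mult)
  have sector: "\<bar>Im (\<tau> j)\<bar> \<le> Re (\<tau> j)" if "\<bar>y j\<bar> \<le> 1" for j
    unfolding Re Im using mult_left_mono[OF that, of "t j"] t(1)[of j] by simp
  have ev: "\<forall>\<^sub>F j in sequentially. \<bar>y j\<bar> \<le> 1"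
  proof -
    have "\<forall>\<^sub>F j in sequentially. dist (y j) 0 < 1" using y0 by (rule tendstoD) simp
    thus ?thesis by eventually_elim simp
  qed
  have ge: "norm (1 + q j ^ r j) \<ge> 1 / 2" if "\<bar>y j\<bar> \<le> 1" for j
    unfolding q_def by (rule norm_one_plus_exp_ge) (use sector[OF that] t(1)[of j] Re in auto)

  \<comment> \<open>Stated as an implication so that one choice function covers all
    \<open>j\<close>; outside the sector, which happens only finitely often, its value is
    arbitrary.\<close>
  have "\<exists>\<delta>. \<bar>y j\<bar> \<le> 1 \<longrightarrow> norm \<delta> \<le> 96 * pi * \<bar>y j\<bar> \<and>
      steady_gf (q j) = of_real (real_steady_gf (t j)) * exp (of_real a / \<tau> j - of_real a / of_real (t j) + \<delta>)" for j
  proof (cases "\<bar>y j\<bar> \<le> 1")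
    case True
    have "0 < Re (\<tau> j)" using Re t(1) by simp
    from steady_gf_sector[OF this sector[OF True]] obtain \<delta> where
      "norm \<delta> \<le> 96 * pi * (t j * \<bar>y j\<bar>) / t j"
      "steady_gf (q j) = of_real (real_steady_gf (t j)) * exp (of_real a / \<tau> j - of_real a / of_real (t j) + \<delta>)"
      unfolding Re Im q_def a_def steady_gf_of_real(1)[OF t(1)] by blast
    moreover have "96 * pi * (t j * \<bar>y j\<bar>) / t j = 96 * pi * \<bar>y j\<bar>" using t0[of j] by simp
    ultimately show ?thesis by metis
  qed auto
  then obtain \<delta> where \<delta>: "\<And>j. \<bar>y j\<bar> \<le> 1 \<Longrightarrow> norm (\<delta> j) \<le> 96 * pi * \<bar>y j\<bar>"
    "\<And>j. \<bar>y j\<bar> \<le> 1 \<Longrightarrow> steady_gf (q j) = of_real (real_steady_gf (t j)) * exp (of_real a / \<tau> j - of_real a / of_real (t j) + \<delta> j)"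
    by metis
  have \<delta>0: "\<delta> \<longlonglongrightarrow> 0"
  proof (rule Lim_null_comparison)
    show "\<forall>\<^sub>F j in sequentially. norm (\<delta> j) \<le> 96 * pi * \<bar>y j\<bar>" using ev by eventually_elim (rule \<delta>)
    show "(\<lambda>j. 96 * pi * \<bar>y j\<bar>) \<longlonglongrightarrow> 0" using tendsto_mult[OF tendsto_const[of "96 * pi"] tendsto_rabs[OF y0]] by simp
  qed
  have A: "(\<lambda>j. exp (- of_real (a * s\<^sup>2) / (1 - \<i> * of_real (y j)) + \<delta> j)) \<longlonglongrightarrow> exp (- of_real (a * s\<^sup>2) / (1 - \<i> * of_real 0) + 0)"
    by (intro tendsto_intros y0 \<delta>0) auto

  have B1: "(\<lambda>j. (1 - q j) / of_real (t j)) \<longlonglongrightarrow> 1"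
  proof -
    have "(\<lambda>j. (1 - q j) / \<tau> j * (1 - \<i> * of_real (y j))) \<longlonglongrightarrow> 1 * (1 - \<i> * of_real 0)"
      unfolding q_def by (intro tendsto_intros exp_difference_quotient_tendsto \<tau>0 \<tau>nz y0)
    moreover have "(1 - q j) / \<tau> j * (1 - \<i> * of_real (y j)) = (1 - q j) / of_real (t j)" for j
      unfolding \<tau>t using iy[of j] t0[of j] by simp
    ultimately show ?thesis by simp
  qed
  have R: "0 < R j" "R j \<le> 1" for j using t(1)[of j] by (auto simp: R_def power_le_one)
  \<comment> \<open>Uniform in r: the power of \<open>q j\<close> is \<open>R j\<close> rotated by
    the angle r t y, so they differ by at most R r t |y|, and R r t = x exp (- x) \<le> 1 for x = r
    t.\<close>
  have ratio: "(\<lambda>j. (1 + of_real (R j)) / (1 + q j ^ r j)) \<longlonglongrightarrow> 1"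
  proof -
    have "(\<lambda>j. (1 + of_real (R j)) / (1 + q j ^ r j) - 1) \<longlonglongrightarrow> 0"
    proof (rule Lim_null_comparison)
      show "(\<lambda>j. 2 * \<bar>y j\<bar>) \<longlonglongrightarrow> 0" using tendsto_mult[OF tendsto_const[of 2] tendsto_rabs[OF y0]] by simp
      show "\<forall>\<^sub>F j in sequentially. norm ((1 + of_real (R j)) / (1 + q j ^ r j) - 1) \<le> 2 * \<bar>y j\<bar>"
        using ev
      proof eventually_elim
        case (elim j)
        have nz: "1 + q j ^ r j \<noteq> 0" using ge[OF elim] by auto
        define \<sigma> where "\<sigma> = - (\<i> * of_real (real (r j) * (t j * y j)))"
        have "q j ^ r j = exp (of_nat (r j) * - \<tau> j)" by (simp only: q_def exp_of_nat_mult)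
        also have "of_nat (r j) * - \<tau> j = of_real (- (real (r j) * t j)) + - \<sigma>"
          by (simp add: \<tau>_def \<sigma>_def complex_eq_iff)
        also have "exp \<dots> = of_real (R j) * exp (- \<sigma>)"
        proof -
          have "R j = exp (- (real (r j) * t j))" by (simp add: R_def exp_of_nat_mult [symmetric])
          thus ?thesis by (simp only: exp_add exp_of_real)
        qed
        finally have "of_real (R j) - q j ^ r j = of_real (R j) * (1 - exp (- \<sigma>))" by (simp add: algebra_simps)
        hence "norm (of_real (R j) - q j ^ r j) = R j * norm (1 - exp (- \<sigma>))" using R(1)[of j] by (simp add: norm_mult)
        also have "\<dots> \<le> R j * norm \<sigma>"
          using R(1)[of j] by (intro mult_left_mono norm_one_minus_exp_le) (auto simp: \<sigma>_def)
        also have "norm \<sigma> = (real (r j) * t j) * \<bar>y j\<bar>" using t(1)[of j] by (simp add: \<sigma>_def norm_mult abs_mult)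
        also have "R j * ((real (r j) * t j) * \<bar>y j\<bar>) = (R j * (real (r j) * t j)) * \<bar>y j\<bar>" by simp
        also have "\<dots> \<le> 1 * \<bar>y j\<bar>"
        proof (rule mult_right_mono)
          have "real (r j) * t j \<le> exp (real (r j) * t j)" using exp_ge_add_one_self[of "real (r j) * t j"] by linarith
          hence "R j * (real (r j) * t j) \<le> R j * exp (real (r j) * t j)" using R(1)[of j] by (intro mult_left_mono) auto
          also have "R j * exp (real (r j) * t j) = 1"
          proof -
            have "R j = exp (- (real (r j) * t j))" by (simp add: R_def exp_of_nat_mult [symmetric])
            thus ?thesis by (simp add: exp_minus)
          qed
          finally show "R j * (real (r j) * t j) \<le> 1" .
        qed auto
        finally have le: "norm (of_real (R j) - q j ^ r j) \<le> \<bar>y j\<bar>" by simp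
        have "(1 + of_real (R j)) / (1 + q j ^ r j) - 1 = (of_real (R j) - q j ^ r j) / (1 + q j ^ r j)"
          using nz by (simp add: field_simps)
        hence "norm ((1 + of_real (R j)) / (1 + q j ^ r j) - 1) = norm (of_real (R j) - q j ^ r j) / norm (1 + q j ^ r j)"
          by (simp add: norm_divide)
        also have "\<dots> \<le> \<bar>y j\<bar> / (1 / 2)" using le ge[OF elim] by (intro frac_le) auto
        finally show ?case by simp
      qed
    qed
    from tendsto_add[OF this tendsto_const[of 1]] show ?thesis by simp
  qed
  define e where "e j = crank_sum (r j) (q j) / (1 - q j) - 1 / (1 + q j ^ r j)\<^sup>2" for j
  have e: "(\<lambda>j. (1 + of_real (R j))\<^sup>2 * e j) \<longlonglongrightarrow> 0"
  proof (rule Lim_null_comparison)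
    have "(\<lambda>j. 4 * (1344 * sqrt (t j))) \<longlonglongrightarrow> 4 * (1344 * sqrt 0)" by (intro tendsto_intros t(3))
    thus "(\<lambda>j. 4 * (1344 * sqrt (t j))) \<longlonglongrightarrow> 0" by simp
    show "\<forall>\<^sub>F j in sequentially. norm ((1 + of_real (R j))\<^sup>2 * e j) \<le> 4 * (1344 * sqrt (t j))"
      using ev
    proof eventually_elim
      case (elim j)
      have "norm (e j) \<le> 1344 * sqrt (t j)"
        using crank_sum_approx[of "\<tau> j" "r j"] sector[OF elim] t(1,2)[of j] unfolding e_def q_def Re by simp
      moreover have "norm (1 + complex_of_real (R j)) \<le> 2" using norm_triangle_ineq[of 1 "complex_of_real (R j)"] R[of j] by simp
      hence "norm ((1 + complex_of_real (R j))\<^sup>2) \<le> 2\<^sup>2" unfolding norm_power by (intro power_mono) auto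
      ultimately show ?case unfolding norm_mult by (intro mult_mono) auto
    qed
  qed
  have "(\<lambda>j. exp (- of_real (a * s\<^sup>2) / (1 - \<i> * of_real (y j)) + \<delta> j) *
           ((1 - q j) / of_real (t j) * (((1 + of_real (R j)) / (1 + q j ^ r j))\<^sup>2 + (1 + of_real (R j))\<^sup>2 * e j)))
        \<longlonglongrightarrow> exp (- of_real (a * s\<^sup>2) / (1 - \<i> * of_real 0) + 0) * (1 * (1\<^sup>2 + 0))"
    by (intro tendsto_mult A B1 tendsto_add tendsto_power ratio e)
  hence lim: "(\<lambda>j. exp (- of_real (a * s\<^sup>2) / (1 - \<i> * of_real (y j)) + \<delta> j) *
           ((1 - q j) / of_real (t j) * (((1 + of_real (R j)) / (1 + q j ^ r j))\<^sup>2 + (1 + of_real (R j))\<^sup>2 * e j)))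
        \<longlonglongrightarrow> of_real (exp (- (a * s\<^sup>2)))"
    by (simp add: exp_of_real [symmetric])
  show ?thesis
  proof (rule Lim_transform_eventually[OF lim])
    show "\<forall>\<^sub>F j in sequentially. exp (- of_real (a * s\<^sup>2) / (1 - \<i> * of_real (y j)) + \<delta> j) *
           ((1 - q j) / of_real (t j) * (((1 + of_real (R j)) / (1 + q j ^ r j))\<^sup>2 + (1 + of_real (R j))\<^sup>2 * e j))
         = saddle_term (t j) (a / (t j)\<^sup>2) (r j) s"
      using ev
    proof eventually_elim
      case (elim j)
      define T Y where "T = complex_of_real (t j)" and "Y = complex_of_real (y j)"
      have T0: "T \<noteq> 0" using t0 by (simp add: T_def)
      have \<theta>: "t j * sqrt (t j) * s = t j * y j" by (simp add: y_def)
      have qj: "exp (- T) * exp (\<i> * complex_of_real (t j * y j)) = q j"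
        unfolding q_def exp_add [symmetric]
        by (rule arg_cong[where f = exp]) (simp add: \<tau>_def T_def complex_eq_iff)
      have q1: "1 - q j \<noteq> 0"
      proof -
        have "norm (q j) < 1" using t(1)[of j] by (simp add: q_def norm_exp_eq_Re Re)
        thus ?thesis by auto
      qed
      have nz: "1 + q j ^ r j \<noteq> 0" using ge[OF elim] by auto
      have crank: "((1 - q j) / T * (((1 + of_real (R j)) / (1 + q j ^ r j))\<^sup>2 + (1 + of_real (R j))\<^sup>2 * e j))
         = crank_sum (r j) (q j) * (1 + of_real (R j))\<^sup>2 / T"
      proof -
        have "((1 + of_real (R j)) / (1 + q j ^ r j))\<^sup>2 + (1 + of_real (R j))\<^sup>2 * e j
            = (1 + of_real (R j))\<^sup>2 * (crank_sum (r j) (q j) / (1 - q j))"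
          by (simp add: e_def power_divide right_diff_distrib)
        thus ?thesis using q1 by simp
      qed
      have "of_real a / \<tau> j - of_real a / T + \<delta> j - \<i> * complex_of_real (a / (t j)\<^sup>2 * (t j * y j)) = - of_real (a * s\<^sup>2) / (1 - \<i> * Y) + \<delta> j"
      proof -
        have U: "1 - \<i> * Y \<noteq> 0" using iy by (simp add: Y_def)
        have Y2: "Y\<^sup>2 = T * of_real (s\<^sup>2)"
          unfolding Y_def T_def of_real_power [symmetric] y2 by simp
        have "of_real a / \<tau> j = of_real a / T * (1 / (1 - \<i> * Y))" by (simp add: \<tau>t T_def Y_def)
        moreover have "\<i> * complex_of_real (a / (t j)\<^sup>2 * (t j * y j)) = of_real a / T * (\<i> * Y)"
          using t0[of j] by (simp add: T_def Y_def power2_eq_square)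
        ultimately have "of_real a / \<tau> j - of_real a / T - \<i> * complex_of_real (a / (t j)\<^sup>2 * (t j * y j))
            = of_real a / T * (1 / (1 - \<i> * Y) - 1 - \<i> * Y)" by (simp add: right_diff_distrib)
        \<comment> \<open>Exact remainder of the geometric series after two terms; Y^2 = T s^2 then
          cancels the large factor a / T.\<close>
        also have "1 / (1 - \<i> * Y) - 1 - \<i> * Y = - (Y\<^sup>2) / (1 - \<i> * Y)"
        proof -
          have "(1 / (1 - \<i> * Y) - 1 - \<i> * Y) * (1 - \<i> * Y) = 1 - (1 + \<i> * Y) * (1 - \<i> * Y)"
            using U by (simp add: left_diff_distrib distrib_right)
          also have "\<dots> = - (Y\<^sup>2)" by (simp add: algebra_simps power2_eq_square)
          finally show ?thesis using U nonzero_eq_divide_eq by blast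
        qed
        also have "of_real a / T * (- (Y\<^sup>2) / (1 - \<i> * Y)) = - of_real (a * s\<^sup>2) / (1 - \<i> * Y)"
          unfolding Y2 using T0 by simp
        finally show ?thesis by (simp add: algebra_simps)
      qed
      hence "exp (- of_real (a * s\<^sup>2) / (1 - \<i> * Y) + \<delta> j) =
           exp (of_real a / \<tau> j - of_real a / T + \<delta> j) * exp (- (\<i> * complex_of_real (a / (t j)\<^sup>2 * (t j * y j))))"
        by (simp only: exp_add [symmetric] diff_conv_add_uminus)
      also have "exp (of_real a / \<tau> j - of_real a / T + \<delta> j) = steady_gf (q j) / of_real (real_steady_gf (t j))"
        unfolding \<delta>(2)[OF elim] T_def by (simp add: less_imp_neq[OF real_steady_gf_pos, symmetric])
      finally have ex: "exp (- of_real (a * s\<^sup>2) / (1 - \<i> * Y) + \<delta> j) =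
         steady_gf (q j) / of_real (real_steady_gf (t j)) * exp (- (\<i> * complex_of_real (a / (t j)\<^sup>2 * (t j * y j))))" .
      show ?case
        unfolding saddle_term_def Let_def \<theta> T_def [symmetric] Y_def [symmetric] qj crank ex R_def [symmetric]
        by (simp add: T_def)
    qed
  qed
qed

section \<open>Assembling the asymptotic formula\<close>

lemma saddle_term_has_integral:
  fixes m n :: nat
  assumes mn: "m \<le> 2 * n" and t: "0 < t"
    and k: "real (min m (2 * n - m)) = k" and r: "nat \<bar>int n - int m\<bar> = r"
  shows "(saddle_term t k r has_integral
           of_real (2 * pi * of_int (D m n) * exp (- (t * k)) * (1 + exp (- t) ^ r)\<^sup>2 / (real_steady_gf t * t * (t * sqrt t))))
           {- (pi / (t * sqrt t))..pi / (t * sqrt t)}"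
proof -
  define K where "K = min m (2 * n - m)"
  have kK: "k = real K" using k by (simp add: K_def)
  define u where "u = t * sqrt t"
  have u: "u > 0" using t by (simp add: u_def)
  define C where "C = (1 + exp (- t) ^ r)\<^sup>2 / (real_steady_gf t * t)"
  define z where "z = (\<lambda>\<theta>. of_real (exp (- t)) * exp (\<i> * complex_of_real \<theta>))"
  have "((\<lambda>\<theta>. steady_gf (z \<theta>) * crank_sum r (z \<theta>) * exp (- (\<i> * of_nat K * complex_of_real \<theta>))) has_integral
            complex_of_real (2 * pi * (of_int (D m n) * exp (- t) ^ K))) {-pi..pi}"
    unfolding z_def K_def r [symmetric] using D_has_integral[OF _ _ mn, of "exp (- t)"] t by simp
  hence I: "((\<lambda>\<theta>. steady_gf (z \<theta>) * crank_sum r (z \<theta>) * exp (- (\<i> * of_nat K * complex_of_real \<theta>)) * of_real C) has_integral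
            (complex_of_real (2 * pi * (of_int (D m n) * exp (- t) ^ K)) * complex_of_real C)) {-pi..pi}"
    by (rule has_integral_mult_left)
  have "((\<lambda>s. steady_gf (z (u * s)) * crank_sum r (z (u * s)) * exp (- (\<i> * of_nat K * complex_of_real (u * s))) * of_real C) has_integral
            (1 / \<bar>u\<bar>) *\<^sub>R (complex_of_real (2 * pi * (of_int (D m n) * exp (- t) ^ K)) * complex_of_real C)) ((\<lambda>x. x / u) ` {-pi..pi})"
    by (rule has_integral_stretch_real[OF I]) (use u in simp)
  moreover have "(\<lambda>x. x / u) ` {-pi..pi} = {- (pi / u)..pi / u}"
  proof -
    have "(\<lambda>x. x / u) ` {-pi..pi} = (\<lambda>x. inverse u * x) ` {-pi..pi}" by (simp add: field_simps)
    also have "\<dots> = {inverse u * (-pi)..inverse u * pi}" using u by (subst image_mult_atLeastAtMost) auto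
    finally show ?thesis by (simp add: divide_inverse mult.commute)
  qed
  moreover have "(\<lambda>s. steady_gf (z (u * s)) * crank_sum r (z (u * s)) * exp (- (\<i> * of_nat K * complex_of_real (u * s))) * of_real C) = saddle_term t k r"
    by (simp add: fun_eq_iff saddle_term_def Let_def z_def u_def C_def kK exp_of_real [symmetric] mult_ac)
  moreover have "(1 / \<bar>u\<bar>) *\<^sub>R (complex_of_real (2 * pi * (of_int (D m n) * exp (- t) ^ K)) * complex_of_real C) =
      of_real (2 * pi * of_int (D m n) * exp (- (t * k)) * (1 + exp (- t) ^ r)\<^sup>2 / (real_steady_gf t * t * (t * sqrt t)))"
  proof -
    have "exp (- t) ^ K = exp (- (t * k))" by (simp add: kK exp_of_nat_mult [symmetric] mult.commute)
    thus ?thesis using u by (simp add: scaleR_conv_of_real C_def u_def mult_ac)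
  qed
  ultimately show ?thesis unfolding u_def by simp
qed

text \<open>Majorant and pointwise limit do not depend on r, so dominated convergence gives
  \<open>V\<close> the limit sqrt (pi / a) however m and n vary. Multiplying by
  \<open>real_steady_gf_asymp\<close> produces the required quotient exactly, without a further
  limit, because k = a / t^2 and the exponential involving |n - m| is exp (- t r).\<close>

lemma D_asymp_sequence:
  fixes m n :: "nat \<Rightarrow> nat"
  assumes mn: "\<And>j. m j \<le> 2 * n j" and k5: "\<And>j. min (m j) (2 * n j - m j) \<ge> 5"
    and lim: "filterlim (\<lambda>j. min (m j) (2 * n j - m j)) at_top sequentially"
  defines "c \<equiv> 2 * pi * sqrt (5 / 12)" and "k \<equiv> \<lambda>j. real (min (m j) (2 * n j - m j))"
  shows "(\<lambda>j. real_of_int (D (m j) (n j)) /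
                (5 * c / (2 ^ 5 * 3) * (exp (c * sqrt (k j)) / k j ^ 2)
                  * (1 + exp (- (c * \<bar>real (n j) - real (m j)\<bar> / (2 * sqrt (k j))))) powi (- 2))) \<longlonglongrightarrow> 1"
proof -
  define a where "a = 5 * pi\<^sup>2 / 12"
  define t where "t j = sqrt (a / k j)" for j
  define r where "r j = nat \<bar>int (n j) - int (m j)\<bar>" for j
  define u where "u j = t j * sqrt (t j)" for j
  define R where "R j = exp (- t j) ^ r j" for j
  \<comment> \<open>Together with \<open>k5\<close> this gives t \<le> 1, as the estimates above
    require.\<close>
  have a: "0 < a" "a \<le> 5"
  proof -
    show "0 < a" by (simp add: a_def)
    show "a \<le> 5" using pi_squared_le_10 by (simp add: a_def)
  qed
  have k: "k j \<ge> 5" for j using k5[of j] by (simp add: k_def)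
  have t: "0 < t j" "t j \<le> 1" for j
  proof -
    show "0 < t j" using a k[of j] by (simp add: t_def)
    have "a / k j \<le> 1" using a k[of j] by simp
    thus "t j \<le> 1" by (simp add: t_def)
  qed
  have t2: "(t j)\<^sup>2 = a / k j" for j using a k[of j] by (simp add: t_def)
  have kt: "k j = a / (t j)\<^sup>2" for j unfolding t2 using a k[of j] by simp
  have kinf: "filterlim k at_top sequentially"
    unfolding k_def by (rule filterlim_compose[OF filterlim_real_sequentially lim])
  have t0: "t \<longlonglongrightarrow> 0"
  proof -
    have "(\<lambda>j. sqrt (a / k j)) \<longlonglongrightarrow> sqrt 0"
      by (intro tendsto_real_sqrt real_tendsto_divide_at_top[OF tendsto_const kinf])
    thus ?thesis by (simp add: t_def [abs_def])
  qed
  define S where "S j = {- (pi / u j)..pi / u j}" for j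
  define V where "V j = 2 * pi * of_int (D (m j) (n j)) * exp (- (t j * k j)) * (1 + R j)\<^sup>2 / (real_steady_gf (t j) * t j * u j)" for j
  define f where "f j s = (if s \<in> S j then saddle_term (t j) (k j) (r j) s else 0)" for j s
  have u0: "u j > 0" for j using t(1)[of j] by (simp add: u_def)
  have f: "(f j has_integral of_real (V j)) UNIV" for j
  proof -
    have "(saddle_term (t j) (k j) (r j) has_integral of_real (V j)) (S j)"
      unfolding V_def R_def S_def u_def by (rule saddle_term_has_integral) (auto simp: mn t k_def r_def)
    thus ?thesis unfolding f_def has_integral_restrict_UNIV .
  qed
  define B :: real where "B = 176 * (105 / 2) ^ 5 + 113232"
  define g where "g s = complex_of_real (exp (- (a * s\<^sup>2)))" for s
  have "(\<lambda>j. integral UNIV (f j)) \<longlonglongrightarrow> integral UNIV g"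
  proof (rule dominated_convergence(2))
    show "f j integrable_on UNIV" for j using f by blast
    show "(\<lambda>s. B * (1 / (1 + s\<^sup>2))) integrable_on UNIV"
      by (intro integrable_on_mult_right inverse_quadratic_integrable_on)
    fix s :: real
    show "norm (f j s) \<le> B * (1 / (1 + s\<^sup>2))" for j
    proof (cases "s \<in> S j")
      case True
      hence "\<bar>s\<bar> \<le> pi / u j" by (auto simp: S_def)
      hence "\<bar>u j * s\<bar> \<le> pi" using u0[of j] by (simp add: abs_mult field_simps)
      thus ?thesis using norm_saddle_term_le[OF t] True by (simp add: f_def B_def u_def)
    next
      case False
      thus ?thesis by (simp add: f_def B_def add_nonneg_nonneg)
    qed
    show "(\<lambda>j. f j s) \<longlonglongrightarrow> g s"
    proof (rule Lim_transform_eventually)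
      show "(\<lambda>j. saddle_term (t j) (k j) (r j) s) \<longlonglongrightarrow> g s"
        unfolding g_def kt a_def by (rule saddle_term_tendsto[OF t t0])
      have "(\<lambda>j. u j * \<bar>s\<bar>) \<longlonglongrightarrow> 0 * sqrt 0 * \<bar>s\<bar>" unfolding u_def by (intro tendsto_intros t0)
      hence "\<forall>\<^sub>F j in sequentially. u j * \<bar>s\<bar> < pi" by (rule order_tendstoD) simp
      thus "\<forall>\<^sub>F j in sequentially. saddle_term (t j) (k j) (r j) s = f j s"
      proof eventually_elim
        case (elim j)
        hence "\<bar>s\<bar> \<le> pi / u j" using u0[of j] by (simp add: field_simps)
        hence "s \<in> S j" unfolding S_def by auto
        thus ?case by (simp add: f_def)
      qed
    qed
  qed
  moreover have "integral UNIV g = of_real (sqrt (pi / a))"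
    unfolding g_def by (intro integral_unique has_integral_of_real gaussian_has_integral a)
  ultimately have "(\<lambda>j. complex_of_real (V j)) \<longlonglongrightarrow> of_real (sqrt (pi / a))"
    using integral_unique[OF f] by simp
  hence V: "V \<longlonglongrightarrow> sqrt (pi / a)" by (simp add: tendsto_of_real_iff)
  define G where "G t = exp (5 * pi\<^sup>2 / 12 / t) * (t / (2 * pi)) * sqrt (t / pi)" for t
  have "filterlim t (at_right 0) sequentially"
  proof -
    have "t j \<in> {0<..} \<and> t j \<noteq> 0" for j using t(1)[of j] by auto
    thus ?thesis using t0 by (simp add: filterlim_at)
  qed
  from filterlim_compose[OF real_steady_gf_asymp this]
  have W: "(\<lambda>j. real_steady_gf (t j) / G (t j)) \<longlonglongrightarrow> 1" by (simp only: G_def)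
  have "(\<lambda>j. V j / sqrt (pi / a) * (real_steady_gf (t j) / G (t j))) \<longlonglongrightarrow> sqrt (pi / a) / sqrt (pi / a) * 1"
    using a by (intro tendsto_intros V W) auto
  hence L: "(\<lambda>j. V j / sqrt (pi / a) * (real_steady_gf (t j) / G (t j))) \<longlonglongrightarrow> 1" using a by simp
  have c: "c = 2 * sqrt a"
  proof -
    have "sqrt a = sqrt (pi\<^sup>2 * (5 / 12))" by (simp add: a_def)
    also have "\<dots> = pi * sqrt (5 / 12)" by (simp only: real_sqrt_mult real_sqrt_pow2_iff) simp
    finally show ?thesis by (simp add: c_def)
  qed
  have "V j / sqrt (pi / a) * (real_steady_gf (t j) / G (t j)) = real_of_int (D (m j) (n j)) /
                (5 * c / (2 ^ 5 * 3) * (exp (c * sqrt (k j)) / k j ^ 2)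
                  * (1 + exp (- (c * \<bar>real (n j) - real (m j)\<bar> / (2 * sqrt (k j))))) powi (- 2))" for j
  proof -
    define T d where "T = t j" and "d = real_of_int (D (m j) (n j))"
    have T: "T > 0" using t by (simp add: T_def)
    have sk: "sqrt (k j) = sqrt a / T"
      unfolding kt T_def [symmetric] using T by (simp add: real_sqrt_divide)
    have sa: "sqrt a > 0" "sqrt a * sqrt a = a" using a by auto
    have ck: "c * sqrt (k j) = 2 * (a / T)"
      unfolding c sk using sa(2) by simp
    have "c * \<bar>real (n j) - real (m j)\<bar> / (2 * sqrt (k j)) = T * real (r j)"
    proof -
      have "\<bar>real (n j) - real (m j)\<bar> = real (r j)" by (simp add: r_def)
      thus ?thesis unfolding c sk using sa T by (simp add: field_simps)
    qed
    hence e: "exp (- (c * \<bar>real (n j) - real (m j)\<bar> / (2 * sqrt (k j)))) = R j"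
      by (simp add: R_def T_def exp_of_nat_mult [symmetric] mult.commute)
    have R: "1 + R j > 0" by (simp add: R_def add_pos_pos)
    have pw: "(1 + R j) powi (- 2) = 1 / (1 + R j)\<^sup>2" by (simp add: power_int_minus field_simps)
    have tk: "t j * k j = a / T"
      unfolding kt T_def using t(1)[of j] by (simp add: power2_eq_square)
    have P: "real_steady_gf T \<noteq> 0" using real_steady_gf_pos[of T] by linarith
    define X where "X = exp (a / T)"
    have X: "X > 0" by (simp add: X_def)
    have G: "G T = X * (T / (2 * pi)) * (sqrt T / sqrt pi)"
      by (simp add: G_def X_def a_def real_sqrt_divide)
    have ek: "exp (- (t j * k j)) = 1 / X" by (simp add: tk X_def exp_minus inverse_eq_divide)
    have ec: "exp (c * sqrt (k j)) = X\<^sup>2" unfolding ck X_def by (rule exp_double)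
    have sT: "sqrt T > 0" "sqrt T * sqrt T = T" using T by auto
    have sp: "sqrt pi > 0" "sqrt (pi / a) = sqrt pi / sqrt a" by (auto simp: real_sqrt_divide)
    have "V j / sqrt (pi / a) * (real_steady_gf (t j) / G (t j)) =
      2 * pi * d * (1 / X) * (1 + R j)\<^sup>2 / (real_steady_gf T * T * (T * sqrt T)) / (sqrt pi / sqrt a) *
        (real_steady_gf T / (X * (T / (2 * pi)) * (sqrt T / sqrt pi)))"
      unfolding V_def u_def ek sp unfolding T_def [symmetric] d_def [symmetric] G ..
    also have "\<dots> = 4 * pi\<^sup>2 * sqrt a * d * (1 + R j)\<^sup>2 / (X\<^sup>2 * (T ^ 3 * (sqrt T * sqrt T)))"
    proof -
      \<comment> \<open>Here w, p and b stand for the square roots of T, pi and a; as plain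
        variables they keep \<open>field_simps\<close> away from rules for
        \<open>sqrt\<close>.\<close>
      have "2 * pi * d * (1 / X) * Q / (P * T * (T * w)) / (p / b) * (P / (X * (T / (2 * pi)) * (w / p)))
          = 4 * pi\<^sup>2 * b * d * Q / (X\<^sup>2 * (T ^ 3 * (w * w)))"
        if "P \<noteq> 0" "X \<noteq> 0" "T \<noteq> 0" "w \<noteq> 0" "p \<noteq> 0" "b \<noteq> 0" for P X T w p b Q :: real
        using that by (simp add: field_simps power2_eq_square power3_eq_cube)
      thus ?thesis using P X T sT(1) sp(1) sa(1) by (metis less_irrefl)
    qed
    also have "T ^ 3 * (sqrt T * sqrt T) = T ^ 4" unfolding sT by (simp add: eval_nat_numeral)
    also have "4 * pi\<^sup>2 * sqrt a * d * (1 + R j)\<^sup>2 / (X\<^sup>2 * T ^ 4) =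
       d / (5 * (2 * sqrt a) / (2 ^ 5 * 3) * (X\<^sup>2 / (a / T\<^sup>2) ^ 2) * (1 / (1 + R j)\<^sup>2))"
    proof -
      \<comment> \<open>With c = 2 sqrt a, this identity matches the Gaussian constants to the
        factor 5 c / 96 of the claim.\<close>
      have "a\<^sup>2 / (10 * sqrt a / 96) = 4 * pi\<^sup>2 * sqrt a"
      proof -
        have "a * a = (sqrt a * sqrt a) * (5 * pi\<^sup>2 / 12)" unfolding sa(2) by (simp add: a_def)
        thus ?thesis using sa(1) by (simp add: power2_eq_square field_simps)
      qed
      moreover have "d / (5 * (2 * sqrt a) / (2 ^ 5 * 3) * (X\<^sup>2 / (a / T\<^sup>2) ^ 2) * (1 / (1 + R j)\<^sup>2))
         = a\<^sup>2 / (10 * sqrt a / 96) * d * (1 + R j)\<^sup>2 / (X\<^sup>2 * T ^ 4)"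
      proof -
        have "(a / T\<^sup>2) ^ 2 = a\<^sup>2 / T ^ 4" by (simp add: power_divide)
        thus ?thesis by (simp add: mult_ac)
      qed
      ultimately show ?thesis by simp
    qed
    finally show ?thesis unfolding e pw ec unfolding kt c d_def T_def .
  qed
  with L show ?thesis by simp
qed

theorem theorem1p2:
  fixes c :: real
  assumes c_eq: "c = 2 * pi * sqrt (5 / 12)"
  shows "\<forall>\<epsilon>::real. \<epsilon> > 0 \<longrightarrow> (\<exists>N::nat. \<forall>m n::nat.
           m > 0 \<longrightarrow> n > 0 \<longrightarrow> m \<le> 2 * n \<longrightarrow> min m (2 * n - m) \<ge> N \<longrightarrow>
           (let k = real (min m (2 * n - m)) in
             \<bar>real_of_int (D m n) /
                (5 * c / (2 ^ 5 * 3) * (exp (c * sqrt k) / k ^ 2)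
                  * (1 + exp (- (c * \<bar>real n - real m\<bar> / (2 * sqrt k)))) powi (- 2))
              - 1\<bar> \<le> \<epsilon>))"
proof (intro allI impI, rule ccontr)
  fix \<epsilon> :: real assume \<epsilon>: "\<epsilon> > 0"
  define Q where "Q m n = (let k = real (min m (2 * n - m)) in
             real_of_int (D m n) /
                (5 * c / (2 ^ 5 * 3) * (exp (c * sqrt k) / k ^ 2)
                  * (1 + exp (- (c * \<bar>real n - real m\<bar> / (2 * sqrt k)))) powi (- 2)))" for m n
  assume "\<not> (\<exists>N::nat. \<forall>m n::nat.
           m > 0 \<longrightarrow> n > 0 \<longrightarrow> m \<le> 2 * n \<longrightarrow> min m (2 * n - m) \<ge> N \<longrightarrow>
           (let k = real (min m (2 * n - m)) in
             \<bar>real_of_int (D m n) /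
                (5 * c / (2 ^ 5 * 3) * (exp (c * sqrt k) / k ^ 2)
                  * (1 + exp (- (c * \<bar>real n - real m\<bar> / (2 * sqrt k)))) powi (- 2))
              - 1\<bar> \<le> \<epsilon>))"
  hence "\<forall>N. \<exists>m n. m \<le> 2 * n \<and> min m (2 * n - m) \<ge> N \<and> \<not> \<bar>Q m n - 1\<bar> \<le> \<epsilon>"
    unfolding Q_def Let_def by blast
  \<comment> \<open>The shift by 5 makes every member of the sequence, not just almost all, satisfy
    \<open>k5\<close>.\<close>
  hence "\<forall>j. \<exists>m n. m \<le> 2 * n \<and> min m (2 * n - m) \<ge> j + 5 \<and> \<not> \<bar>Q m n - 1\<bar> \<le> \<epsilon>" by blast
  then obtain m n where mn: "\<And>j. m j \<le> 2 * n j" "\<And>j. min (m j) (2 * n j - m j) \<ge> j + 5"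
    "\<And>j. \<not> \<bar>Q (m j) (n j) - 1\<bar> \<le> \<epsilon>"
    by metis
  have "(\<lambda>j. Q (m j) (n j)) \<longlonglongrightarrow> 1"
    unfolding Q_def Let_def c_eq
  proof (rule D_asymp_sequence[OF mn(1)])
    show "min (m j) (2 * n j - m j) \<ge> 5" for j using mn(2)[of j] by linarith
    show "filterlim (\<lambda>j. min (m j) (2 * n j - m j)) at_top sequentially"
      unfolding filterlim_at_top
    proof
      fix z :: nat
      show "\<forall>\<^sub>F j in sequentially. z \<le> min (m j) (2 * n j - m j)"
        using eventually_ge_at_top[of z] by eventually_elim (use mn(2) in \<open>meson le_add1 order_trans\<close>)
    qed
  qed
  hence "\<forall>\<^sub>F j in sequentially. dist (Q (m j) (n j)) 1 < \<epsilon>" using \<epsilon> by (rule tendstoD)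
  then obtain j where "dist (Q (m j) (n j)) 1 < \<epsilon>" by (auto simp: eventually_sequentially)
  with mn(3)[of j] show False by (simp add: dist_real_def)
qed

end
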